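(* Let $(s,t)\in I\times J$ with $X(s,t)\in U$, and put $x=X(s,t)$ (so that $t=t(s,x)$). Below, $\frac{\partial}{\partial s}\delta$ and $\frac{\partial^2}{\partial s^2}\delta$ denote the first and second derivatives of $s\mapsto\delta(s,t(s,x))$ with $x$ fixed, evaluated at this point. (1) If $\delta(s,t)=0$ but $\frac{\partial}{\partial s}\delta(s,t)\neq 0$, then the image of the improper affine map $q$ is a cuspidal edge at $q(s,t)$. (2) If $\delta(s,t)=\frac{\partial}{\partial s}\delta(s,t)=0$ but $\frac{\partial^2}{\partial s^2}\delta(s,t)\neq 0$, then the image of $q$ is a swallowtail at $q(s,t)$.
   Context: For $u,v\in\mathbb{R}^2$, $[u,v]$ is the determinant of the matrix with columns $u,v$. Let $\Omega\subset\mathbb{R}^2$ be a simply connected domain with coordinates $(s,t)$ and let $A,B,C,D:\Omega\to\mathbb{R}$ be such that $A-iD$ and $B+iC$ are holomorphic functions of $s+it$, i.e. $A_s=-D_t$, $A_t=D_s$, $B_s=C_t$, $B_t=-C_s$. Put $X(s,t)=(A(s,t),B(s,t))$ (the planar map, written $x(s,t)$ in the source), $c(s,t)=(-D(s,t),C(s,t))$, $\delta(s,t)=[X_s,X_t]$. Let $g:\Omega\to\mathbb{R}$ satisfy $g_s=[X_s,c]$, $g_t=[X_t,c]$ (unique up to an additive constant). The map $q=(X,g):\Omega\to\mathbb{R}^3$ is called a (convex) improper affine map. Let $S=\{\delta=0\}\subset\Omega$ be the singular set, and assume $(\delta_s,\delta_t)\neq(0,0)$ on $S$. Standing assumptions: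 fix $(s_0,t_0)\in S$ with $\delta_t(s_0,t_0)\neq0$, $X_t(s_0,t_0)\ne 0$ and $[X_t(s_0,t_0),c(s_0,t_0)]\neq0$; put $x_0=X(s_0,t_0)$. Then there are open neighborhoods $I$ of $s_0$, $J$ of $t_0$, $U\subset\mathbb{R}^2$ of $x_0$ and a smooth function $t:I\times U\to J$ such that, for $(s,t,x)\in I\times J\times U$, $[x-X(s,t),c(s,t)]=0$ if and only if $t=t(s,x)$. The neighborhoods $I,J,U$ are taken sufficiently small (they may be chosen arbitrarily small). A subset of $\mathbb{R}^3$ (the image under $q$ of a small neighborhood of the point $(s,t)$) is a cuspidal edge, respectively a swallowtail, at $p$ if its germ at $p$ is carried by a local diffeomorphism of $\mathbb{R}^3$ sending $p$ to $0$ to the germ at $0$ of $\{(u,v^2,v^3)\}$, respectively of $\{(3v^4+uv^2,\,4v^3+2uv,\,u)\}$, $(u,v)\in\mathbb{R}^2$. *)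

theory Defs
  imports "HOL-Analysis.Analysis"
begin

type_synonym plane = "real \<times> real"
type_synonym space = "real \<times> real \<times> real"

definition bracket :: "plane \<Rightarrow> plane \<Rightarrow> real" where
  "bracket u v = det (vector [vector [fst u, fst v], vector [snd u, snd v]] :: real^2^2)"

definition partial_s :: "(plane \<Rightarrow> 'a::real_normed_vector) \<Rightarrow> plane \<Rightarrow> 'a" where
  "partial_s f p = vector_derivative (\<lambda>s. f (s, snd p)) (at (fst p))"

definition partial_t :: "(plane \<Rightarrow> 'a::real_normed_vector) \<Rightarrow> plane \<Rightarrow> 'a" where
  "partial_t f p = vector_derivative (\<lambda>t. f (fst p, t)) (at (snd p))"


text \<open>Both notions are meant for an open set. In finite dimension, continuity of all
  directional derivatives is the same as continuity of the Frechet derivative.\<close>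

primrec Ck_on :: "nat \<Rightarrow> 'a::real_normed_vector set \<Rightarrow> ('a \<Rightarrow> 'b::real_normed_vector) \<Rightarrow> bool" where
  "Ck_on 0 S f \<longleftrightarrow> continuous_on S f"
| "Ck_on (Suc k) S f \<longleftrightarrow>
     (\<forall>x\<in>S. f differentiable (at x)) \<and> (\<forall>v. Ck_on k S (\<lambda>x. frechet_derivative f (at x) v))"

definition smooth_on :: "'a::real_normed_vector set \<Rightarrow> ('a \<Rightarrow> 'b::real_normed_vector) \<Rightarrow> bool" where
  "smooth_on S f \<longleftrightarrow> (\<forall>k. Ck_on k S f)"

definition diffeomorphism ::
  "'a::real_normed_vector set \<Rightarrow> 'b::real_normed_vector set \<Rightarrow> ('a \<Rightarrow> 'b) \<Rightarrow> bool" where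
  "diffeomorphism V W \<Phi> \<longleftrightarrow>
     open V \<and> open W \<and> bij_betw \<Phi> V W \<and> smooth_on V \<Phi> \<and> smooth_on W (inv_into V \<Phi>)"


definition diffeomorphic_germs :: "space set \<Rightarrow> space \<Rightarrow> space set \<Rightarrow> space \<Rightarrow> bool" where
  "diffeomorphic_germs M p N r \<longleftrightarrow>
     (\<exists>V W \<Phi>. diffeomorphism V W \<Phi> \<and> p \<in> V \<and> \<Phi> p = r \<and> \<Phi> ` (M \<inter> V) = N \<inter> W)"

definition cuspidal_edge_at :: "space set \<Rightarrow> space \<Rightarrow> bool" where
  "cuspidal_edge_at M p \<longleftrightarrow>
     diffeomorphic_germs M p (range (\<lambda>(u, v). (u, v^2, v^3))) (0, 0, 0)"

definition swallowtail_at :: "space set \<Rightarrow> space \<Rightarrow> bool" where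
  "swallowtail_at M p \<longleftrightarrow>
     diffeomorphic_germs M p
       (range (\<lambda>(u, v). (3 * v^4 + u * v^2, 4 * v^3 + 2 * u * v, u))) (0, 0, 0)"

text \<open>\<open>q\<close> may have other preimages of \<open>q p\<close> far from \<open>p\<close>, so the image that is classified is
  that of every sufficiently small neighbourhood of \<open>p\<close>.\<close>

definition small_images :: "plane set \<Rightarrow> (plane \<Rightarrow> space) \<Rightarrow> plane \<Rightarrow> (space set \<Rightarrow> bool) \<Rightarrow> bool" where
  "small_images \<Omega> q p P \<longleftrightarrow>
     (\<exists>N0. open N0 \<and> p \<in> N0 \<and> N0 \<subseteq> \<Omega> \<and> (\<forall>N. open N \<and> p \<in> N \<and> N \<subseteq> N0 \<longrightarrow> P (q ` N)))"


definition planar_map :: "(plane \<Rightarrow> real) \<Rightarrow> (plane \<Rightarrow> real) \<Rightarrow> plane \<Rightarrow> plane" where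
  "planar_map A B p = (A p, B p)"

definition conormal :: "(plane \<Rightarrow> real) \<Rightarrow> (plane \<Rightarrow> real) \<Rightarrow> plane \<Rightarrow> plane" where
  "conormal C D p = (- D p, C p)"

definition jac_det :: "(plane \<Rightarrow> plane) \<Rightarrow> plane \<Rightarrow> real" where
  "jac_det X p = bracket (partial_s X p) (partial_t X p)"

text \<open>The improper affine map \<open>q = (X, g)\<close> with \<open>X = (A, B)\<close>.\<close>

definition affine_map ::
  "(plane \<Rightarrow> real) \<Rightarrow> (plane \<Rightarrow> real) \<Rightarrow> (plane \<Rightarrow> real) \<Rightarrow> plane \<Rightarrow> space" where
  "affine_map A B g p = (A p, B p, g p)"

definition improper_affine_data ::
  "plane set \<Rightarrow> (plane \<Rightarrow> real) \<Rightarrow> (plane \<Rightarrow> real) \<Rightarrow> (plane \<Rightarrow> real) \<Rightarrow> (plane \<Rightarrow> real) \<Rightarrow>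
     (plane \<Rightarrow> real) \<Rightarrow> bool" where
  "improper_affine_data \<Omega> A B C D g \<longleftrightarrow>
     open \<Omega> \<and> connected \<Omega> \<and> simply_connected \<Omega> \<and>
     (\<lambda>z. Complex (A (Re z, Im z)) (- D (Re z, Im z))) holomorphic_on {z. (Re z, Im z) \<in> \<Omega>} \<and>
     (\<lambda>z. Complex (B (Re z, Im z)) (C (Re z, Im z))) holomorphic_on {z. (Re z, Im z) \<in> \<Omega>} \<and>
     (\<forall>(s, t)\<in>\<Omega>.
        ((\<lambda>s'. g (s', t)) has_real_derivative
           bracket (partial_s (planar_map A B) (s, t)) (conormal C D (s, t))) (at s) \<and>
        ((\<lambda>t'. g (s, t')) has_real_derivative
           bracket (partial_t (planar_map A B) (s, t)) (conormal C D (s, t))) (at t))"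

text \<open>\<open>\<tau>\<close> is the smooth function written \<open>t(s, x)\<close>; it solves \<open>[x - X(s, t), c(s, t)] = 0\<close>
  for \<open>t\<close> on the neighbourhoods \<open>I\<close>, \<open>J\<close>, \<open>U\<close>.\<close>

definition implicit_solution ::
  "(plane \<Rightarrow> plane) \<Rightarrow> (plane \<Rightarrow> plane) \<Rightarrow> real set \<Rightarrow> real set \<Rightarrow> plane set \<Rightarrow>
     (real \<times> plane \<Rightarrow> real) \<Rightarrow> bool" where
  "implicit_solution X c I J U \<tau> \<longleftrightarrow>
     smooth_on (I \<times> U) \<tau> \<and> \<tau> ` (I \<times> U) \<subseteq> J \<and>
     (\<forall>s\<in>I. \<forall>t\<in>J. \<forall>x\<in>U. bracket (x - X (s, t)) (c (s, t)) = 0 \<longleftrightarrow> t = \<tau> (s, x))"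

end

theory Submission
  imports Defs "HOL-Complex_Analysis.Complex_Analysis" "HOL-Library.Landau_Symbols"
begin

text \<open>
  Put \<open>F = A - i D\<close> and \<open>G = B + i C\<close>, holomorphic in \<open>z = s + i t\<close>. Then \<open>X + i c = (F, G)\<close>, and
  \<open>dg = Im G dRe F - Im F dRe G\<close>. Near a point \<open>p\<close> where \<open>F' \<noteq> 0\<close> the function \<open>F\<close> is a coordinate.
  Let \<open>\<omega> = F z - F p = u + i v\<close> and let \<open>K\<close> be the primitive, vanishing at \<open>0\<close>, of \<open>G - Re (G p)\<close> as a
  function of \<open>\<omega>\<close>. Up to an affine change of the target, the improper affine map becomes
  \<open>\<omega> \<mapsto> (u, \<phi>\<^sub>v, \<phi> - v \<phi>\<^sub>v)\<close> with the harmonic function \<open>\<phi>(u, v) = Im K(u + i v)\<close>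
  (\<open>legendre_normal_form\<close>). Hence its image is the discriminant of the family of functions
  \<open>v \<mapsto> \<phi>(u, v) - y v - z\<close>: the set of parameters \<open>(u, y, z)\<close> at which the function has a double zero.

  In these terms \<open>\<delta> = -|F'|\<^sup>2 Im K''\<close>. The curve \<open>s' \<mapsto> (s', t(s', x))\<close> on which \<open>[x - X, c] = 0\<close> passes
  through \<open>p\<close> in the direction of the kernel of \<open>dX\<close>, which is the \<open>v\<close>-direction; the second derivative of
  its \<open>u\<close>-component vanishes there too as soon as \<open>Re K''' = 0\<close>. Therefore the first and second derivative of
  \<open>\<delta>\<close> along it are, up to nonzero factors, \<open>Re K'''\<close> and \<open>Im K''''\<close> (\<open>caustic_jets_along_curve\<close>), that
  is, \<open>\<phi>\<^sub>v\<^sub>v\<^sub>v\<close> and \<open>\<phi>\<^sub>v\<^sub>v\<^sub>v\<^sub>v\<close>. Since \<open>\<phi>\<close> and \<open>\<phi>\<^sub>v\<close> vanish at \<open>0\<close> and \<open>\<delta> = 0\<close> means \<open>\<phi>\<^sub>v\<^sub>v = 0\<close>, the hypotheses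
  of the first part say that \<open>\<phi>(0, v)\<close> has a zero of order three at \<open>v = 0\<close>, those of the second part
  that it has a zero of order four; there the condition \<open>d\<delta> \<noteq> 0\<close> says \<open>\<phi>\<^sub>u\<^sub>v\<^sub>v \<noteq> 0\<close>.

  It remains to see that the family is a versal unfolding of that zero. A Weierstrass preparation
  with smooth dependence on the parameters writes the family as a nonvanishing factor times
  \<open>(v - m)^3 - 3 Y (v - m) + 2 Z\<close>, respectively \<open>(v - m)^4 + b (v - m)^2 - Y (v - m) + Z\<close>, where the
  coefficients are functions of \<open>(u, y, z)\<close>, and \<open>(u, Y, Z)\<close>, respectively \<open>(Z, Y, b)\<close>, are local
  coordinates of the target. A nonvanishing factor does not change double zeros, and the
  polynomials with a double zero are exactly the standard cuspidal edge and swallowtail.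

  The preparation comes from a division with parameters (\<open>analytic_division\<close>). Because \<open>\<phi>\<close> is the
  imaginary part of a holomorphic function, Cauchy's formula makes it a superposition of simple
  fractions \<open>1 / (a - v)\<close>; these can be divided by any polynomial explicitly, and integrating over the
  circle gives remainder and quotient that depend smoothly on the coefficients of the divisor. The
  coefficients for which the remainder has the prescribed form \<open>z + y v\<close> are then found with the
  inverse function theorem (\<open>discriminant_germ\<close>).
\<close>

section \<open>Functions with continuous derivatives\<close>

lemma Ck_on_SucI:
  assumes "\<And>x. x \<in> S \<Longrightarrow> (f has_derivative f' x) (at x)"
    and "\<And>v. Ck_on k S (\<lambda>x. frechet_derivative f (at x) v)"
  shows "Ck_on (Suc k) S f"
proof -
  have "f differentiable (at x)" if "x \<in> S" for x
    using assms(1)[OF that] unfolding differentiable_def by blast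
  then show ?thesis using assms(2) by simp
qed

lemma Ck_on_cong:
  assumes "open S" "\<And>x. x \<in> S \<Longrightarrow> f x = g x" "Ck_on k S f"
  shows "Ck_on k S g"
  using assms(2,3)
proof (induction k arbitrary: f g)
  case 0
  have "continuous_on S f \<longleftrightarrow> continuous_on S g"
    by (rule continuous_on_cong) (use 0 in auto)
  with 0 show ?case by simp
next
  case (Suc k)
  have d: "(g has_derivative frechet_derivative f (at x)) (at x)" if "x \<in> S" for x
  proof -
    have "(f has_derivative frechet_derivative f (at x)) (at x)"
      using Suc.prems(2) that frechet_derivative_works by auto
    then show ?thesis
      using has_derivative_transform_within_open[OF _ \<open>open S\<close> that] Suc.prems(1) by blast
  qed
  have e: "frechet_derivative g (at x) = frechet_derivative f (at x)" if "x \<in> S" for x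
    using frechet_derivative_at[OF d[OF that]] by simp
  show ?case
  proof (rule Ck_on_SucI[OF d])
    fix v show "Ck_on k S (\<lambda>x. frechet_derivative g (at x) v)"
      by (rule Suc.IH[of "\<lambda>x. frechet_derivative f (at x) v"]) (use e Suc.prems in auto)
  qed
qed

lemma Ck_on_SucI':
  assumes "open S" "\<And>x. x \<in> S \<Longrightarrow> (f has_derivative f' x) (at x)"
    and "\<And>v. Ck_on k S (\<lambda>x. f' x v)"
  shows "Ck_on (Suc k) S f"
proof (rule Ck_on_SucI[OF assms(2)])
  fix v show "Ck_on k S (\<lambda>x. frechet_derivative f (at x) v)"
  proof (rule Ck_on_cong[OF assms(1) _ assms(3)[of v]])
    show "f' x v = frechet_derivative f (at x) v" if "x \<in> S" for x
      using frechet_derivative_at[OF assms(2)[OF that]] by simp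
  qed
qed

lemma Ck_on_Suc_has_derivative:
  "Ck_on (Suc k) S f \<Longrightarrow> x \<in> S \<Longrightarrow> (f has_derivative frechet_derivative f (at x)) (at x)"
  by (simp add: frechet_derivative_works)

lemma Ck_on_subset: "Ck_on k S f \<Longrightarrow> T \<subseteq> S \<Longrightarrow> Ck_on k T f"
proof (induction k arbitrary: f)
  case 0
  then show ?case using continuous_on_subset by auto
next
  case (Suc k)
  have "Ck_on k T (\<lambda>x. frechet_derivative f (at x) v)" for v
    by (rule Suc.IH) (use Suc.prems in simp_all)
  then show ?case using Suc.prems by auto
qed

lemma Ck_on_SucD:
  assumes "Ck_on (Suc k) S f"
  shows "x \<in> S \<Longrightarrow> f differentiable (at x)" "Ck_on k S (\<lambda>x. frechet_derivative f (at x) v)"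
  using assms unfolding Ck_on.simps by blast+

lemma Ck_on_Suc_imp: "Ck_on (Suc k) S f \<Longrightarrow> Ck_on k S f"
proof (induction k arbitrary: f)
  case 0
  have "isCont f x" if "x \<in> S" for x
    by (rule differentiable_imp_continuous_within[OF Ck_on_SucD(1)[OF 0 that]])
  then show ?case
    unfolding Ck_on.simps(1) by (intro continuous_at_imp_continuous_on ballI)
next
  case (Suc k)
  show ?case
    unfolding Ck_on.simps(2)
    using Ck_on_SucD(1)[OF Suc.prems] Suc.IH[OF Ck_on_SucD(2)[OF Suc.prems]] by blast
qed

lemma Ck_on_continuous: "Ck_on k S f \<Longrightarrow> continuous_on S f"
  using Ck_on_Suc_imp by (induction k) (simp, blast)

lemma Ck_on_const: "open S \<Longrightarrow> Ck_on k S (\<lambda>x. c)"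
proof (induction k arbitrary: c)
  case (Suc k)
  show ?case
  proof (rule Ck_on_SucI'[OF Suc.prems])
    show "((\<lambda>x. c) has_derivative (\<lambda>v. 0)) (at x)" for x
      by (rule has_derivative_const)
    show "Ck_on k S (\<lambda>x. 0::'b)"
      by (rule Suc.IH[OF Suc.prems])
  qed
qed simp

lemma Ck_on_linear:
  assumes "open S" "bounded_linear h"
  shows "Ck_on k S h"
proof (cases k)
  case 0
  then show ?thesis using assms(2) by (simp add: linear_continuous_on)
next
  case (Suc j)
  show ?thesis unfolding Suc
  proof (rule Ck_on_SucI'[OF assms(1)])
    show "(h has_derivative h) (at x)" for x
      by (rule bounded_linear_imp_has_derivative[OF assms(2)])
    show "Ck_on j S (\<lambda>x. h v)" for v
      by (rule Ck_on_const[OF assms(1)])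
  qed
qed

lemma Ck_on_linear_comp:
  assumes "open S" "bounded_linear h" "Ck_on k S f"
  shows "Ck_on k S (\<lambda>x. h (f x))"
  using assms(3)
proof (induction k arbitrary: f)
  case 0
  then show ?case using assms(2)
    by (simp add: bounded_linear.continuous_on)
next
  case (Suc k)
  show ?case
    by (rule Ck_on_SucI'[OF assms(1) bounded_linear.has_derivative[OF assms(2) Ck_on_Suc_has_derivative[OF Suc.prems]]])
       (use Suc in auto)
qed

lemma Ck_on_add:
  assumes "open S" "Ck_on k S f" "Ck_on k S g"
  shows "Ck_on k S (\<lambda>x. f x + g x)"
  using assms(2,3)
proof (induction k arbitrary: f g)
  case 0
  then show ?case by (simp add: continuous_on_add)
next
  case (Suc k)
  show ?case
    by (rule Ck_on_SucI'[OF assms(1) has_derivative_add[OF Ck_on_Suc_has_derivative[OF Suc.prems(1)] Ck_on_Suc_has_derivative[OF Suc.prems(2)]]])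
       (use Suc in auto)
qed

lemma Ck_on_bilinear:
  assumes "open S" "bounded_bilinear pr" "Ck_on k S f" "Ck_on k S g"
  shows "Ck_on k S (\<lambda>x. pr (f x) (g x))"
  using assms(3,4)
proof (induction k arbitrary: f g)
  case 0
  then show ?case using bounded_bilinear.continuous_on[OF assms(2)] by auto
next
  case (Suc k)
  show ?case
  proof (rule Ck_on_SucI'[OF assms(1) bounded_bilinear.FDERIV[OF assms(2) Ck_on_Suc_has_derivative[OF Suc.prems(1)] Ck_on_Suc_has_derivative[OF Suc.prems(2)]]])
    fix v
    show "Ck_on k S (\<lambda>x. pr (f x) (frechet_derivative g (at x) v) + pr (frechet_derivative f (at x) v) (g x))"
      by (intro Ck_on_add[OF assms(1)] Suc.IH) (use Suc.prems in \<open>auto dest: Ck_on_Suc_imp simp del: Ck_on.simps(2)\<close>, auto)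
  qed
qed

lemma Ck_on_sum:
  assumes "open S" "\<And>i. i \<in> I \<Longrightarrow> Ck_on k S (f i)"
  shows "Ck_on k S (\<lambda>x. \<Sum>i\<in>I. f i x)"
  using assms(2)
  by (induction I rule: infinite_finite_induct) (auto simp: Ck_on_const Ck_on_add assms(1))

text \<open>The chain rule gives \<open>g'(f x) (f'(x) v)\<close>, whose direction depends on \<open>x\<close>. Expanding that direction in a
  basis turns it into a sum of products of functions to which the induction applies.\<close>

lemma Ck_on_compose:
  fixes g :: "'b::euclidean_space \<Rightarrow> 'c::real_normed_vector"
  assumes "open S" "Ck_on k S f" "Ck_on k T g" "f ` S \<subseteq> T"
  shows "Ck_on k S (\<lambda>x. g (f x))"
  using assms(2,3)
proof (induction k arbitrary: g)
  case 0
  then show ?case using assms(4) by (auto intro: continuous_on_compose2)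
next
  case (Suc k)
  let ?g' = "\<lambda>y. frechet_derivative g (at y)" and ?f' = "\<lambda>x. frechet_derivative f (at x)"
  show ?case
  proof (rule Ck_on_SucI'[OF assms(1)])
    fix x assume x: "x \<in> S"
    have "(g has_derivative ?g' (f x)) (at (f x))"
      using Suc.prems(2) x assms(4) by (intro Ck_on_Suc_has_derivative) auto
    from has_derivative_compose[OF Ck_on_Suc_has_derivative[OF Suc.prems(1) x] this]
    have d: "((\<lambda>x. g (f x)) has_derivative (\<lambda>v. ?g' (f x) (?f' x v))) (at x)" .
    have lin: "linear (?g' (f x))"
      using \<open>(g has_derivative ?g' (f x)) (at (f x))\<close> has_derivative_linear by blast
    have "?g' (f x) w = (\<Sum>b\<in>Basis. (w \<bullet> b) *\<^sub>R ?g' (f x) b)" for w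
    proof -
      have "?g' (f x) w = ?g' (f x) (\<Sum>b\<in>Basis. (w \<bullet> b) *\<^sub>R b)"
        by (simp add: euclidean_representation)
      also have "\<dots> = (\<Sum>b\<in>Basis. (w \<bullet> b) *\<^sub>R ?g' (f x) b)"
        using lin by (simp add: linear_sum linear_scale)
      finally show ?thesis .
    qed
    then have "(\<lambda>v. ?g' (f x) (?f' x v)) = (\<lambda>v. \<Sum>b\<in>Basis. (?f' x v \<bullet> b) *\<^sub>R ?g' (f x) b)"
      by blast
    with d show "((\<lambda>x. g (f x)) has_derivative (\<lambda>v. \<Sum>b\<in>Basis. (?f' x v \<bullet> b) *\<^sub>R ?g' (f x) b)) (at x)"
      by metis
  next
    fix v
    show "Ck_on k S (\<lambda>x. \<Sum>b\<in>Basis. (?f' x v \<bullet> b) *\<^sub>R ?g' (f x) b)"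
    proof (intro Ck_on_sum[OF assms(1)] Ck_on_bilinear[OF assms(1) bounded_bilinear_scaleR])
      fix b :: 'b assume "b \<in> Basis"
      show "Ck_on k S (\<lambda>x. ?f' x v \<bullet> b)"
        by (rule Ck_on_linear_comp[OF assms(1) bounded_linear_inner_left]) (use Suc.prems in auto)
      show "Ck_on k S (\<lambda>x. ?g' (f x) b)"
        by (rule Suc.IH) (use Suc.prems Ck_on_Suc_imp in auto)
    qed
  qed
qed

named_theorems smooth_intros

lemma smooth_on_const [smooth_intros]: "open S \<Longrightarrow> smooth_on S (\<lambda>x. c)"
  by (simp add: smooth_on_def Ck_on_const)

lemma smooth_on_linear: "open S \<Longrightarrow> bounded_linear h \<Longrightarrow> smooth_on S h"
  by (simp add: smooth_on_def Ck_on_linear)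

lemma smooth_on_linear_comp: "open S \<Longrightarrow> bounded_linear h \<Longrightarrow> smooth_on S f \<Longrightarrow> smooth_on S (\<lambda>x. h (f x))"
  by (simp add: smooth_on_def Ck_on_linear_comp)

lemma smooth_on_add [smooth_intros]:
  "open S \<Longrightarrow> smooth_on S f \<Longrightarrow> smooth_on S g \<Longrightarrow> smooth_on S (\<lambda>x. f x + g x)"
  by (simp add: smooth_on_def Ck_on_add)

lemma smooth_on_uminus [smooth_intros]:
  "open S \<Longrightarrow> smooth_on S f \<Longrightarrow> smooth_on S (\<lambda>x. - f x)"
  by (rule smooth_on_linear_comp) (auto intro: bounded_linear_minus bounded_linear_ident)

lemma smooth_on_diff [smooth_intros]:
  "open S \<Longrightarrow> smooth_on S f \<Longrightarrow> smooth_on S g \<Longrightarrow> smooth_on S (\<lambda>x. f x - g x)"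
  using smooth_on_add[of S f "\<lambda>x. - g x"] smooth_on_uminus[of S g] by simp

lemma smooth_on_mult [smooth_intros]:
  fixes f :: "_ \<Rightarrow> 'b::real_normed_algebra"
  shows "open S \<Longrightarrow> smooth_on S f \<Longrightarrow> smooth_on S g \<Longrightarrow> smooth_on S (\<lambda>x. f x * g x)"
  by (simp add: smooth_on_def Ck_on_bilinear bounded_bilinear_mult)

lemma smooth_on_power [smooth_intros]:
  fixes f :: "_ \<Rightarrow> 'b::real_normed_algebra_1"
  shows "open S \<Longrightarrow> smooth_on S f \<Longrightarrow> smooth_on S (\<lambda>x. f x ^ n)"
  by (induction n) (auto intro: smooth_intros)

lemma smooth_on_sum [smooth_intros]:
  "open S \<Longrightarrow> (\<And>i. i \<in> I \<Longrightarrow> smooth_on S (f i)) \<Longrightarrow> smooth_on S (\<lambda>x. \<Sum>i\<in>I. f i x)"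
  by (simp add: smooth_on_def Ck_on_sum)

lemma smooth_on_compose:
  fixes g :: "'b::euclidean_space \<Rightarrow> 'c::real_normed_vector"
  shows "open S \<Longrightarrow> smooth_on T g \<Longrightarrow> smooth_on S f \<Longrightarrow> f ` S \<subseteq> T \<Longrightarrow> smooth_on S (\<lambda>x. g (f x))"
  unfolding smooth_on_def using Ck_on_compose by blast

lemma smooth_on_subset: "smooth_on S f \<Longrightarrow> T \<subseteq> S \<Longrightarrow> smooth_on T f"
  unfolding smooth_on_def using Ck_on_subset by blast

lemma smooth_on_cong:
  "open S \<Longrightarrow> (\<And>x. x \<in> S \<Longrightarrow> f x = g x) \<Longrightarrow> smooth_on S f \<Longrightarrow> smooth_on S g"
  by (auto simp: smooth_on_def intro: Ck_on_cong)

lemma smooth_on_continuous: "smooth_on S f \<Longrightarrow> continuous_on S f"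
  by (auto simp: smooth_on_def intro: Ck_on_continuous)

lemma smooth_on_has_derivative:
  "smooth_on S f \<Longrightarrow> x \<in> S \<Longrightarrow> (f has_derivative frechet_derivative f (at x)) (at x)"
  unfolding smooth_on_def by (meson Ck_on_Suc_has_derivative)

lemma smooth_on_directional:
  "smooth_on S f \<Longrightarrow> smooth_on S (\<lambda>x. frechet_derivative f (at x) v)"
  unfolding smooth_on_def by (metis Ck_on.simps(2))

lemma smooth_on_ident [smooth_intros]: "open S \<Longrightarrow> smooth_on S (\<lambda>x. x)"
  by (rule smooth_on_linear[OF _ bounded_linear_ident])

lemma smooth_on_of_real [smooth_intros]:
  "open S \<Longrightarrow> smooth_on S f \<Longrightarrow> smooth_on S (\<lambda>x. of_real (f x) :: complex)"
  by (rule smooth_on_linear_comp[OF _ bounded_linear_of_real])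

lemma smooth_on_Im [smooth_intros]: "open S \<Longrightarrow> smooth_on S f \<Longrightarrow> smooth_on S (\<lambda>x. Im (f x))"
  by (rule smooth_on_linear_comp[OF _ bounded_linear_Im])

text \<open>A directional derivative of a holomorphic function is \<open>deriv f x * v\<close>, again holomorphic, so the
  induction on the order never leaves the holomorphic functions.\<close>

lemma holomorphic_on_imp_smooth_on:
  assumes "f holomorphic_on S" "open S"
  shows "smooth_on S f"
proof -
  have "Ck_on k S f" for k
    using assms(1)
  proof (induction k arbitrary: f)
    case 0
    then show ?case by (simp add: holomorphic_on_imp_continuous_on)
  next
    case (Suc k)
    show ?case
    proof (rule Ck_on_SucI'[OF assms(2)])
      show "(f has_derivative (\<lambda>h. deriv f x * h)) (at x)" if "x \<in> S" for x
        using holomorphic_derivI[OF Suc.prems assms(2) that]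
        by (simp add: has_field_derivative_def)
      show "Ck_on k S (\<lambda>x. deriv f x * v)" for v
        by (rule Suc.IH) (intro holomorphic_intros Suc.prems assms(2))
    qed
  qed
  then show ?thesis by (simp add: smooth_on_def)
qed

lemma smooth_on_inverse_complex [smooth_intros]:
  fixes f :: "_ \<Rightarrow> complex"
  assumes "open S" "smooth_on S f" "\<And>x. x \<in> S \<Longrightarrow> f x \<noteq> 0"
  shows "smooth_on S (\<lambda>x. inverse (f x))"
proof -
  have "smooth_on (- {0}) (inverse :: complex \<Rightarrow> complex)"
  proof (rule holomorphic_on_imp_smooth_on)
    show "(inverse :: complex \<Rightarrow> complex) holomorphic_on - {0}"
      by (rule holomorphic_on_inverse[OF holomorphic_on_ident]) simp
    show "open (- {0::complex})"
      by (rule open_Compl[OF closed_singleton])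
  qed
  then show ?thesis
  proof (rule smooth_on_compose[OF assms(1) _ assms(2)])
    show "f ` S \<subseteq> - {0}" using assms(3) by auto
  qed
qed

section \<open>Parameter integrals and the smooth inverse function theorem\<close>

lemma Ck_on_integral:
  fixes f :: "'p::euclidean_space \<times> real \<Rightarrow> 'c::banach"
  assumes "open S" "Ck_on k (S \<times> UNIV) f"
  shows "Ck_on k S (\<lambda>p. integral {a..b} (\<lambda>t. f (p, t)))"
  using assms(2)
proof (induction k arbitrary: f)
  case 0
  have "continuous_on (S \<times> cbox a b) (\<lambda>(p, t). f (p, t))"
    using 0 by (auto intro: continuous_on_subset)
  from integral_continuous_on_param[OF this] show ?case by simp
next
  case (Suc k)
  let ?f' = "\<lambda>p t v. frechet_derivative f (at (p, t)) (v, 0)"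
  have d: "((\<lambda>p. f (p, t)) has_derivative ?f' p t) (at p)" if "p \<in> S" for p t
  proof (rule has_derivative_compose[of "\<lambda>p. (p, t)" "\<lambda>v. (v, 0)"])
    show "((\<lambda>p. (p, t)) has_derivative (\<lambda>v. (v, 0))) (at p)"
      by (intro has_derivative_Pair has_derivative_ident has_derivative_const)
    show "(f has_derivative frechet_derivative f (at (p, t))) (at (p, t))"
      by (rule Ck_on_Suc_has_derivative[OF Suc.prems]) (use that in auto)
  qed
  have c': "continuous_on (S \<times> UNIV) (\<lambda>x. frechet_derivative f (at x) (v, 0))" for v
    by (rule Ck_on_continuous[OF Ck_on_SucD(2)[OF Suc.prems]])
  define F where "F p t = Blinfun (?f' p t)" for p t
  have F: "blinfun_apply (F p t) = ?f' p t" if "p \<in> S" for p t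
    unfolding F_def by (rule bounded_linear_Blinfun_apply[OF has_derivative_bounded_linear[OF d[OF that]]])
  have Fc: "continuous_on (S \<times> cbox a b) (\<lambda>(p, t). F p t)"
  proof (rule continuous_on_blinfun_componentwise)
    fix i :: 'p
    have "continuous_on (S \<times> cbox a b) (\<lambda>x. frechet_derivative f (at x) (i, 0))"
      by (rule continuous_on_subset[OF c']) auto
    then show "continuous_on (S \<times> cbox a b) (\<lambda>x. blinfun_apply (case x of (p, t) \<Rightarrow> F p t) i)"
      by (rule continuous_on_eq) (auto simp: F)
  qed
  have fc: "continuous_on (cbox a b) (\<lambda>t. f (p, t))" if "p \<in> S" for p
    by (rule continuous_on_compose2[OF Ck_on_continuous[OF Suc.prems]])
       (use that in \<open>auto intro!: continuous_intros\<close>)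
  have Fi: "(F p) integrable_on cbox a b" if "p \<in> S" for p
  proof (rule integrable_continuous)
    have "continuous_on (cbox a b) (\<lambda>t. case (p, t) of (p, t) \<Rightarrow> F p t)"
      by (rule continuous_on_compose2[OF Fc]) (use that in \<open>auto intro!: continuous_on_Pair\<close>)
    then show "continuous_on (cbox a b) (F p)" by simp
  qed
  show ?case
  proof (rule Ck_on_SucI'[OF assms(1)])
    fix p assume p: "p \<in> S"
    obtain e where e: "e > 0" "ball p e \<subseteq> S"
      using assms(1) p openE by blast
    have "((\<lambda>p. integral (cbox a b) (\<lambda>t. f (p, t))) has_derivative
        blinfun_apply (integral (cbox a b) (F p))) (at p within ball p e)"
    proof (rule leibniz_rule)
      show "((\<lambda>x. f (x, t)) has_derivative blinfun_apply (F x t)) (at x within ball p e)"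
        if "x \<in> ball p e" for x t
      proof -
        have x: "x \<in> S" using that e(2) by auto
        show ?thesis unfolding F[OF x] by (rule has_derivative_at_withinI[OF d[OF x]])
      qed
      show "(\<lambda>t. f (x, t)) integrable_on cbox a b" if "x \<in> ball p e" for x
        by (rule integrable_continuous[OF fc]) (use that e(2) in auto)
      show "continuous_on (ball p e \<times> cbox a b) (\<lambda>(x, t). F x t)"
        by (rule continuous_on_subset[OF Fc]) (use e(2) in auto)
    qed (use e(1) in auto)
    then have "((\<lambda>p. integral (cbox a b) (\<lambda>t. f (p, t))) has_derivative
        blinfun_apply (integral (cbox a b) (F p))) (at p)"
      using at_within_open[of p "ball p e"] e(1) by simp
    moreover have "blinfun_apply (integral (cbox a b) (F p)) = (\<lambda>v. integral (cbox a b) (\<lambda>t. ?f' p t v))"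
      by (rule ext) (unfold blinfun_apply_integral[OF Fi[OF p]] F[OF p], rule refl)
    ultimately show "((\<lambda>p. integral {a..b} (\<lambda>t. f (p, t))) has_derivative
        (\<lambda>v. integral {a..b} (\<lambda>t. ?f' p t v))) (at p)"
      by simp
  next
    fix v
    show "Ck_on k S (\<lambda>p. integral {a..b} (\<lambda>t. ?f' p t v))"
      by (rule Suc.IH[OF Ck_on_SucD(2)[OF Suc.prems]])
  qed
qed

lemma smooth_on_integral:
  fixes f :: "'p::euclidean_space \<times> real \<Rightarrow> 'c::banach"
  assumes "open S" "smooth_on (S \<times> UNIV) f"
  shows "smooth_on S (\<lambda>p. integral {a..b} (\<lambda>t. f (p, t)))"
  using assms unfolding smooth_on_def using Ck_on_integral by blast

text \<open>The product rule at a zero of the second factor, for which continuity of the first is enough.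
  It differentiates \<open>y \<mapsto> Ji y \<circ> (J y - J x)\<close> when only continuity of \<open>Ji\<close> is known.\<close>

lemma has_derivative_bilinear_at_zero:
  assumes P: "bounded_bilinear P" and c: "isCont c x"
    and d: "(d has_derivative d') (at x)" and d0: "d x = 0"
  shows "((\<lambda>y. P (c y) (d y)) has_derivative (\<lambda>v. P (c x) (d' v))) (at x)"
proof -
  interpret bounded_bilinear P by (rule P)
  obtain K where K: "K > 0" "\<And>a b. norm (P a b) \<le> norm a * norm b * K"
    using pos_bounded by blast
  have bl: "bounded_linear d'" by (rule has_derivative_bounded_linear[OF d])
  then obtain B where B: "B > 0" "\<And>v. norm (d' v) \<le> norm v * B"
    using bounded_linear.pos_bounded by blast
  obtain r where r: "r > 0" "\<And>y. norm (y - x) < r \<Longrightarrow> norm (d y - d' (y - x)) \<le> norm (y - x)"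
    using d[unfolded has_derivative_at_alt] d0 by (metis diff_zero mult_1 zero_less_one)
  have dn: "norm (d y) \<le> (1 + B) * norm (y - x)" if "norm (y - x) < r" for y
  proof -
    have "norm (d y) \<le> norm (d y - d' (y - x)) + norm (d' (y - x))"
      using norm_triangle_sub[of "d y" "d' (y - x)"] by simp
    also have "\<dots> \<le> norm (y - x) + norm (y - x) * B"
      using r(2)[OF that] B(2) by (rule add_mono)
    finally show ?thesis by (simp add: algebra_simps)
  qed
  have "((\<lambda>y. P (c y - c x) (d y)) has_derivative (\<lambda>v. 0)) (at x)"
    unfolding has_derivative_at_alt
  proof (intro conjI allI impI)
    fix e :: real assume "e > 0"
    define \<eta> where "\<eta> = e / (K * (1 + B))"
    have \<eta>: "\<eta> > 0" "\<eta> * (1 + B) * K = e"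
      using \<open>e > 0\<close> K(1) B(1) by (auto simp: \<eta>_def)
    obtain r' where r': "r' > 0" "\<And>y. norm (y - x) < r' \<Longrightarrow> norm (c y - c x) < \<eta>"
      using c[unfolded continuous_at_eps_delta] \<eta>(1) by (auto simp: dist_norm)
    show "\<exists>d'>0. \<forall>y. norm (y - x) < d' \<longrightarrow>
        norm (P (c y - c x) (d y) - P (c x - c x) (d x) - 0) \<le> e * norm (y - x)"
    proof (intro exI conjI allI impI)
      show "min r r' > 0" using r r' by simp
      fix y assume y: "norm (y - x) < min r r'"
      have "norm (P (c y - c x) (d y)) \<le> norm (c y - c x) * norm (d y) * K" by (rule K)
      also have "\<dots> \<le> \<eta> * ((1 + B) * norm (y - x)) * K"
        using y r'(2)[of y] dn[of y] K(1) \<eta>(1) B(1) by (intro mult_mono) auto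
      also have "\<dots> = e * norm (y - x)" using \<eta>(2) by (metis mult.assoc mult.commute)
      finally show "norm (P (c y - c x) (d y) - P (c x - c x) (d x) - 0) \<le> e * norm (y - x)"
        by (simp add: zero_left)
    qed
  qed simp
  from has_derivative_add[OF this bounded_linear.has_derivative[OF bounded_linear_right d, of "c x"]]
  show ?thesis by (simp add: diff_left)
qed

text \<open>Everything follows from the resolvent identity \<open>Ji y - Ji x = - Ji y (J y - J x) Ji x\<close>: it bounds \<open>Ji\<close> near
  \<open>x\<close>, hence gives continuity, then the derivative \<open>- Ji J' Ji\<close>. The latter
  has \<open>k\<close> continuous derivatives if \<open>Ji\<close> and \<open>J'\<close> have, which is the induction step.\<close>

lemma Ck_on_blinfun_inverse:
  fixes J Ji :: "'b::real_normed_vector \<Rightarrow> ('a::real_normed_vector \<Rightarrow>\<^sub>L 'a)"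
  assumes S: "open S"
    and left: "\<And>y. y \<in> S \<Longrightarrow> Ji y o\<^sub>L J y = id_blinfun"
    and right: "\<And>y. y \<in> S \<Longrightarrow> J y o\<^sub>L Ji y = id_blinfun"
    and J: "Ck_on k S J"
  shows "Ck_on k S Ji"
proof -
  interpret comp: bounded_bilinear "(o\<^sub>L) :: ('a \<Rightarrow>\<^sub>L 'a) \<Rightarrow> ('a \<Rightarrow>\<^sub>L 'a) \<Rightarrow> _"
    by (rule bounded_bilinear_blinfun_compose)
  have apps: "blinfun_apply (Ji y) (blinfun_apply (J y) h) = h" 
    "blinfun_apply (J y) (blinfun_apply (Ji y) h) = h" if "y \<in> S" for y h
    using left[OF that] right[OF that] by (metis blinfun_apply_blinfun_compose blinfun_apply_id_blinfun id_apply)+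
  have diff: "Ji y - Ji x = - ((Ji y o\<^sub>L (J y - J x)) o\<^sub>L Ji x)" if "x \<in> S" "y \<in> S" for x y
    by (rule blinfun_eqI) (simp add: blinfun.bilinear_simps apps that)
  have cont: "continuous_on S Ji" if Jc: "continuous_on S J"
  proof -
    have "isCont Ji x" if x: "x \<in> S" for x
    proof -
      have "isCont J x" using Jc S x continuous_on_eq_continuous_at by blast
      then have J0: "((\<lambda>y. norm (J y - J x)) \<longlongrightarrow> 0) (at x)"
        by (metis isCont_def LIM_zero tendsto_norm_zero)
      have J1: "((\<lambda>y. norm (J y - J x) * norm (Ji x)) \<longlongrightarrow> 0) (at x)"
        by (rule tendsto_mult_left_zero[OF J0])
      have ev: "\<forall>\<^sub>F y in at x. y \<in> S \<and> norm (J y - J x) * norm (Ji x) < 1/2"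
        using order_tendstoD(2)[OF J1, of "1/2"] eventually_at_topological S x
        by (intro eventually_conj) auto
      have "((\<lambda>y. Ji y - Ji x) \<longlongrightarrow> 0) (at x)"
      proof (rule Lim_null_comparison)
        show "\<forall>\<^sub>F y in at x. norm (Ji y - Ji x) \<le> (2 * norm (Ji x)) * (norm (J y - J x) * norm (Ji x))"
          using ev
        proof (eventually_elim)
          case (elim y)
          let ?e = "norm (J y - J x) * norm (Ji x)"
          have 1: "norm (Ji y - Ji x) \<le> norm (Ji y) * ?e"
          proof -
            have "norm (Ji y - Ji x) \<le> norm (Ji y o\<^sub>L (J y - J x)) * norm (Ji x)"
              unfolding diff[OF x conjunct1[OF elim]] norm_minus_cancel by (rule norm_blinfun_compose)
            also have "\<dots> \<le> norm (Ji y) * norm (J y - J x) * norm (Ji x)"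
              by (intro mult_right_mono norm_blinfun_compose) auto
            finally show ?thesis by (simp add: mult.assoc)
          qed
          have "norm (Ji y) \<le> norm (Ji x) + norm (Ji y - Ji x)"
            by (metis norm_triangle_sub)
          also have "\<dots> \<le> norm (Ji x) + norm (Ji y) * (1/2)"
            using 1 elim mult_left_mono[of ?e "1/2" "norm (Ji y)"] by (smt (verit) norm_ge_zero)
          finally have 2: "norm (Ji y) \<le> 2 * norm (Ji x)" by simp
          from 1 have "norm (Ji y - Ji x) \<le> norm (Ji y) * ?e" .
          also have "\<dots> \<le> (2 * norm (Ji x)) * ?e" using 2 by (intro mult_right_mono) auto
          finally show ?case .
        qed
        show "((\<lambda>y. 2 * norm (Ji x) * (norm (J y - J x) * norm (Ji x))) \<longlongrightarrow> 0) (at x)"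
          by (rule tendsto_mult_right_zero[OF J1])
      qed
      then show ?thesis using LIM_zero_cancel isCont_def by blast
    qed
    then show ?thesis by (simp add: continuous_at_imp_continuous_on)
  qed
  show ?thesis using J
  proof (induction k)
    case 0
    then show ?case using cont by simp
  next
    case (Suc k)
    have c: "continuous_on S Ji" by (rule cont[OF Ck_on_continuous[OF Suc.prems]])
    have k: "Ck_on k S Ji" by (rule Suc.IH[OF Ck_on_Suc_imp[OF Suc.prems]])
    let ?J' = "\<lambda>x. frechet_derivative J (at x)"
    show ?case
    proof (rule Ck_on_SucI'[OF S])
      fix x assume x: "x \<in> S"
      have "isCont Ji x" using c S x continuous_on_eq_continuous_at by blast
      moreover have "((\<lambda>y. J y - J x) has_derivative ?J' x) (at x)"
        using has_derivative_diff[OF Ck_on_Suc_has_derivative[OF Suc.prems x] has_derivative_const] by simp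
      ultimately have "((\<lambda>y. Ji y o\<^sub>L (J y - J x)) has_derivative (\<lambda>v. Ji x o\<^sub>L ?J' x v)) (at x)"
        by (rule has_derivative_bilinear_at_zero[OF bounded_bilinear_blinfun_compose]) simp
      from has_derivative_diff[OF has_derivative_const[of "Ji x"]
          bounded_linear.has_derivative[OF comp.bounded_linear_left this, of "Ji x"]]
      have "((\<lambda>y. Ji x - ((Ji y o\<^sub>L (J y - J x)) o\<^sub>L Ji x)) has_derivative
          (\<lambda>v. - ((Ji x o\<^sub>L ?J' x v) o\<^sub>L Ji x))) (at x)" by simp
      then show "(Ji has_derivative (\<lambda>v. - ((Ji x o\<^sub>L ?J' x v) o\<^sub>L Ji x))) (at x)"
      proof (rule has_derivative_transform_within_open[OF _ S x])
        fix y assume "y \<in> S"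
        from diff[OF x this] show "Ji x - ((Ji y o\<^sub>L (J y - J x)) o\<^sub>L Ji x) = Ji y"
          by (simp add: algebra_simps)
      qed
    next
      fix v
      show "Ck_on k S (\<lambda>x. - ((Ji x o\<^sub>L ?J' x v) o\<^sub>L Ji x))"
      proof (rule Ck_on_linear_comp[OF S bounded_linear_minus[OF bounded_linear_ident]])
        show "Ck_on k S (\<lambda>x. (Ji x o\<^sub>L ?J' x v) o\<^sub>L Ji x)"
          by (rule Ck_on_bilinear[OF S bounded_bilinear_blinfun_compose
                Ck_on_bilinear[OF S bounded_bilinear_blinfun_compose k Ck_on_SucD(2)[OF Suc.prems]] k])
      qed
    qed
  qed
qed

text \<open>The inverse function theorem for continuously differentiable maps provides the inverse \<open>g\<close> with
  \<open>g' = (f' \<circ> g)\<^bsup>-1\<^esup>\<close>. If \<open>g\<close> has \<open>k\<close> continuous derivatives, so has \<open>f' \<circ> g\<close> and thus its inverse; hence \<open>g\<close>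
  has \<open>k + 1\<close>.\<close>

lemma smooth_inverse_function:
  fixes f :: "'a::euclidean_space \<Rightarrow> 'a"
  assumes S: "open S" "smooth_on S f" "x0 \<in> S"
    and inj: "\<And>v. frechet_derivative f (at x0) v = 0 \<Longrightarrow> v = 0"
  obtains V W where "V \<subseteq> S" "x0 \<in> V" "diffeomorphism V W f"
proof -
  let ?f' = "\<lambda>x. frechet_derivative f (at x)"
  define J where "J x = Blinfun (?f' x)" for x
  have fd: "(f has_derivative ?f' x) (at x)" if "x \<in> S" for x
    by (rule smooth_on_has_derivative[OF S(2) that])
  have J: "blinfun_apply (J x) = ?f' x" if "x \<in> S" for x
    unfolding J_def by (rule bounded_linear_Blinfun_apply[OF has_derivative_bounded_linear[OF fd[OF that]]])
  have Jc: "continuous_on S J"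
  proof (rule continuous_on_blinfun_componentwise)
    fix i :: 'a
    have "continuous_on S (\<lambda>x. ?f' x i)"
      by (rule smooth_on_continuous[OF smooth_on_directional[OF S(2)]])
    then show "continuous_on S (\<lambda>x. blinfun_apply (J x) i)"
      by (rule continuous_on_eq) (simp add: J)
  qed
  have lin: "linear (?f' x0)" by (rule has_derivative_linear[OF fd[OF S(3)]])
  have "inj (?f' x0)" unfolding linear_injective_0[OF lin] using inj by blast
  then obtain h where h: "linear h" "h \<circ> ?f' x0 = id"
    using linear_injective_left_inverse[OF lin] by blast
  have "Blinfun h o\<^sub>L J x0 = id_blinfun"
  proof (rule blinfun_eqI)
    fix v
    have "blinfun_apply (Blinfun h) = h"
      by (rule bounded_linear_Blinfun_apply) (use h(1) linear_conv_bounded_linear in blast)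
    then show "blinfun_apply (Blinfun h o\<^sub>L J x0) v = blinfun_apply id_blinfun v"
      using h(2) J[OF S(3)] by (simp add: fun_eq_iff)
  qed
  moreover have "(f has_derivative blinfun_apply (J x)) (at x)" if "x \<in> S" for x
    using fd[OF that] J[OF that] by simp
  ultimately obtain V W g g' where VW: "open V" "V \<subseteq> S" "x0 \<in> V" "open W" "homeomorphism V W f g"
    and g': "\<And>y. y \<in> W \<Longrightarrow> (g has_derivative (g' y)) (at y)"
      "\<And>y. y \<in> W \<Longrightarrow> g' y = inv (blinfun_apply (J (g y)))"
      "\<And>y. y \<in> W \<Longrightarrow> bij (blinfun_apply (J (g y)))"
    using inverse_function_theorem[OF S(1) _ Jc S(3), of f "Blinfun h"] by metis
  have gV: "g ` W \<subseteq> V" using VW(5) by (auto simp: homeomorphism_def)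
  have comp: "Ck_on k W (\<lambda>y. J (g y))" if "Ck_on k W g" for k
  proof -
    have rep: "(\<Sum>b\<in>Basis. blinfun_scaleR_left (?f' (g y) b) o\<^sub>L blinfun_inner_right b) = J (g y)"
      if "y \<in> W" for y
    proof (rule blinfun_eqI)
      fix v :: 'a
      have gy: "g y \<in> S" using gV VW(2) that by auto
      have "blinfun_apply (J (g y)) v = blinfun_apply (J (g y)) (\<Sum>b\<in>Basis. (v \<bullet> b) *\<^sub>R b)"
        by (simp add: euclidean_representation)
      also have "\<dots> = (\<Sum>b\<in>Basis. (v \<bullet> b) *\<^sub>R ?f' (g y) b)"
        by (simp add: blinfun.sum_right blinfun.scaleR_right flip: J[OF gy])
      finally show "blinfun_apply (\<Sum>b\<in>Basis. blinfun_scaleR_left (?f' (g y) b) o\<^sub>L blinfun_inner_right b) v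
          = blinfun_apply (J (g y)) v"
        by (simp add: blinfun.sum_left inner_commute)
    qed
    have "Ck_on k W (\<lambda>y. \<Sum>b\<in>Basis. blinfun_scaleR_left (?f' (g y) b) o\<^sub>L blinfun_inner_right b)"
    proof (rule Ck_on_sum[OF VW(4)])
      fix b :: 'a
      have "Ck_on k S (\<lambda>x. ?f' x b)"
        using smooth_on_directional[OF S(2)] by (simp add: smooth_on_def)
      then have "Ck_on k W (\<lambda>y. ?f' (g y) b)"
        by (rule Ck_on_compose[OF VW(4) that]) (use gV VW(2) in auto)
      then have "Ck_on k W (\<lambda>y. blinfun_scaleR_left (?f' (g y) b))"
        by (rule Ck_on_linear_comp[OF VW(4) bounded_linear_blinfun_scaleR_left])
      then show "Ck_on k W (\<lambda>y. blinfun_scaleR_left (?f' (g y) b) o\<^sub>L blinfun_inner_right b)"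
        by (rule Ck_on_bilinear[OF VW(4) bounded_bilinear_blinfun_compose _ Ck_on_const[OF VW(4)]])
    qed
    then show ?thesis
      by (rule Ck_on_cong[OF VW(4), rotated]) (rule rep)
  qed
  have gk: "Ck_on k W g" for k
  proof (induction k)
    case 0
    then show ?case using VW(5) by (simp add: homeomorphism_def)
  next
    case (Suc k)
    show ?case
    proof (rule Ck_on_SucI'[OF VW(4) g'(1)])
      fix v
      have bl: "blinfun_apply (Blinfun (g' y)) = g' y" if "y \<in> W" for y
        by (rule bounded_linear_Blinfun_apply[OF has_derivative_bounded_linear[OF g'(1)[OF that]]])
      have "Ck_on k W (\<lambda>y. Blinfun (g' y))"
      proof (rule Ck_on_blinfun_inverse[OF VW(4) _ _ comp[OF Suc.IH]])
        fix y assume y: "y \<in> W"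
        have "blinfun_apply (Blinfun (g' y)) = inv (blinfun_apply (J (g y)))"
          unfolding bl[OF y] by (rule g'(2)[OF y])
        then show "Blinfun (g' y) o\<^sub>L J (g y) = id_blinfun" "J (g y) o\<^sub>L Blinfun (g' y) = id_blinfun"
          by (auto intro!: blinfun_eqI simp: inv_f_f[OF bij_is_inj[OF g'(3)[OF y]]]
              surj_f_inv_f[OF bij_is_surj[OF g'(3)[OF y]]])
      qed
      then have "Ck_on k W (\<lambda>y. blinfun_apply (Blinfun (g' y)) v)"
        by (rule Ck_on_linear_comp[OF VW(4) blinfun.bounded_linear_left])
      then show "Ck_on k W (\<lambda>y. g' y v)"
        by (rule Ck_on_cong[OF VW(4), rotated]) (simp add: bl)
    qed
  qed
  have bij: "bij_betw f V W"
    using VW(5) unfolding homeomorphism_def bij_betw_def by (metis inj_on_inverseI)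
  have "smooth_on W (inv_into V f)"
  proof (rule smooth_on_cong[OF VW(4)])
    show "g y = inv_into V f y" if "y \<in> W" for y
    proof -
      have "g y \<in> V" "f (g y) = y" using VW(5) that unfolding homeomorphism_def by auto
      then show ?thesis using bij inv_into_f_f[of f V "g y"] by (simp add: bij_betw_def)
    qed
    show "smooth_on W g" unfolding smooth_on_def using gk by blast
  qed
  then have "diffeomorphism V W f"
    unfolding diffeomorphism_def using VW bij smooth_on_subset[OF S(2) VW(2)] by blast
  with VW show ?thesis using that by blast
qed

section \<open>Division by a polynomial with parameters\<close>

lemma Cauchy_integral_unit_interval:
  assumes K: "K holomorphic_on ball 0 R" and \<sigma>: "0 < \<sigma>" "\<sigma> < R" and w: "cmod w < \<sigma>"
  defines "e \<equiv> \<lambda>x. of_real \<sigma> * exp (2 * of_real pi * \<i> * of_real x)"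
  shows "((\<lambda>x. K (e x) * e x / (e x - w)) has_integral K w) {0..1}"
proof -
  have "K holomorphic_on cball 0 \<sigma>"
    by (rule holomorphic_on_subset[OF K]) (use \<sigma> in auto)
  from Cauchy_integral_circlepath_simple[OF this] w
  have "((\<lambda>u. K u / (u - w)) has_contour_integral (2 * of_real pi * \<i> * K w)) (circlepath 0 \<sigma>)"
    by simp
  then have "((\<lambda>x. K (circlepath 0 \<sigma> x) / (circlepath 0 \<sigma> x - w) *
      vector_derivative (circlepath 0 \<sigma>) (at x within {0..1})) has_integral (2 * of_real pi * \<i> * K w)) {0..1}"
    by (simp add: has_contour_integral_def)
  then have "((\<lambda>x. inverse (2 * of_real pi * \<i>) * (K (circlepath 0 \<sigma> x) / (circlepath 0 \<sigma> x - w) *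
      vector_derivative (circlepath 0 \<sigma>) (at x within {0..1}))) has_integral
      (inverse (2 * of_real pi * \<i>) * (2 * of_real pi * \<i> * K w))) {0..1}"
    by (rule has_integral_mult_right)
  then have "((\<lambda>x. inverse (2 * of_real pi * \<i>) * (K (circlepath 0 \<sigma> x) / (circlepath 0 \<sigma> x - w) *
      vector_derivative (circlepath 0 \<sigma>) (at x within {0..1}))) has_integral K w) {0..1}"
    by (simp add: field_simps)
  then show ?thesis
    by (rule has_integral_eq[rotated])
       (simp add: vector_derivative_circlepath01, simp add: circlepath e_def field_simps)
qed

text \<open>Division of \<open>\<phi>(u, v) = Im K(u + i v)\<close> by a polynomial \<open>P\<^sub>p(v)\<close> whose coefficients \<open>c k p\<close>, like
  \<open>u = l p\<close>, depend on a parameter \<open>p\<close>, and which is \<open>v^n\<close> at \<open>p = 0\<close>. With \<open>e\<close> on a circle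
  around \<open>0\<close> and \<open>a = i (u - e)\<close>, Cauchy's kernel is \<open>1 / (e - u - i v) = - i / (a - v)\<close>, and
  \<open>1 / (a - v) = (P(a) - P(v)) / ((a - v) P(a)) + P(v) / (P(a) (a - v))\<close>.
  The first term is a polynomial in \<open>v\<close> of degree below \<open>n\<close>. Only real \<open>v\<close> occur, so the imaginary part
  of the integral over the circle is a real division; the integrands are smooth in \<open>(p, v)\<close>.\<close>

lemma analytic_division:
  fixes c :: "nat \<Rightarrow> 'p::euclidean_space \<Rightarrow> real" and l :: "'p \<Rightarrow> real" and n :: nat
  assumes K: "K holomorphic_on ball 0 R" and R: "0 < R" and n: "1 \<le> n"
    and c: "\<And>k. smooth_on UNIV (c k)" and l: "bounded_linear l"
    and c0: "\<And>k. k \<le> n \<Longrightarrow> c k 0 = (if k = n then 1 else 0)"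
  obtains \<rho> G r Q where "0 < \<rho>" "open G" "0 \<in> G" "\<And>j. smooth_on G (r j)"
    "smooth_on (G \<times> {-\<rho><..<\<rho>}) Q"
    "\<And>p v. p \<in> G \<Longrightarrow> \<bar>v\<bar> < \<rho> \<Longrightarrow> cmod (Complex (l p) v) < R"
    "\<And>p v. p \<in> G \<Longrightarrow> \<bar>v\<bar> < \<rho> \<Longrightarrow>
       Im (K (Complex (l p) v)) = (\<Sum>j<n. r j p * v ^ j) + (\<Sum>k\<le>n. c k p * v ^ k) * Q (p, v)"
proof -
  define \<sigma> where "\<sigma> = min (R / 2) (1 / 2)"
  have \<sigma>: "0 < \<sigma>" "\<sigma> < R" "\<sigma> \<le> 1 / 2" using R by (auto simp: \<sigma>_def min_def)
  \<comment> \<open>Here \<open>\<sigma> / 2 \<le> |a| \<le> 1\<close>, so a perturbation of the coefficients by less than \<open>(\<sigma> / 2)^n\<close> keeps \<open>P(a) \<noteq> 0\<close>.\<close>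
  define G where "G = {p. (\<Sum>k\<le>n. \<bar>c k p - c k 0\<bar>) < (\<sigma> / 2) ^ n \<and> \<bar>l p\<bar> < \<sigma> / 2}"
  have cont_c: "continuous_on UNIV (c k)" for k by (rule smooth_on_continuous[OF c])
  have cont_l: "continuous_on UNIV l" using l by (rule linear_continuous_on)
  have G: "open G" unfolding G_def
    by (intro open_Collect_conj open_Collect_less continuous_intros cont_c cont_l)
  have G0: "0 \<in> G" using \<sigma> l by (simp add: G_def linear_simps)
  define e where "e x = of_real \<sigma> * exp (2 * of_real pi * \<i> * of_real x)" for x :: real
  have norm_e: "cmod (e x) = \<sigma>" for x
    using \<sigma> by (simp add: e_def norm_mult norm_exp_eq_Re)
  have e_smooth: "smooth_on UNIV e"
  proof -
    have "smooth_on UNIV (exp :: complex \<Rightarrow> complex)"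
      by (rule holomorphic_on_imp_smooth_on) (auto intro: holomorphic_on_exp)
    from smooth_on_compose[OF open_UNIV this, of "\<lambda>x. 2 * of_real pi * \<i> * of_real x"]
    have "smooth_on UNIV (\<lambda>x::real. exp (2 * of_real pi * \<i> * of_real x) :: complex)"
      by (simp add: smooth_intros)
    then show ?thesis unfolding e_def[abs_def]
      by (intro smooth_intros) auto
  qed
  define \<kappa> where "\<kappa> x = - \<i> * (K (e x) * e x)" for x
  have \<kappa>: "smooth_on UNIV \<kappa>"
  proof -
    have "smooth_on UNIV (\<lambda>x. K (e x))"
      by (rule smooth_on_compose[OF open_UNIV holomorphic_on_imp_smooth_on[OF K] e_smooth])
         (use norm_e \<sigma> in auto)
    then show ?thesis unfolding \<kappa>_def[abs_def] by (intro smooth_intros e_smooth) auto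
  qed
  define a where "a p x = \<i> * (of_real (l p) - e x)" for p x
  have a_bounds: "\<sigma> / 2 \<le> cmod (a p x)" "cmod (a p x) \<le> 1" if "p \<in> G" for p x
  proof -
    have lp: "cmod (of_real (l p)) < \<sigma> / 2" using that by (simp add: G_def)
    have 1: "cmod (a p x) = cmod (of_real (l p) - e x)"
      by (simp add: a_def norm_mult)
    show "\<sigma> / 2 \<le> cmod (a p x)"
      using norm_triangle_ineq3[of "of_real (l p)" "e x"] lp unfolding 1 norm_e by linarith
    show "cmod (a p x) \<le> 1"
      using norm_triangle_ineq4[of "of_real (l p)" "e x"] lp \<sigma> unfolding 1 norm_e by linarith
  qed
  have av: "a p x - of_real v \<noteq> 0" if "p \<in> G" "\<bar>v\<bar> < \<sigma> / 2" for p x v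
  proof
    assume "a p x - of_real v = 0"
    then have "\<i> * a p x = \<i> * of_real v" by simp
    then have "e x = of_real (l p) + \<i> * of_real v"
      by (simp add: a_def algebra_simps)
    then have "\<sigma> \<le> \<bar>l p\<bar> + \<bar>v\<bar>"
      using norm_triangle_ineq[of "of_real (l p)" "\<i> * of_real v"] norm_e[of x] by (simp add: norm_mult)
    then show False using that by (simp add: G_def)
  qed
  define P where "P p z = (\<Sum>k\<le>n. of_real (c k p) * z ^ k)" for p and z :: complex
  have Pnz: "P p (a p x) \<noteq> 0" if "p \<in> G" for p x
  proof -
    have "P p z - z ^ n = (\<Sum>k\<le>n. of_real (c k p - c k 0) * z ^ k)" for z
    proof -
      have "(\<Sum>k\<le>n. of_real (c k 0) * z ^ k) = (\<Sum>k\<le>n. if k = n then z ^ k else 0)"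
        by (rule sum.cong) (auto simp: c0)
      then show ?thesis
        by (simp add: P_def algebra_simps sum_subtractf)
    qed
    then have "cmod (P p (a p x) - a p x ^ n) \<le> (\<Sum>k\<le>n. \<bar>c k p - c k 0\<bar> * cmod (a p x) ^ k)"
      by (simp only:) (rule sum_norm_le, simp add: norm_mult norm_power flip: of_real_diff)
    also have "\<dots> \<le> (\<Sum>k\<le>n. \<bar>c k p - c k 0\<bar>)"
      by (intro sum_mono mult_right_le_one_le power_le_one) (use a_bounds[OF that] in auto)
    also have "\<dots> < (\<sigma> / 2) ^ n" using that by (simp add: G_def)
    also have "\<dots> \<le> cmod (a p x ^ n)"
      unfolding norm_power by (rule power_mono) (use a_bounds[OF that] \<sigma> in auto)
    finally show ?thesis by auto
  qed
  define q where "q j p x = (\<Sum>k<n-j. of_real (c (j + k + 1) p) * a p x ^ k)" for j p x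
  define r where "r j p = integral {0..1} (\<lambda>x. Im (\<kappa> x * q j p x * inverse (P p (a p x))))" for j p
  define Q where "Q z = integral {0..1} (\<lambda>x. Im (\<kappa> x * inverse (P (fst z) (a (fst z) x)) *
      inverse (a (fst z) x - of_real (snd z))))" for z :: "'p \<times> real"
  have sm_comp: "smooth_on T (\<lambda>z. F (h z))" if "open T" "smooth_on UNIV F" "bounded_linear h"
    for T :: "'x::real_normed_vector set" and F :: "'y::euclidean_space \<Rightarrow> 'z::real_normed_vector" and h
    by (rule smooth_on_compose[OF that(1,2) smooth_on_linear[OF that(1,3)]]) simp
  have sm_r: "smooth_on G (r j)" for j
  proof -
    let ?T = "G \<times> (UNIV :: real set)"
    have T: "open ?T" by (intro open_Times G open_UNIV)
    note s = sm_comp[OF T c bounded_linear_fst] sm_comp[OF T \<kappa> bounded_linear_snd]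
      sm_comp[OF T e_smooth bounded_linear_snd]
      sm_comp[OF T smooth_on_linear[OF open_UNIV l] bounded_linear_fst]
    have sa: "smooth_on ?T (\<lambda>z. a (fst z) (snd z))"
      unfolding a_def by (intro smooth_intros T s)
    have sP: "smooth_on ?T (\<lambda>z. inverse (P (fst z) (a (fst z) (snd z))))"
      using Pnz unfolding P_def by (intro smooth_intros T s sa) auto
    have "smooth_on ?T (\<lambda>z. Im (\<kappa> (snd z) * q j (fst z) (snd z) * inverse (P (fst z) (a (fst z) (snd z)))))"
      unfolding q_def by (intro smooth_intros T s sa sP)
    from smooth_on_integral[OF G this] show ?thesis by (simp add: r_def[abs_def])
  qed
  have sm_Q: "smooth_on (G \<times> {-(\<sigma>/2)<..<\<sigma>/2}) Q"
  proof -
    let ?T = "(G \<times> {-(\<sigma>/2)<..<\<sigma>/2}) \<times> (UNIV :: real set)"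
    have T: "open ?T" "open (G \<times> {-(\<sigma>/2)<..<\<sigma>/2})" by (intro open_Times G open_UNIV open_greaterThanLessThan)+
    have bl: "bounded_linear (\<lambda>z. fst (fst z) :: 'p)" "bounded_linear (\<lambda>z. snd (fst z) :: real)"
      by (intro bounded_linear_compose[OF bounded_linear_fst bounded_linear_fst]
          bounded_linear_compose[OF bounded_linear_snd bounded_linear_fst])+
    note s = sm_comp[OF T(1) c bl(1)] sm_comp[OF T(1) \<kappa> bounded_linear_snd]
      sm_comp[OF T(1) e_smooth bounded_linear_snd]
      sm_comp[OF T(1) smooth_on_linear[OF open_UNIV l] bl(1)] smooth_on_linear[OF T(1) bl(2)]
    have sa: "smooth_on ?T (\<lambda>z. a (fst (fst z)) (snd z))"
      unfolding a_def by (intro smooth_intros T s)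
    have sP: "smooth_on ?T (\<lambda>z. inverse (P (fst (fst z)) (a (fst (fst z)) (snd z))))"
      using Pnz unfolding P_def by (intro smooth_intros T s sa) auto
    have sv: "smooth_on ?T (\<lambda>z. inverse (a (fst (fst z)) (snd z) - of_real (snd (fst z))))"
      using av by (intro smooth_intros T s sa) auto
    have "smooth_on ?T (\<lambda>z. Im (\<kappa> (snd z) * inverse (P (fst (fst z)) (a (fst (fst z)) (snd z))) *
        inverse (a (fst (fst z)) (snd z) - of_real (snd (fst z)))))"
      by (intro smooth_intros T s sa sP sv)
    from smooth_on_integral[OF T(2) this] show ?thesis by (simp add: Q_def[abs_def])
  qed
  have bound: "cmod (Complex (l p) v) < \<sigma>" if "p \<in> G" "\<bar>v\<bar> < \<sigma> / 2" for p v
  proof -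
    have "cmod (Complex (l p) v) \<le> \<bar>l p\<bar> + \<bar>v\<bar>" using cmod_le[of "Complex (l p) v"] by simp
    then show ?thesis using that by (simp add: G_def)
  qed
  have main: "Im (K (Complex (l p) v)) = (\<Sum>j<n. r j p * v ^ j) + (\<Sum>k\<le>n. c k p * v ^ k) * Q (p, v)"
    if pv: "p \<in> G" "\<bar>v\<bar> < \<sigma> / 2" for p v
  proof -
    have cont: "continuous_on UNIV e" "continuous_on UNIV \<kappa>"
      using e_smooth \<kappa> smooth_on_continuous by blast+
    have cc: "continuous_on {0..1} e" "continuous_on {0..1} \<kappa>"
      using cont continuous_on_subset by blast+
    have ca: "continuous_on {0..1} (a p)" unfolding a_def[abs_def] by (intro continuous_intros cc)
    have cP: "continuous_on {0..1} (\<lambda>x. P p (a p x))" unfolding P_def by (intro continuous_intros ca)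
    let ?r = "\<lambda>j x. Im (\<kappa> x * q j p x * inverse (P p (a p x)))"
    let ?Q = "\<lambda>x. Im (\<kappa> x * inverse (P p (a p x)) * inverse (a p x - of_real v))"
    have ir: "(?r j has_integral r j p) {0..1}" for j
      unfolding r_def q_def
      by (intro integrable_integral integrable_continuous_interval continuous_intros cc ca cP ballI)
         (use Pnz pv in auto)
    have iQ: "(?Q has_integral Q (p, v)) {0..1}"
      unfolding Q_def fst_conv snd_conv
      by (intro integrable_integral integrable_continuous_interval continuous_intros cc ca cP ballI)
         (use Pnz av pv in auto)
    have "((\<lambda>x. Im (K (e x) * e x / (e x - Complex (l p) v))) has_integral Im (K (Complex (l p) v))) {0..1}"
      using has_integral_linear[OF Cauchy_integral_unit_interval[OF K \<sigma>(1,2) bound[OF pv]] bounded_linear_Im]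
      by (simp add: o_def e_def)
    moreover have "Im (K (e x) * e x / (e x - Complex (l p) v)) =
        (\<Sum>j<n. ?r j x * v ^ j) + (\<Sum>k\<le>n. c k p * v ^ k) * ?Q x" for x
    proof -
      let ?a = "a p x"
      have eq: "P p (of_real v) - P p ?a = (of_real v - ?a) * (\<Sum>j<n. q j p x * of_real v ^ j)"
        unfolding P_def q_def using polyfun_diff_alt[OF n, of "\<lambda>k. of_real (c k p)" "of_real v" ?a]
        by (simp add: sum_distrib_right)
      have "e x - Complex (l p) v = \<i> * (?a - of_real v)"
        by (simp add: a_def Complex_eq algebra_simps)
      then have "K (e x) * e x / (e x - Complex (l p) v) = \<kappa> x / (?a - of_real v)"
        by (simp add: \<kappa>_def divide_simps)
      also have "\<dots> = (\<Sum>j<n. \<kappa> x * q j p x * inverse (P p ?a) * of_real v ^ j) +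
          P p (of_real v) * (\<kappa> x * inverse (P p ?a) * inverse (?a - of_real v))"
      proof -
        have "(\<Sum>j<n. \<kappa> x * q j p x * inverse (P p ?a) * of_real v ^ j) =
          \<kappa> x * inverse (P p ?a) * (\<Sum>j<n. q j p x * of_real v ^ j)"
          by (simp add: sum_distrib_left algebra_simps)
        also have "\<dots> = \<kappa> x * inverse (P p ?a) * ((P p ?a - P p (of_real v)) / (?a - of_real v))"
        proof -
          have "P p ?a - P p (of_real v) = (?a - of_real v) * (\<Sum>j<n. q j p x * of_real v ^ j)"
            using eq by (simp add: algebra_simps)
          then show ?thesis using av[OF pv, of x] by simp
        qed
        finally show ?thesis
          using Pnz[OF pv(1), of x] av[OF pv, of x] by (simp add: divide_simps) (simp add: algebra_simps)
      qed
      also have "P p (of_real v) = of_real (\<Sum>k\<le>n. c k p * v ^ k)"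
        by (simp add: P_def)
      finally have *: "K (e x) * e x / (e x - Complex (l p) v) =
          (\<Sum>j<n. \<kappa> x * q j p x * inverse (P p ?a) * of_real v ^ j) +
          of_real (\<Sum>k\<le>n. c k p * v ^ k) * (\<kappa> x * inverse (P p ?a) * inverse (?a - of_real v))" .
      have "Im ((\<Sum>j<n. A j * of_real v ^ j) + of_real s * B) = (\<Sum>j<n. Im (A j) * v ^ j) + s * Im B"
        for A :: "nat \<Rightarrow> complex" and B s
        by (simp flip: of_real_power)
      then show ?thesis unfolding * .
    qed
    moreover have "((\<lambda>x. (\<Sum>j<n. ?r j x * v ^ j) + (\<Sum>k\<le>n. c k p * v ^ k) * ?Q x) has_integral
        ((\<Sum>j<n. r j p * v ^ j) + (\<Sum>k\<le>n. c k p * v ^ k) * Q (p, v))) {0..1}"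
      by (intro has_integral_add has_integral_sum has_integral_mult_left has_integral_mult_right ir iQ) auto
    ultimately show ?thesis by (metis (no_types, lifting) has_integral_cong has_integral_unique)
  qed
  show ?thesis
  proof (rule that[of "\<sigma> / 2" G r Q])
    show "cmod (Complex (l p) v) < R" if "p \<in> G" "\<bar>v\<bar> < \<sigma> / 2" for p v
      using bound[OF that] \<sigma>(2) by simp
  qed (use \<sigma> G G0 sm_r sm_Q main in auto)
qed

section \<open>Discriminants and orders of vanishing\<close>

lemma diffeomorphism_restrict:
  assumes "diffeomorphism V W \<Phi>" "open V'" "V' \<subseteq> V"
  shows "diffeomorphism V' (\<Phi> ` V') \<Phi>"
proof -
  have bij: "bij_betw \<Phi> V W" and V: "open V" "open W" and sm: "smooth_on V \<Phi>" "smooth_on W (inv_into V \<Phi>)"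
    using assms(1) by (auto simp: diffeomorphism_def)
  have sub: "\<Phi> ` V' \<subseteq> W" using bij assms(3) by (auto simp: bij_betw_def)
  have inj: "inj_on \<Phi> V" using bij by (simp add: bij_betw_def)
  have inv: "inv_into V \<Phi> (\<Phi> x) = x" if "x \<in> V" for x using inv_into_f_f[OF inj that] .
  have "\<Phi> ` V' = W \<inter> inv_into V \<Phi> -` V'"
  proof
    show "\<Phi> ` V' \<subseteq> W \<inter> inv_into V \<Phi> -` V'" using sub inv assms(3) by auto
    show "W \<inter> inv_into V \<Phi> -` V' \<subseteq> \<Phi> ` V'"
    proof
      fix y assume "y \<in> W \<inter> inv_into V \<Phi> -` V'"
      then show "y \<in> \<Phi> ` V'"
        using f_inv_into_f[of y \<Phi> V] bij by (metis IntE bij_betw_imp_surj_on image_eqI vimageE)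
    qed
  qed
  then have op: "open (\<Phi> ` V')"
    using continuous_open_preimage[OF smooth_on_continuous[OF sm(2)] V(2) assms(2)] by simp
  have "smooth_on (\<Phi> ` V') (inv_into V' \<Phi>)"
  proof (rule smooth_on_cong[OF op _ smooth_on_subset[OF sm(2) sub]])
    fix y assume "y \<in> \<Phi> ` V'"
    then obtain x where x: "x \<in> V'" "y = \<Phi> x" by blast
    then show "inv_into V \<Phi> y = inv_into V' \<Phi> y"
      using inv[of x] assms(3) inv_into_f_f[OF inj_on_subset[OF inj assms(3)], of x] by auto
  qed
  moreover have "bij_betw \<Phi> V' (\<Phi> ` V')"
    using inj_on_subset[OF inj assms(3)] by (simp add: bij_betw_def)
  ultimately show ?thesis
    using assms(2) op smooth_on_subset[OF sm(1) assms(3)] by (simp add: diffeomorphism_def)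
qed

text \<open>If \<open>T\<close> is a local diffeomorphism, the points with \<open>T p \<in> range \<iota>\<close> form a submanifold parametrized by
  \<open>P = T\<^bsup>-1\<^esup> \<circ> \<iota>\<close>. The last hypothesis says that \<open>\<pi>\<close> is injective on its tangent space, so that \<open>\<pi> \<circ> P\<close> is a
  local diffeomorphism. In the application \<open>T\<close> sends the coefficients of the divisor to those of the
  remainder, \<open>\<iota>\<close> prescribes the remainder, and \<open>\<pi>\<close> keeps the coordinates of the normal form.\<close>

lemma smooth_slice_of_local_inverse:
  fixes T :: "'p::euclidean_space \<Rightarrow> 'p" and \<iota> :: "'s::euclidean_space \<Rightarrow> 'p" and \<pi> :: "'p \<Rightarrow> 's"
  assumes T: "open G" "smooth_on G T" "0 \<in> G" "T 0 = 0"
    and inj: "\<And>p. frechet_derivative T (at 0) p = 0 \<Longrightarrow> p = 0"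
    and lin: "bounded_linear \<iota>" "bounded_linear \<pi>"
    and trans: "\<And>p x. frechet_derivative T (at 0) p = \<iota> x \<Longrightarrow> \<pi> p = 0 \<Longrightarrow> x = 0"
  obtains V W P where "0 \<in> V" "smooth_on V P" "P 0 = 0"
    "\<And>x. x \<in> V \<Longrightarrow> P x \<in> G \<and> T (P x) = \<iota> x" "diffeomorphism V W (\<lambda>x. \<pi> (P x))"
proof -
  obtain V1 W1 where V1: "V1 \<subseteq> G" "0 \<in> V1" and d: "diffeomorphism V1 W1 T"
    using smooth_inverse_function[OF T(1-3) inj] by blast
  have bij: "bij_betw T V1 W1" and o: "open V1" "open W1" and sm: "smooth_on W1 (inv_into V1 T)"
    using d by (auto simp: diffeomorphism_def)
  define W2 where "W2 = \<iota> -` W1"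
  define P where "P x = inv_into V1 T (\<iota> x)" for x
  have W2: "open W2" unfolding W2_def
    by (rule continuous_open_vimage[OF o(2)]) (rule linear_continuous_at[OF lin(1)])
  have inj1: "inj_on T V1" using bij by (simp add: bij_betw_def)
  have P0: "P 0 = 0"
    using inv_into_f_f[OF inj1 V1(2)] T(4) lin(1) by (simp add: P_def linear_simps)
  have W20: "0 \<in> W2"
    using bij V1(2) T(4) lin(1) by (force simp: W2_def linear_simps bij_betw_def)
  have TP: "P x \<in> V1 \<and> T (P x) = \<iota> x" if "x \<in> W2" for x
    using that bij unfolding W2_def P_def bij_betw_def
    by (metis vimageE f_inv_into_f inv_into_into)
  have smP: "smooth_on W2 P"
    unfolding P_def[abs_def]
    by (rule smooth_on_compose[OF W2 sm smooth_on_linear[OF W2 lin(1)]]) (auto simp: W2_def)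
  have dP: "(P has_derivative frechet_derivative P (at 0)) (at 0)"
    by (rule smooth_on_has_derivative[OF smP W20])
  have dT: "(T has_derivative frechet_derivative T (at 0)) (at 0)"
    by (rule smooth_on_has_derivative[OF T(2,3)])
  have "((\<lambda>x. T (P x)) has_derivative (\<lambda>x. frechet_derivative T (at 0) (frechet_derivative P (at 0) x))) (at 0)"
    by (rule has_derivative_compose[OF dP]) (simp add: P0 dT)
  moreover have "((\<lambda>x. T (P x)) has_derivative \<iota>) (at 0)"
    by (rule has_derivative_transform_within_open[OF bounded_linear_imp_has_derivative[OF lin(1)] W2 W20])
       (simp add: TP)
  ultimately have DTP: "frechet_derivative T (at 0) (frechet_derivative P (at 0) x) = \<iota> x" for x
    using has_derivative_unique by (metis (no_types, lifting))
  have smF: "smooth_on W2 (\<lambda>x. \<pi> (P x))"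
    by (rule smooth_on_linear_comp[OF W2 lin(2) smP])
  have "frechet_derivative (\<lambda>x. \<pi> (P x)) (at 0) = (\<lambda>x. \<pi> (frechet_derivative P (at 0) x))"
    using frechet_derivative_at[OF bounded_linear.has_derivative[OF lin(2) dP]] by simp
  then have "x = 0" if "frechet_derivative (\<lambda>x. \<pi> (P x)) (at 0) x = 0" for x
    using that trans[OF DTP] by simp
  then obtain V W where VW: "V \<subseteq> W2" "0 \<in> V" "diffeomorphism V W (\<lambda>x. \<pi> (P x))"
    using smooth_inverse_function[OF W2 smF W20] by blast
  show ?thesis
    by (rule that[of V P W]) (use VW TP V1 P0 smooth_on_subset[OF smP] in auto)
qed

text \<open>\<open>R b w\<close> stands for: the normal form with coefficients \<open>b\<close> has a double zero at \<open>w\<close>. The coordinate change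
  \<open>\<Phi>\<close> respects double zeros up to the translation \<open>m\<close> of \<open>v\<close>. Small coefficients force small double
  zeros, so the double zeros that belong to points of the target near \<open>0\<close> come from parameters in
  \<open>N\<close>, however small \<open>N\<close> is.\<close>

lemma germ_of_parametrized_discriminant:
  fixes S :: "complex \<Rightarrow> space" and R :: "space \<Rightarrow> real \<Rightarrow> bool"
  assumes \<rho>: "0 < \<rho>" and V: "0 \<in> V" "diffeomorphism V W \<Phi>" "\<Phi> 0 = 0"
    and m: "continuous_on V m" "m 0 = 0"
    and S: "\<And>\<omega>. fst (S \<omega>) = Re \<omega>"
    and equiv: "\<And>x v. x \<in> V \<Longrightarrow> \<bar>v\<bar> < \<rho> \<Longrightarrow> S (Complex (fst x) v) = x \<longleftrightarrow> R (\<Phi> x) (v - m x)"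
    and small: "\<And>\<epsilon>. 0 < \<epsilon> \<Longrightarrow> \<exists>\<eta>>0. \<forall>b w. norm b < \<eta> \<longrightarrow> R b w \<longrightarrow> \<bar>w\<bar> < \<epsilon>"
    and N: "open N" "0 \<in> N" "N \<subseteq> ball 0 \<rho>"
  shows "diffeomorphic_germs (S ` N) 0 {b. \<exists>w. R b w} 0"
proof -
  obtain r where r: "r > 0" "ball 0 r \<subseteq> N" using N openE by blast
  define \<epsilon> where "\<epsilon> = min r \<rho> / 4"
  have \<epsilon>: "\<epsilon> > 0" "4 * \<epsilon> \<le> r" "4 * \<epsilon> \<le> \<rho>" using r \<rho> by (auto simp: \<epsilon>_def)
  obtain \<eta> where \<eta>: "\<eta> > 0" "\<And>b w. norm b < \<eta> \<Longrightarrow> R b w \<Longrightarrow> \<bar>w\<bar> < \<epsilon>"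
    using small[OF \<epsilon>(1)] by blast
  have oV: "open V" and \<Phi>c: "continuous_on V \<Phi>" and bij: "bij_betw \<Phi> V W"
    using V(2) smooth_on_continuous by (auto simp: diffeomorphism_def)
  \<comment> \<open>On \<open>V'\<close> a double zero \<open>w\<close> gives \<open>v = w + m\<close> with \<open>|v| < 2 \<epsilon>\<close> and \<open>|u| < \<epsilon>\<close>, hence \<open>u + i v \<in> N\<close>.\<close>
  define V' where "V' = (V \<inter> fst -` {-\<epsilon><..<\<epsilon>}) \<inter> ((V \<inter> m -` {-\<epsilon><..<\<epsilon>}) \<inter> (V \<inter> \<Phi> -` ball 0 \<eta>))"
  have V'mem: "x \<in> V' \<longleftrightarrow> x \<in> V \<and> \<bar>fst x\<bar> < \<epsilon> \<and> \<bar>m x\<bar> < \<epsilon> \<and> norm (\<Phi> x) < \<eta>" for x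
    by (auto simp: V'_def)
  have oV': "open V'" unfolding V'_def
    by (intro open_Int continuous_open_preimage[OF _ oV] m \<Phi>c continuous_on_fst continuous_on_id
        open_greaterThanLessThan open_ball)
  have 0: "0 \<in> V'" using V m(2) \<epsilon> \<eta> by (simp add: V'mem)
  have d: "diffeomorphism V' (\<Phi> ` V') \<Phi>"
    by (rule diffeomorphism_restrict[OF V(2) oV']) (auto simp: V'_def)
  have "\<Phi> ` (S ` N \<inter> V') = {b. \<exists>w. R b w} \<inter> \<Phi> ` V'"
  proof (intro equalityI subsetI)
    fix b assume "b \<in> \<Phi> ` (S ` N \<inter> V')"
    then obtain \<omega> where \<omega>: "\<omega> \<in> N" "S \<omega> \<in> V'" "b = \<Phi> (S \<omega>)" by blast
    have "\<bar>Im \<omega>\<bar> < \<rho>" using \<omega>(1) N(3) abs_Im_le_cmod[of \<omega>] by auto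
    moreover have "Complex (fst (S \<omega>)) (Im \<omega>) = \<omega>" by (simp add: S)
    ultimately have "R (\<Phi> (S \<omega>)) (Im \<omega> - m (S \<omega>))"
      using equiv[of "S \<omega>" "Im \<omega>"] \<omega>(2) by (simp add: V'mem)
    then show "b \<in> {b. \<exists>w. R b w} \<inter> \<Phi> ` V'" using \<omega> by auto
  next
    fix b assume "b \<in> {b. \<exists>w. R b w} \<inter> \<Phi> ` V'"
    then obtain w x where x: "R b w" "x \<in> V'" "b = \<Phi> x" by blast
    then have w: "\<bar>w\<bar> < \<epsilon>" using \<eta>(2)[of b w] by (simp add: V'mem)
    define v where "v = w + m x"
    have v: "\<bar>v\<bar> < 2 * \<epsilon>" using w x(2) unfolding v_def V'mem by linarith
    have "S (Complex (fst x) v) = x"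
      using equiv[of x v] x v \<epsilon> by (simp add: v_def V'mem)
    moreover have "Complex (fst x) v \<in> N"
    proof -
      have "cmod (Complex (fst x) v) \<le> \<bar>fst x\<bar> + \<bar>v\<bar>" using cmod_le[of "Complex (fst x) v"] by simp
      also have "\<dots> < r" using v x(2) \<epsilon> by (simp add: V'mem)
      finally show ?thesis using r(2) by auto
    qed
    ultimately have "x \<in> S ` N" by force
    then show "b \<in> \<Phi> ` (S ` N \<inter> V')" using x by blast
  qed
  then show ?thesis unfolding diffeomorphic_germs_def using d 0 V(3) by blast
qed

lemma polynomial_bigo_zero:
  fixes b :: "nat \<Rightarrow> real"
  assumes "(\<lambda>v. \<Sum>j<n. b j * v ^ j) \<in> O[at 0](\<lambda>v. v ^ n)" "j < n"
  shows "b j = 0"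
  using assms
proof (induction n arbitrary: b j)
  case 0
  from 0(2) show ?case by simp
next
  case (Suc n)
  have jn: "j < Suc n" by (rule Suc.prems(2))
  have "((\<lambda>v. \<Sum>j<Suc n. b j * v ^ j) \<longlongrightarrow> 0) (at 0)"
  proof -
    have "((\<lambda>v::real. v ^ Suc n) \<longlongrightarrow> 0 ^ Suc n) (at 0)" by (intro tendsto_intros)
    then have "((\<lambda>v::real. v ^ Suc n) \<longlongrightarrow> 0) (at 0)" by simp
    then have lim: "((\<lambda>v::real. c * norm (v ^ Suc n)) \<longlongrightarrow> 0) (at 0)" for c
      by (intro tendsto_mult_right_zero tendsto_norm_zero)
    obtain c where "\<forall>\<^sub>F v in at 0. norm (\<Sum>j<Suc n. b j * v ^ j) \<le> c * norm (v ^ Suc n)"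
      using landau_o.bigE[OF Suc.prems(1)] by blast
    then show ?thesis by (rule Lim_null_comparison[OF _ lim])
  qed
  moreover have "((\<lambda>v. \<Sum>j<Suc n. b j * v ^ j) \<longlongrightarrow> (\<Sum>j<Suc n. b j * 0 ^ j)) (at 0)"
    by (intro tendsto_intros)
  ultimately have "(\<Sum>j<Suc n. b j * 0 ^ j) = 0" using tendsto_unique by (metis trivial_limit_at)
  then have b0: "b 0 = 0" by (simp add: sum.lessThan_Suc_shift)
  have "(\<lambda>v. v * (\<Sum>j<n. b (Suc j) * v ^ j)) \<in> O[at 0](\<lambda>v. v * v ^ n)"
    using Suc.prems(1) by (simp add: sum.lessThan_Suc_shift b0 sum_distrib_left algebra_simps del: sum.lessThan_Suc)
  then have "(\<lambda>v. \<Sum>j<n. b (Suc j) * v ^ j) \<in> O[at 0](\<lambda>v. v ^ n)"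
    by (subst (asm) landau_o.big.mult_cancel_left) (auto simp: eventually_at_filter)
  note IH = Suc.IH[OF this]
  show ?case
  proof (cases j)
    case 0
    then show ?thesis using b0 by simp
  next
    case (Suc i)
    show ?thesis unfolding Suc by (rule IH) (use jn Suc in simp)
  qed
qed

lemma holomorphic_bigo_Taylor:
  assumes K: "K holomorphic_on ball 0 R" and R: "0 < R"
  shows "(\<lambda>v. Im (K (Complex 0 v)) - (\<Sum>j<n. Im ((deriv ^^ j) K 0 * \<i> ^ j) / fact j * v ^ j)) \<in> O[at 0](\<lambda>v. v ^ n)"
proof (cases n)
  case 0
  have "isCont K 0"
    using K R by (meson centre_in_ball continuous_on_eq_continuous_at holomorphic_on_imp_continuous_on open_ball)
  moreover have "isCont (Complex 0) 0"
    unfolding Complex_eq[abs_def] by (intro continuous_intros)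
  ultimately have "isCont (\<lambda>v. Im (K (Complex 0 v))) 0"
    by (intro isCont_Im isCont_o2[of 0 "Complex 0" K]) (auto simp: zero_complex.code)
  then have "((\<lambda>v. Im (K (Complex 0 v)) / 1) \<longlongrightarrow> Im (K (Complex 0 0))) (at 0)"
    by (simp add: isCont_def)
  from bigoI_tendsto[OF this] show ?thesis using 0 by simp
next
  case (Suc m)
  define B' where "B' = cball (0::complex) (R / 2)"
  have sub: "B' \<subseteq> ball 0 R" using R by (auto simp: B'_def)
  have hol: "(deriv ^^ i) K holomorphic_on ball 0 R" for i
    by (rule holomorphic_higher_deriv[OF K open_ball])
  have "compact ((deriv ^^ Suc m) K ` B')"
    using hol[of "Suc m"] sub unfolding B'_def
    by (intro compact_continuous_image compact_cball)
       (meson continuous_on_subset holomorphic_on_imp_continuous_on)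
  then obtain M where M: "\<And>x. x \<in> B' \<Longrightarrow> cmod ((deriv ^^ Suc m) K x) \<le> M"
    using compact_imp_bounded bounded_iff by (metis image_eqI)
  have T: "cmod (K z - (\<Sum>i\<le>m. (deriv ^^ i) K 0 * z ^ i / fact i)) \<le> M * cmod z ^ Suc m / fact m"
    if "z \<in> B'" for z
  proof -
    have "cmod ((deriv ^^ 0) K z - (\<Sum>i\<le>m. (deriv ^^ i) K 0 * (z - 0) ^ i / fact i)) \<le> M * cmod (z - 0) ^ Suc m / fact m"
    proof (rule complex_Taylor[where S = B' and f = "\<lambda>i. (deriv ^^ i) K"])
      show "((deriv ^^ i) K has_field_derivative (deriv ^^ Suc i) K x) (at x within B')" if "x \<in> B'" for i x
        using holomorphic_derivI[OF hol open_ball] sub that by auto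
    qed (use M that R in \<open>auto simp: B'_def\<close>)
    then show ?thesis by simp
  qed
  show ?thesis
  proof (rule bigoI[where c = "M / fact m"])
    have "\<forall>\<^sub>F v in at (0::real). \<bar>v\<bar> < R / 2"
      using R by (auto simp: eventually_at dist_real_def intro!: exI[of _ "R / 2"])
    then show "\<forall>\<^sub>F v in at 0. norm (Im (K (Complex 0 v)) - (\<Sum>j<n. Im ((deriv ^^ j) K 0 * \<i> ^ j) / fact j * v ^ j))
        \<le> M / fact m * norm (v ^ n)"
    proof eventually_elim
      case (elim v)
      let ?z = "Complex 0 v"
      have z: "?z = \<i> * of_real v" by (simp add: Complex_eq)
      have "?z \<in> B'" using elim by (simp add: B'_def z norm_mult)
      from T[OF this] have "cmod (K ?z - (\<Sum>i\<le>m. (deriv ^^ i) K 0 * ?z ^ i / fact i)) \<le> M / fact m * \<bar>v\<bar> ^ n"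
        by (simp add: z norm_mult Suc)
      moreover have "Im (K ?z - (\<Sum>i\<le>m. (deriv ^^ i) K 0 * ?z ^ i / fact i)) =
          Im (K ?z) - (\<Sum>j<n. Im ((deriv ^^ j) K 0 * \<i> ^ j) / fact j * v ^ j)"
      proof -
        have "Im ((deriv ^^ i) K 0 * ?z ^ i / fact i) = Im ((deriv ^^ i) K 0 * \<i> ^ i) / fact i * v ^ i" for i
        proof -
          have "(deriv ^^ i) K 0 * ?z ^ i / fact i = ((deriv ^^ i) K 0 * \<i> ^ i) * of_real (v ^ i / fact i)"
            by (simp add: z power_mult_distrib)
          then show ?thesis by (simp del: of_real_divide of_real_power)
        qed
        then show ?thesis unfolding Suc lessThan_Suc_atMost by simp
      qed
      ultimately show ?case
        using abs_Im_le_cmod[of "K ?z - (\<Sum>i\<le>m. (deriv ^^ i) K 0 * ?z ^ i / fact i)"]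
        by (simp add: power_abs)
    qed
  qed
qed

lemma bigo_imp_tendsto_zero:
  fixes f g :: "'a \<Rightarrow> real"
  assumes "f \<in> O[F](g)" "(g \<longlongrightarrow> 0) F"
  shows "(f \<longlongrightarrow> 0) F"
proof -
  obtain c where "\<forall>\<^sub>F x in F. norm (f x) \<le> c * norm (g x)"
    using landau_o.bigE[OF assms(1)] by blast
  then show ?thesis
    by (rule Lim_null_comparison) (intro tendsto_mult_right_zero tendsto_norm_zero assms(2))
qed

lemma continuous_power_bigo:
  fixes f :: "real \<Rightarrow> real"
  assumes "isCont f 0"
  shows "(\<lambda>v. v ^ n * f v) \<in> O[at 0](\<lambda>v. v ^ n)"
proof -
  have "((\<lambda>v. f v / 1) \<longlongrightarrow> f 0) (at 0)" using assms by (simp add: isCont_def)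
  from bigoI_tendsto[OF this] have "f \<in> O[at 0](\<lambda>_. 1)" by simp
  from landau_o.big.mult[OF landau_o.big_refl[of "\<lambda>v. v ^ n" "at 0"] this] show ?thesis by simp
qed

lemma bigo_cong_near_zero:
  fixes f g :: "real \<Rightarrow> real"
  assumes "f \<in> O[at 0](h)" "0 < \<rho>" "\<And>v. \<bar>v\<bar> < \<rho> \<Longrightarrow> f v = g v"
  shows "g \<in> O[at 0](h)"
proof -
  have "\<forall>\<^sub>F v in at 0. f v = g v"
    using assms(2,3) by (auto simp: eventually_at dist_real_def)
  then show ?thesis using assms(1) landau_o.big.in_cong by blast
qed

lemma sum_top_coefficient:
  fixes b :: "nat \<Rightarrow> real"
  assumes "\<And>k. k \<le> n \<Longrightarrow> b k = (if k = n then 1 else 0)"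
  shows "(\<Sum>k\<le>n. b k * v ^ k) = v ^ n"
proof -
  have "(\<Sum>k\<le>n. b k * v ^ k) = (\<Sum>k\<le>n. if k = n then v ^ k else 0)"
    by (rule sum.cong) (auto simp: assms)
  then show ?thesis by simp
qed

lemma holomorphic_Im_vertical_derivative:
  assumes "K holomorphic_on ball 0 R" "cmod (Complex u v) < R"
  shows "((\<lambda>v. Im (K (Complex u v))) has_real_derivative Re (deriv K (Complex u v))) (at v)"
proof -
  have K: "(K has_field_derivative deriv K (Complex u v)) (at (Complex u v))"
    by (rule holomorphic_derivI[OF assms(1) open_ball]) (use assms(2) in simp)
  have "((\<lambda>v. Complex u v) has_derivative (\<lambda>h. \<i> * of_real h)) (at v)"
    unfolding Complex_eq by (auto intro!: derivative_eq_intros)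
  from has_derivative_compose[OF this K[unfolded has_field_derivative_def]]
  have "((\<lambda>v. K (Complex u v)) has_derivative (\<lambda>h. deriv K (Complex u v) * (\<i> * of_real h))) (at v)" .
  from bounded_linear.has_derivative[OF bounded_linear_Im this]
  show ?thesis by (simp add: has_field_derivative_def)
qed

text \<open>The derivative at \<open>p = 0\<close> of \<open>\<phi> = \<Sum> r\<^sub>j v^j + P Q\<close>, where \<open>P\<^sub>0 = v^n\<close>: the derivative of \<open>Q\<close> is multiplied by
  \<open>v^n\<close>, so it disappears modulo \<open>O(v^n)\<close>. Together with \<open>polynomial_bigo_zero\<close> this compares
  coefficients below degree \<open>n\<close> without differentiating the integrals that define \<open>r\<close> and \<open>Q\<close>.\<close>

lemma directional_derivative_of_division:
  fixes c :: "nat \<Rightarrow> 'p::euclidean_space \<Rightarrow> real" and l :: "'p \<Rightarrow> real" and n :: nat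
  assumes K: "K holomorphic_on ball 0 R" and R: "0 < R" and l: "bounded_linear l"
    and c0: "\<And>k. k \<le> n \<Longrightarrow> c k 0 = (if k = n then 1 else 0)"
    and c': "\<And>k. k \<le> n \<Longrightarrow> (c k has_derivative c' k) (at 0)"
    and \<rho>: "0 < \<rho>" and G: "open G" "0 \<in> G" and r: "\<And>j. smooth_on G (r j)"
    and Q: "smooth_on (G \<times> {-\<rho><..<\<rho>}) Q"
    and bound: "\<And>p v. p \<in> G \<Longrightarrow> \<bar>v\<bar> < \<rho> \<Longrightarrow> cmod (Complex (l p) v) < R"
    and eq: "\<And>p v. p \<in> G \<Longrightarrow> \<bar>v\<bar> < \<rho> \<Longrightarrow>
       Im (K (Complex (l p) v)) = (\<Sum>j<n. r j p * v ^ j) + (\<Sum>k\<le>n. c k p * v ^ k) * Q (p, v)"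
  shows "(\<lambda>v. Im (deriv K (Complex 0 v)) * l p - (\<Sum>j<n. frechet_derivative (r j) (at 0) p * v ^ j)
      - (\<Sum>k\<le>n. c' k p * v ^ k) * Q (0, v)) \<in> O[at 0](\<lambda>v. v ^ n)"
proof (rule bigo_cong_near_zero[OF _ \<rho>])
  let ?Q' = "\<lambda>v. frechet_derivative Q (at (0, v)) (p, 0)"
  have oGI: "open (G \<times> {-\<rho><..<\<rho>})" by (intro open_Times G open_greaterThanLessThan)
  have "continuous_on {-\<rho><..<\<rho>} ?Q'"
    by (rule continuous_on_compose2[OF smooth_on_continuous[OF smooth_on_directional[OF Q]]])
       (use G in \<open>auto intro!: continuous_intros\<close>)
  then have "isCont ?Q' 0"
    using \<rho> by (metis continuous_on_eq_continuous_at greaterThanLessThan_iff neg_less_0_iff_less open_greaterThanLessThan)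
  then show "(\<lambda>v. v ^ n * ?Q' v) \<in> O[at 0](\<lambda>v. v ^ n)" by (rule continuous_power_bigo)
  fix v assume v: "\<bar>v\<bar> < \<rho>"
  have l0: "l 0 = 0" using l by (simp add: linear_simps)
  have dl: "(l has_derivative l) (at 0)" by (rule bounded_linear_imp_has_derivative[OF l])
  have dK: "(K has_field_derivative deriv K (Complex 0 v)) (at (Complex (l 0) v))"
    using holomorphic_derivI[OF K open_ball, of "Complex 0 v"] bound[OF G(2) v] l0 by simp
  have "((\<lambda>p. Complex (l p) v) has_derivative (\<lambda>p. of_real (l p))) (at 0)"
    unfolding Complex_eq by (auto intro!: derivative_eq_intros dl)
  from bounded_linear.has_derivative[OF bounded_linear_Im has_derivative_compose[OF this dK[unfolded has_field_derivative_def]]]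
  have 1: "((\<lambda>p. Im (K (Complex (l p) v))) has_derivative (\<lambda>p. Im (deriv K (Complex 0 v) * of_real (l p)))) (at 0)" .
  have dr: "(r j has_derivative frechet_derivative (r j) (at 0)) (at 0)" for j
    by (rule smooth_on_has_derivative[OF r G(2)])
  have dQ: "((\<lambda>p. Q (p, v)) has_derivative (\<lambda>p. frechet_derivative Q (at (0, v)) (p, 0))) (at 0)"
  proof (rule has_derivative_compose[of "\<lambda>p. (p, v)" "\<lambda>p. (p, 0)"])
    show "((\<lambda>p. (p, v)) has_derivative (\<lambda>p. (p, 0))) (at 0)"
      by (intro has_derivative_Pair has_derivative_ident has_derivative_const)
    show "(Q has_derivative frechet_derivative Q (at (0, v))) (at (0, v))"
      by (rule smooth_on_has_derivative[OF Q]) (use G v in auto)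
  qed
  have 2: "((\<lambda>p. (\<Sum>j<n. r j p * v ^ j) + (\<Sum>k\<le>n. c k p * v ^ k) * Q (p, v)) has_derivative
      (\<lambda>p. (\<Sum>j<n. frechet_derivative (r j) (at 0) p * v ^ j) +
        ((\<Sum>k\<le>n. c k 0 * v ^ k) * frechet_derivative Q (at (0, v)) (p, 0) + (\<Sum>k\<le>n. c' k p * v ^ k) * Q (0, v)))) (at 0)"
    by (intro has_derivative_add has_derivative_mult has_derivative_sum has_derivative_mult_left dr dQ c') auto
  have "((\<lambda>p. Im (K (Complex (l p) v))) has_derivative
      (\<lambda>p. (\<Sum>j<n. frechet_derivative (r j) (at 0) p * v ^ j) +
        ((\<Sum>k\<le>n. c k 0 * v ^ k) * frechet_derivative Q (at (0, v)) (p, 0) + (\<Sum>k\<le>n. c' k p * v ^ k) * Q (0, v)))) (at 0)"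
    by (rule has_derivative_transform_within_open[OF 2 G]) (simp add: eq v)
  from has_derivative_unique[OF 1 this]
  have "Im (deriv K (Complex 0 v) * of_real (l p)) = (\<Sum>j<n. frechet_derivative (r j) (at 0) p * v ^ j) +
        ((\<Sum>k\<le>n. c k 0 * v ^ k) * ?Q' v + (\<Sum>k\<le>n. c' k p * v ^ k) * Q (0, v))"
    by (rule fun_cong)
  moreover have "(\<Sum>k\<le>n. c k 0 * v ^ k) = v ^ n"
    by (rule sum_top_coefficient[OF c0])
  ultimately show "v ^ n * ?Q' v = Im (deriv K (Complex 0 v)) * l p - (\<Sum>j<n. frechet_derivative (r j) (at 0) p * v ^ j)
      - (\<Sum>k\<le>n. c' k p * v ^ k) * Q (0, v)"
    by simp
qed

section \<open>Weierstrass preparation and versality\<close>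

text \<open>With \<open>\<phi>(u, v) = Im K(u + i v)\<close> this is \<open>(u, \<phi>\<^sub>v, \<phi> - v \<phi>\<^sub>v)\<close>, where \<open>\<omega> = u + i v\<close>: the tangent line of \<open>\<phi>(u, _)\<close> at \<open>v\<close> has
  slope \<open>y\<close> and intercept \<open>z\<close>.\<close>

definition legendre_surface :: "(complex \<Rightarrow> complex) \<Rightarrow> complex \<Rightarrow> space" where
  "legendre_surface K \<omega> = (Re \<omega>, Re (deriv K \<omega>), Im (K \<omega>) - Im \<omega> * Re (deriv K \<omega>))"

abbreviation legendre_germs :: "(complex \<Rightarrow> complex) \<Rightarrow> space set \<Rightarrow> bool" where
  "legendre_germs K NF \<equiv> \<exists>\<rho>>0. \<forall>N. open N \<and> 0 \<in> N \<and> N \<subseteq> ball 0 \<rho> \<longrightarrow>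
      diffeomorphic_germs (legendre_surface K ` N) 0 NF 0"

text \<open>\<open>T\<close> collects \<open>u\<close> and the \<open>n\<close> coefficients of the remainder of \<open>\<phi>\<close> after division by \<open>P\<^sub>p\<close>. It is a local
  diffeomorphism because \<open>\<phi>(0, v) = v^n Q(0, v)\<close> with \<open>Q(0, 0) \<noteq> 0\<close>, so that a change of \<open>P\<close> changes the
  remainder. On the slice where the remainder is \<open>z + y v\<close> the polynomial \<open>P\<close> divides \<open>\<phi> - y v - z\<close> with
  nonvanishing quotient, and both have the same double zeros.

  The hypotheses \<open>kern2\<close> and \<open>kern3\<close> express versality. A tangent vector to the slice that is invisible
  to \<open>\<pi>\<close> changes \<open>P\<close> only in degree \<open>n - 1\<close>; hence \<open>u \<phi>\<^sub>u(0, v) - y v - z\<close> is \<open>O(v^(n-1))\<close>, and \<open>kern3\<close> supplies a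
  coefficient of \<open>\<phi>\<^sub>u\<close> in a degree between \<open>2\<close> and \<open>n - 2\<close> that forces \<open>u = 0\<close>, unless \<open>\<pi>\<close> records \<open>u\<close>. The
  coefficients of \<open>\<phi>\<close> and \<open>\<phi>\<^sub>u\<close> on the line \<open>u = 0\<close> are \<open>Im (K\<^bsup>(j)\<^esup>(0) i^j) / j!\<close> and
  \<open>Im (K\<^bsup>(j+1)\<^esup>(0) i^j) / j!\<close>.\<close>

lemma discriminant_germ:
  fixes c c' :: "nat \<Rightarrow> 'p::euclidean_space \<Rightarrow> real" and l \<mu> :: "'p \<Rightarrow> real"
    and eu :: 'p and e :: "nat \<Rightarrow> 'p" and \<pi> :: "'p \<Rightarrow> space"
  assumes K: "K holomorphic_on ball 0 R" and R: "0 < R" and n: "3 \<le> n"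
    and order: "\<And>j. j < n \<Longrightarrow> Im ((deriv ^^ j) K 0 * \<i> ^ j) = 0" "Im ((deriv ^^ n) K 0 * \<i> ^ n) \<noteq> 0"
    and c: "\<And>k. smooth_on UNIV (c k)" and l: "bounded_linear l" and \<mu>: "bounded_linear \<mu>" and \<pi>: "bounded_linear \<pi>"
    and c0: "\<And>k. k \<le> n \<Longrightarrow> c k 0 = (if k = n then 1 else 0)"
    and c': "\<And>k. k \<le> n \<Longrightarrow> (c k has_derivative c' k) (at 0)" and c'n: "\<And>p. c' n p = 0"
    and indep: "\<And>a b. a *\<^sub>R eu + (\<Sum>j<n. b j *\<^sub>R e j) = 0 \<Longrightarrow> a = 0 \<and> (\<forall>j<n. b j = 0)"
    and kern1: "\<And>p. l p = 0 \<Longrightarrow> (\<And>k. k < n \<Longrightarrow> c' k p = 0) \<Longrightarrow> p = 0"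
    and kern2: "\<And>p k. \<pi> p = 0 \<Longrightarrow> k < n - 1 \<Longrightarrow> c' k p = 0"
    and kern3: "\<And>p. \<pi> p = 0 \<Longrightarrow> l p \<noteq> 0 \<Longrightarrow> \<exists>j. 2 \<le> j \<and> j < n - 1 \<and> Im ((deriv ^^ Suc j) K 0 * \<i> ^ j) \<noteq> 0"
    and D: "\<And>p v. D (\<pi> p) (v - \<mu> p) \<longleftrightarrow>
        (\<Sum>k\<le>n. c k p * v ^ k) = 0 \<and> (\<Sum>k\<le>n. c k p * (real k * v ^ (k - 1))) = 0"
    and small: "\<And>\<epsilon>. 0 < \<epsilon> \<Longrightarrow> \<exists>\<eta>>0. \<forall>b w. norm b < \<eta> \<longrightarrow> D b w \<longrightarrow> \<bar>w\<bar> < \<epsilon>"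
  shows "legendre_germs K {b. \<exists>w. D b w}"
proof -
  obtain \<rho>1 G1 r Q where \<rho>1: "0 < \<rho>1" and G1: "open G1" "0 \<in> G1" and r1: "\<And>j. smooth_on G1 (r j)"
    and Q1: "smooth_on (G1 \<times> {-\<rho>1<..<\<rho>1}) Q"
    and bound: "\<And>p v. p \<in> G1 \<Longrightarrow> \<bar>v\<bar> < \<rho>1 \<Longrightarrow> cmod (Complex (l p) v) < R"
    and eq: "\<And>p v. p \<in> G1 \<Longrightarrow> \<bar>v\<bar> < \<rho>1 \<Longrightarrow>
       Im (K (Complex (l p) v)) = (\<Sum>j<n. r j p * v ^ j) + (\<Sum>k\<le>n. c k p * v ^ k) * Q (p, v)"
    by (rule analytic_division[OF K R _ c l c0]) (use n in auto)
  have l0: "l 0 = 0" using l by (simp add: linear_simps)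
  have P0: "(\<Sum>k\<le>n. c k 0 * v ^ k) = v ^ n" for v
    by (rule sum_top_coefficient[OF c0])
  have Qc: "isCont (\<lambda>v. Q (0, v)) 0"
  proof -
    have "continuous_on {-\<rho>1<..<\<rho>1} (\<lambda>v. Q (0, v))"
      by (rule continuous_on_compose2[OF smooth_on_continuous[OF Q1]])
         (use G1 in \<open>auto intro!: continuous_intros\<close>)
    then show ?thesis
      using \<rho>1 by (metis continuous_on_eq_continuous_at greaterThanLessThan_iff neg_less_0_iff_less open_greaterThanLessThan)
  qed
  have eq0: "Im (K (Complex 0 v)) = (\<Sum>j<n. r j 0 * v ^ j) + v ^ n * Q (0, v)" if "\<bar>v\<bar> < \<rho>1" for v
    using eq[OF G1(2) that] by (simp add: P0 l0)
  have K0: "(\<lambda>v. Im (K (Complex 0 v))) \<in> O[at 0](\<lambda>v. v ^ n)"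
  proof -
    have "(\<Sum>j<n. Im ((deriv ^^ j) K 0 * \<i> ^ j) / fact j * v ^ j) = 0" for v :: real
      by (rule sum.neutral) (simp add: order(1) del: times_complex.sel)
    then show ?thesis using holomorphic_bigo_Taylor[OF K R, of n] by (simp only: diff_zero)
  qed
  have r0: "r j 0 = 0" if "j < n" for j
  proof (rule polynomial_bigo_zero[OF _ that])
    show "(\<lambda>v. \<Sum>j<n. r j 0 * v ^ j) \<in> O[at 0](\<lambda>v. v ^ n)"
      by (rule bigo_cong_near_zero[OF sum_in_bigo(2)[OF K0 continuous_power_bigo[OF Qc]] \<rho>1])
         (simp add: eq0)
  qed
  have Q0: "Q (0, 0) \<noteq> 0"
  proof -
    define a where "a = Im ((deriv ^^ n) K 0 * \<i> ^ n) / fact n"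
    have "(\<Sum>j<Suc n. Im ((deriv ^^ j) K 0 * \<i> ^ j) / fact j * v ^ j) = a * v ^ n" for v :: real
    proof -
      have "(\<Sum>j<n. Im ((deriv ^^ j) K 0 * \<i> ^ j) / fact j * v ^ j) = 0"
        by (rule sum.neutral) (simp add: order(1) del: times_complex.sel)
      then show ?thesis by (simp only: sum.lessThan_Suc a_def)
    qed
    then have "(\<lambda>v. Im (K (Complex 0 v)) - a * v ^ n) \<in> O[at 0](\<lambda>v. v ^ Suc n)"
      using holomorphic_bigo_Taylor[OF K R, of "Suc n"] by (simp only:)
    then have "(\<lambda>v. v ^ n * (Q (0, v) - a)) \<in> O[at 0](\<lambda>v. v ^ Suc n)"
      by (rule bigo_cong_near_zero[OF _ \<rho>1]) (simp add: eq0 r0 algebra_simps)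
    then have "(\<lambda>v. v ^ n * (Q (0, v) - a)) \<in> O[at 0](\<lambda>v. v ^ n * v)"
      by (simp add: mult.commute)
    then have "(\<lambda>v. Q (0, v) - a) \<in> O[at 0](\<lambda>v. v)"
    proof (subst (asm) landau_o.big.mult_cancel_left)
      show "\<forall>\<^sub>F v in at 0. v ^ n \<noteq> (0::real)"
        by (rule eventually_mono[OF eventually_neq_at_within[of 0]]) simp
    qed simp
    then have "((\<lambda>v. Q (0, v) - a) \<longlongrightarrow> 0) (at 0)"
      by (rule bigo_imp_tendsto_zero) (rule tendsto_ident_at)
    moreover have "((\<lambda>v. Q (0, v) - a) \<longlongrightarrow> Q (0, 0) - a) (at 0)"
      using Qc by (intro tendsto_diff tendsto_const) (simp add: isCont_def)
    ultimately have "Q (0, 0) = a" using tendsto_unique trivial_limit_at by fastforce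
    then show ?thesis using order(2) by (simp add: a_def)
  qed
  \<comment> \<open>The slice is taken inside the region where \<open>Q\<close> does not vanish, so double zeros are preserved on all of it.\<close>
  obtain G \<rho> where G: "open G" "0 \<in> G" "G \<subseteq> G1" and \<rho>: "0 < \<rho>" "\<rho> \<le> \<rho>1"
    and Qnz: "\<And>p v. p \<in> G \<Longrightarrow> \<bar>v\<bar> < \<rho> \<Longrightarrow> Q (p, v) \<noteq> 0"
  proof -
    let ?U = "(G1 \<times> {-\<rho>1<..<\<rho>1}) \<inter> Q -` (- {0})"
    have "open ?U"
      by (intro continuous_open_preimage[OF smooth_on_continuous[OF Q1]] open_Times G1 open_greaterThanLessThan)
         (simp add: open_Compl)
    moreover have "(0, 0) \<in> ?U" using G1 \<rho>1 Q0 by simp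
    ultimately obtain A B where AB: "open A" "open B" "(0, 0) \<in> A \<times> B" "A \<times> B \<subseteq> ?U"
      by (rule open_prod_elim)
    from AB(2,3) obtain s where s: "s > 0" "ball 0 s \<subseteq> B" using openE by blast
    show ?thesis
    proof (rule that[of A "min s \<rho>1"])
      show "A \<subseteq> G1" using AB(3,4) by blast
      show "Q (p, v) \<noteq> 0" if "p \<in> A" "\<bar>v\<bar> < min s \<rho>1" for p v
        using that AB(4) s(2) by (auto simp: subset_iff)
    qed (use AB s \<rho>1 in auto)
  qed
  have r: "smooth_on G (r j)" for j by (rule smooth_on_subset[OF r1 G(3)])
  let ?r' = "\<lambda>j. frechet_derivative (r j) (at 0)"
  have dI: "(\<lambda>v. Im (deriv K (Complex 0 v)) * l p - (\<Sum>j<n. ?r' j p * v ^ j)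
      - (\<Sum>k\<le>n. c' k p * v ^ k) * Q (0, v)) \<in> O[at 0](\<lambda>v. v ^ n)" for p
    by (rule directional_derivative_of_division[OF K R l c0 c' \<rho>1 G1 r1 Q1 bound eq])
  define T where "T p = l p *\<^sub>R eu + (\<Sum>j<n. r j p *\<^sub>R e j)" for p
  have dT: "frechet_derivative T (at 0) p = l p *\<^sub>R eu + (\<Sum>j<n. ?r' j p *\<^sub>R e j)" for p
  proof -
    have "(T has_derivative (\<lambda>p. l p *\<^sub>R eu + (\<Sum>j<n. ?r' j p *\<^sub>R e j))) (at 0)"
      unfolding T_def[abs_def]
    proof (rule has_derivative_add)
      show "((\<lambda>p. l p *\<^sub>R eu) has_derivative (\<lambda>p. l p *\<^sub>R eu)) (at 0)"
        by (rule bounded_linear.has_derivative[OF bounded_linear_scaleR_left bounded_linear_imp_has_derivative[OF l]])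
      show "((\<lambda>p. \<Sum>j<n. r j p *\<^sub>R e j) has_derivative (\<lambda>p. \<Sum>j<n. ?r' j p *\<^sub>R e j)) (at 0)"
      proof (rule has_derivative_sum)
        show "((\<lambda>p. r j p *\<^sub>R e j) has_derivative (\<lambda>p. ?r' j p *\<^sub>R e j)) (at 0)" for j
          by (rule bounded_linear.has_derivative[OF bounded_linear_scaleR_left smooth_on_has_derivative[OF r G(2)]])
      qed
    qed
    from frechet_derivative_at[OF this] show ?thesis by (simp add: fun_eq_iff)
  qed
  have smT: "smooth_on G T" unfolding T_def[abs_def]
    by (intro smooth_on_add smooth_on_sum G(1) smooth_on_linear_comp[OF G(1) bounded_linear_scaleR_left]
        r smooth_on_linear[OF G(1) l])
  have T0: "T 0 = 0" by (simp add: T_def l0 r0)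
  have injT: "p = 0" if "frechet_derivative T (at 0) p = 0" for p
  proof (rule kern1)
    from indep[of "l p" "\<lambda>j. ?r' j p"] that dT
    have lp: "l p = 0" and rp: "\<And>j. j < n \<Longrightarrow> ?r' j p = 0" by auto
    show "l p = 0" by (rule lp)
    have "(\<lambda>v. (\<Sum>k<n. c' k p * v ^ k) * Q (0, v)) \<in> O[at 0](\<lambda>v. v ^ n)"
    proof -
      have "(\<Sum>j<n. ?r' j p * v ^ j) = 0" for v
        by (rule sum.neutral) (simp add: rp)
      then have "(\<lambda>v. - ((\<Sum>k<n. c' k p * v ^ k) * Q (0, v))) \<in> O[at 0](\<lambda>v. v ^ n)"
        using dI[of p] by (simp add: lp c'n flip: lessThan_Suc_atMost)
      then show ?thesis by (simp only: landau_o.big.uminus_in_iff)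
    qed
    moreover have "(\<lambda>v. inverse (Q (0, v))) \<in> O[at 0](\<lambda>v. 1)"
    proof (rule bigoI_tendsto)
      show "((\<lambda>v. inverse (Q (0, v)) / 1) \<longlongrightarrow> inverse (Q (0, 0))) (at 0)"
        using Qc Q0 by (simp add: isCont_def tendsto_inverse)
    qed simp
    ultimately have "(\<lambda>v. (\<Sum>k<n. c' k p * v ^ k) * Q (0, v) * inverse (Q (0, v))) \<in> O[at 0](\<lambda>v. v ^ n * 1)"
      by (rule landau_o.big.mult)
    then have "(\<lambda>v. (\<Sum>k<n. c' k p * v ^ k) * Q (0, v) * inverse (Q (0, v))) \<in> O[at 0](\<lambda>v. v ^ n)"
      by simp
    then have "(\<lambda>v. \<Sum>k<n. c' k p * v ^ k) \<in> O[at 0](\<lambda>v. v ^ n)"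
      by (rule bigo_cong_near_zero[OF _ \<rho>(1)]) (simp add: Qnz[OF G(2)])
    then show "c' k p = 0" if "k < n" for k using that by (rule polynomial_bigo_zero[where b = "\<lambda>k. c' k p"])
  qed
  define b :: "space \<Rightarrow> nat \<Rightarrow> real"
    where "b x j = (if j = 0 then snd (snd x) else if j = 1 then fst (snd x) else 0)" for x j
  have bl_b: "bounded_linear (\<lambda>x. b x j)" for j
  proof -
    consider "j = 0" | "j = 1" | "j \<noteq> 0" "j \<noteq> 1" by blast
    then show ?thesis
      by cases (auto simp: b_def[abs_def] intro: bounded_linear_compose[OF bounded_linear_snd bounded_linear_snd]
          bounded_linear_compose[OF bounded_linear_fst bounded_linear_snd])
  qed
  define \<iota> where "\<iota> x = fst x *\<^sub>R eu + (\<Sum>j<n. b x j *\<^sub>R e j)" for x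
  have \<iota>: "bounded_linear \<iota>" unfolding \<iota>_def[abs_def]
    by (intro bounded_linear_add bounded_linear_sum bounded_linear_compose[OF bounded_linear_scaleR_left]
        bl_b bounded_linear_fst)
  have split: "l' = fst x \<and> (\<forall>j<n. b' j = b x j)"
    if "l' *\<^sub>R eu + (\<Sum>j<n. b' j *\<^sub>R e j) = \<iota> x" for l' b' x
  proof -
    have "(l' - fst x) *\<^sub>R eu + (\<Sum>j<n. (b' j - b x j) *\<^sub>R e j) = 0"
      using that by (simp add: \<iota>_def scaleR_diff_left sum_subtractf add_diff_add[symmetric])
    from indep[OF this] show ?thesis by auto
  qed
  have trans: "x = 0" if Tp: "frechet_derivative T (at 0) p = \<iota> x" and \<pi>p: "\<pi> p = 0" for p x
  proof -
    from split[of "l p" "\<lambda>j. ?r' j p" x] Tp dT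
    have lp: "l p = fst x" and rp: "\<And>j. j < n \<Longrightarrow> ?r' j p = b x j" by auto
    define a where "a j = Im ((deriv ^^ Suc j) K 0 * \<i> ^ j) / fact j" for j
    obtain m where m: "n = Suc m" using n by (cases n) auto
    have pw: "(\<lambda>v::real. v ^ n) \<in> O[at 0](\<lambda>v. v ^ m)"
      using continuous_power_bigo[of "\<lambda>v. v" m] by (simp add: m mult.commute)
    have "(\<lambda>v. Im (deriv K (Complex 0 v)) * l p - (\<Sum>j<n. b x j * v ^ j) - c' m p * v ^ m * Q (0, v)) \<in> O[at 0](\<lambda>v. v ^ m)"
    proof -
      have 1: "(\<Sum>j<n. ?r' j p * v ^ j) = (\<Sum>j<n. b x j * v ^ j)" for v
        by (rule sum.cong) (auto simp: rp)
      have 2: "(\<Sum>k\<le>n. c' k p * v ^ k) = c' m p * v ^ m" for v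
      proof -
        have "(\<Sum>k<m. c' k p * v ^ k) = 0" by (rule sum.neutral) (use kern2[OF \<pi>p] m in auto)
        then show ?thesis by (simp add: m c'n[unfolded m] flip: lessThan_Suc_atMost)
      qed
      show ?thesis using landau_o.big_trans[OF dI[of p] pw] unfolding 1 2 .
    qed
    moreover have "(\<lambda>v. v ^ m * (c' m p * Q (0, v))) \<in> O[at 0](\<lambda>v. v ^ m)"
      by (intro continuous_power_bigo continuous_intros Qc)
    ultimately have 3: "(\<lambda>v. (Im (deriv K (Complex 0 v)) * l p - (\<Sum>j<n. b x j * v ^ j) - c' m p * v ^ m * Q (0, v))
        + v ^ m * (c' m p * Q (0, v))) \<in> O[at 0](\<lambda>v. v ^ m)"
      by (rule sum_in_bigo)
    have Tay: "(\<lambda>v. Im (deriv K (Complex 0 v)) - (\<Sum>j<m. a j * v ^ j)) \<in> O[at 0](\<lambda>v. v ^ m)"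
      using holomorphic_bigo_Taylor[OF holomorphic_deriv[OF K open_ball] R, of m]
      by (simp only: a_def funpow_Suc_right o_apply)
    have "(\<lambda>v. l p * (Im (deriv K (Complex 0 v)) - (\<Sum>j<m. a j * v ^ j))) \<in> O[at 0](\<lambda>v. v ^ m)"
      by (cases "l p = 0") (simp_all add: Tay)
    from sum_in_bigo(2)[OF 3 this]
    have "(\<lambda>v. v ^ m * - b x m + (\<Sum>j<m. (l p * a j - b x j) * v ^ j)) \<in> O[at 0](\<lambda>v. v ^ m)"
      by (rule bigo_cong_near_zero[OF _ \<rho>(1)])
         (simp add: m algebra_simps sum_subtractf sum_distrib_left)
    from sum_in_bigo(2)[OF this continuous_power_bigo[of "\<lambda>_. - b x m" m]]
    have "(\<lambda>v. \<Sum>j<m. (l p * a j - b x j) * v ^ j) \<in> O[at 0](\<lambda>v. v ^ m)" by simp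
    then have ab: "l p * a j = b x j" if "j < m" for j
      using polynomial_bigo_zero[where b = "\<lambda>j. l p * a j - b x j", OF _ that] by simp
    have "l p = 0"
    proof (rule ccontr)
      assume nz: "l p \<noteq> 0"
      from kern3[OF \<pi>p this] obtain j where j: "2 \<le> j" "j < m" "a j \<noteq> 0"
        by (auto simp: m a_def simp del: funpow.simps)
      then show False using ab[of j] nz by (simp add: b_def)
    qed
    then have "fst x = 0" "fst (snd x) = 0" "snd (snd x) = 0"
      using ab[of 0] ab[of 1] lp n m by (auto simp: b_def)
    then show "x = 0" by (simp add: prod_eq_iff)
  qed
  obtain V W P where V0: "0 \<in> V" and smP: "smooth_on V P" and P00: "P 0 = 0"
    and P: "\<And>x. x \<in> V \<Longrightarrow> P x \<in> G \<and> T (P x) = \<iota> x" and dif: "diffeomorphism V W (\<lambda>x. \<pi> (P x))"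
  proof (rule smooth_slice_of_local_inverse[OF G(1) smT G(2) T0 _ \<iota> \<pi>])
    show "p = 0" if "frechet_derivative T (at 0) p = 0" for p by (rule injT[OF that])
    show "x = 0" if "frechet_derivative T (at 0) p = \<iota> x" "\<pi> p = 0" for p x by (rule trans[OF that])
  qed (rule that)
  have equiv: "legendre_surface K (Complex (fst x) v) = x \<longleftrightarrow> D (\<pi> (P x)) (v - \<mu> (P x))"
    if x: "x \<in> V" and v: "\<bar>v\<bar> < \<rho>" for x v
  proof -
    let ?p = "P x"
    obtain u y z where xyz: "x = (u, y, z)" by (cases x) auto
    have pG: "?p \<in> G" "?p \<in> G1" using P[OF x] G(3) by auto
    have lp: "l ?p = u" and rp: "\<And>j. j < n \<Longrightarrow> r j ?p = b x j"
      using split[of "l ?p" "\<lambda>j. r j ?p" x] P[OF x] by (auto simp: T_def xyz)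
    let ?A = "\<lambda>v. \<Sum>k\<le>n. c k ?p * v ^ k" and ?A' = "\<lambda>v. \<Sum>k\<le>n. c k ?p * (real k * v ^ (k - 1))"
    have f: "Im (K (Complex u v)) = z + y * v + ?A v * Q (?p, v)" if "\<bar>v\<bar> < \<rho>" for v
    proof -
      have "n = Suc (Suc (n - 2))" using n by simp
      then obtain m where m: "n = Suc (Suc m)" ..
      have "(\<Sum>j<n. r j ?p * v ^ j) = (\<Sum>j<n. b x j * v ^ j)"
        by (rule sum.cong) (auto simp: rp)
      also have "\<dots> = z + y * v"
        unfolding m sum.lessThan_Suc_shift by (simp add: b_def xyz)
      finally show ?thesis using eq[OF pG(2), of v] that \<rho>(2) lp by simp
    qed
    let ?DQ = "frechet_derivative Q (at (?p, v))"
    have dQ: "(Q has_derivative ?DQ) (at (?p, v))"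
      by (rule smooth_on_has_derivative[OF Q1]) (use pG v \<rho>(2) in auto)
    have "((\<lambda>v. Q (?p, v)) has_derivative (\<lambda>h. ?DQ (0, h))) (at v)"
      by (rule has_derivative_compose[of "\<lambda>v. (?p, v)" "\<lambda>h. (0, h)"])
         (auto intro!: has_derivative_Pair has_derivative_const has_derivative_ident dQ)
    moreover have "(\<lambda>h. ?DQ (0, h)) = (*) (?DQ (0, 1))"
    proof
      fix h
      have "?DQ (h *\<^sub>R (0, 1)) = h *\<^sub>R ?DQ (0, 1)" by (rule linear_scale[OF has_derivative_linear[OF dQ]])
      then show "?DQ (0, h) = ?DQ (0, 1) * h" by (simp add: mult.commute)
    qed
    ultimately have dQv: "((\<lambda>v. Q (?p, v)) has_real_derivative ?DQ (0, 1)) (at v)"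
      by (simp add: has_field_derivative_def)
    have dA: "(?A has_real_derivative ?A' v) (at v)"
      by (auto intro!: derivative_eq_intros sum.cong simp: field_simps)
    have "((\<lambda>v. z + y * v + ?A v * Q (?p, v)) has_real_derivative (y + (?A' v * Q (?p, v) + ?DQ (0, 1) * ?A v))) (at v)"
      by (rule DERIV_add[OF _ DERIV_mult[OF dA dQv]]) (auto intro!: derivative_eq_intros)
    then have "((\<lambda>v. Im (K (Complex u v))) has_real_derivative (y + (?A' v * Q (?p, v) + ?DQ (0, 1) * ?A v))) (at v)"
      by (rule has_field_derivative_transform_within_open[where S = "{-\<rho><..<\<rho>}"]) (use v in \<open>auto simp: f\<close>)
    moreover have "((\<lambda>v. Im (K (Complex u v))) has_real_derivative Re (deriv K (Complex u v))) (at v)"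
      by (rule holomorphic_Im_vertical_derivative[OF K]) (use bound[OF pG(2), of v] lp v \<rho>(2) in auto)
    ultimately have f': "Re (deriv K (Complex u v)) = y + (?A' v * Q (?p, v) + ?DQ (0, 1) * ?A v)"
      using DERIV_unique by blast
    have Qv: "Q (?p, v) \<noteq> 0" by (rule Qnz[OF pG(1) v])
    have "legendre_surface K (Complex (fst x) v) = x \<longleftrightarrow>
        Re (deriv K (Complex u v)) = y \<and> Im (K (Complex u v)) = z + y * v"
      by (auto simp: legendre_surface_def xyz algebra_simps)
    also have "\<dots> \<longleftrightarrow> ?A v = 0 \<and> ?A' v = 0"
      unfolding f[OF v] f' using Qv by auto
    also have "\<dots> \<longleftrightarrow> D (\<pi> ?p) (v - \<mu> ?p)" by (simp only: D)
    finally show ?thesis .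
  qed
  have oV: "open V" using dif by (simp add: diffeomorphism_def)
  have mc: "continuous_on V (\<lambda>x. \<mu> (P x))"
    by (rule bounded_linear.continuous_on[OF \<mu> smooth_on_continuous[OF smP]])
  have z: "\<pi> (P 0) = 0" "\<mu> (P 0) = 0" using \<pi> \<mu> by (simp_all add: P00 linear_simps)
  show ?thesis
  proof (intro exI[of _ \<rho>] conjI allI impI \<rho>(1))
    fix N :: "complex set" assume N: "open N \<and> 0 \<in> N \<and> N \<subseteq> ball 0 \<rho>"
    show "diffeomorphic_germs (legendre_surface K ` N) 0 {b. \<exists>w. D b w} 0"
      by (rule germ_of_parametrized_discriminant[OF \<rho>(1) V0 dif z(1) mc z(2) _ equiv small])
         (use N in \<open>auto simp: legendre_surface_def\<close>)
  qed
qed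

section \<open>The cuspidal edge and the swallowtail\<close>

abbreviation standard_cuspidal_edge :: "space set" where
  "standard_cuspidal_edge \<equiv> range (\<lambda>(u, v). (u, v^2, v^3))"

abbreviation standard_swallowtail :: "space set" where
  "standard_swallowtail \<equiv> range (\<lambda>(u, v). (3 * v^4 + u * v^2, 4 * v^3 + 2 * u * v, u))"

lemma abs_fst_component_le_norm: "\<bar>fst x\<bar> \<le> norm (x :: real \<times> 'a::real_normed_vector)"
  using norm_fst_le[of "fst x" "snd x"] by simp

lemma abs_snd_component_le_norm:
  fixes x :: space
  shows "\<bar>fst (snd x)\<bar> \<le> norm x" "\<bar>snd (snd x)\<bar> \<le> norm x"
proof -
  have "norm (snd x) \<le> norm x" using norm_snd_le[of "snd x" "fst x"] by simp
  moreover have "\<bar>fst (snd x)\<bar> \<le> norm (snd x)" "\<bar>snd (snd x)\<bar> \<le> norm (snd x)"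
    using norm_fst_le[of "fst (snd x)" "snd (snd x)"] norm_snd_le[of "snd (snd x)" "fst (snd x)"] by simp_all
  ultimately show "\<bar>fst (snd x)\<bar> \<le> norm x" "\<bar>snd (snd x)\<bar> \<le> norm x" by linarith+
qed

text \<open>The divisor is \<open>(v - m)^3 - 3 Y (v - m) + 2 Z\<close> with parameter \<open>p = (u, m, Y, Z)\<close>; the factors are such that
  a double zero at \<open>m + w\<close> means exactly \<open>(Y, Z) = (w^2, w^3)\<close>. Since \<open>u\<close> is one of the coordinates of the
  normal form, the unfolding is versal whatever the \<open>u\<close>-derivatives of \<open>\<phi>\<close> are.\<close>

lemma cuspidal_edge_legendre_surface:
  assumes K: "K holomorphic_on ball 0 R" "0 < R"
    and order: "\<And>j. j < 3 \<Longrightarrow> Im ((deriv ^^ j) K 0 * \<i> ^ j) = 0" "Im ((deriv ^^ 3) K 0 * \<i> ^ 3) \<noteq> 0"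
  shows "legendre_germs K standard_cuspidal_edge"
proof -
  define D :: "space \<Rightarrow> real \<Rightarrow> bool"
    where "D b w \<longleftrightarrow> fst (snd b) = w^2 \<and> snd (snd b) = w^3" for b w
  define l :: "real \<times> real \<times> real \<times> real \<Rightarrow> real" where "l = fst"
  define \<mu> :: "real \<times> real \<times> real \<times> real \<Rightarrow> real" where "\<mu> p = fst (snd p)" for p
  define Y :: "real \<times> real \<times> real \<times> real \<Rightarrow> real" where "Y p = fst (snd (snd p))" for p
  define Z :: "real \<times> real \<times> real \<times> real \<Rightarrow> real" where "Z p = snd (snd (snd p))" for p
  define \<pi> where "\<pi> p = (l p, Y p, Z p)" for p
  define c where "c k p = (if k = 0 then - (\<mu> p ^ 3) + 3 * Y p * \<mu> p + 2 * Z p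
      else if k = 1 then 3 * \<mu> p ^ 2 - 3 * Y p else if k = 2 then - 3 * \<mu> p else if k = 3 then 1 else 0)"
    for k :: nat and p
  define c' where "c' k p = (if k = 0 then 2 * Z p else if k = 1 then - 3 * Y p
      else if k = 2 then - 3 * \<mu> p else 0)" for k :: nat and p
  define e :: "nat \<Rightarrow> real \<times> real \<times> real \<times> real"
    where "e j = (if j = 0 then (0, 0, 0, 1) else if j = 1 then (0, 0, 1, 0) else (0, 1, 0, 0))" for j
  have lin: "bounded_linear l" "bounded_linear \<mu>" "bounded_linear Y" "bounded_linear Z"
    unfolding l_def \<mu>_def[abs_def] Y_def[abs_def] Z_def[abs_def]
    by (intro bounded_linear_fst bounded_linear_snd bounded_linear_compose[OF bounded_linear_fst]
        bounded_linear_compose[OF bounded_linear_snd])+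
  note sm = smooth_on_linear[OF open_UNIV lin(1)] smooth_on_linear[OF open_UNIV lin(2)]
    smooth_on_linear[OF open_UNIV lin(3)] smooth_on_linear[OF open_UNIV lin(4)]
  note hd = bounded_linear_imp_has_derivative[OF lin(1)] bounded_linear_imp_has_derivative[OF lin(2)]
    bounded_linear_imp_has_derivative[OF lin(3)] bounded_linear_imp_has_derivative[OF lin(4)]
  have z: "l 0 = 0" "\<mu> 0 = 0" "Y 0 = 0" "Z 0 = 0" by (auto simp: l_def \<mu>_def Y_def Z_def)
  have eq0: "p = 0 \<longleftrightarrow> l p = 0 \<and> \<mu> p = 0 \<and> Y p = 0 \<and> Z p = 0" for p
    by (auto simp: l_def \<mu>_def Y_def Z_def prod_eq_iff)
  have "legendre_germs K {b. \<exists>w. D b w}"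
  proof (rule discriminant_germ[OF K _ order, of c l \<mu> \<pi> c' "(1, 0, 0, 0)" e])
    show "smooth_on UNIV (c k)" for k
    proof -
      consider "k = 0" | "k = 1" | "k = 2" | "k = 3" | "k > 3" by linarith
      then show ?thesis
        by cases (simp_all add: c_def[abs_def] smooth_intros sm)
    qed
    show "bounded_linear \<pi>" unfolding \<pi>_def[abs_def] by (intro bounded_linear_Pair lin)
    show "c k 0 = (if k = 3 then 1 else 0)" if "k \<le> 3" for k by (auto simp: c_def z)
    show "(c k has_derivative c' k) (at 0)" if k: "k \<le> 3" for k
    proof -
      consider "k = 0" | "k = 1" | "k = 2" | "k = 3" using k by linarith
      then show ?thesis
        by cases (auto simp: c_def[abs_def] c'_def[abs_def] z intro!: derivative_eq_intros hd)
    qed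
    show "a = 0 \<and> (\<forall>j<3. b j = 0)"
      if "a *\<^sub>R (1, 0, 0, 0) + (\<Sum>j<3. b j *\<^sub>R e j) = 0" for a and b :: "nat \<Rightarrow> real"
      using that by (auto simp: e_def numeral_3_eq_3 zero_prod_def less_Suc_eq)
    show "p = 0" if "l p = 0" "\<And>k. k < 3 \<Longrightarrow> c' k p = 0" for p
      using that(1) that(2)[of 0] that(2)[of 1] that(2)[of 2] by (simp add: c'_def eq0)
    show "c' k p = 0" if "\<pi> p = 0" "k < 3 - 1" for p k
      using that by (auto simp: c'_def \<pi>_def zero_prod_def)
    show "\<exists>j. 2 \<le> j \<and> j < 3 - 1 \<and> Im ((deriv ^^ Suc j) K 0 * \<i> ^ j) \<noteq> 0"
      if "\<pi> p = 0" "l p \<noteq> 0" for p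
      using that by (simp add: \<pi>_def zero_prod_def)
    show "D (\<pi> p) (v - \<mu> p) \<longleftrightarrow> (\<Sum>k\<le>3. c k p * v ^ k) = 0 \<and> (\<Sum>k\<le>3. c k p * (real k * v ^ (k - 1))) = 0"
      for p v
    proof -
      let ?w = "v - \<mu> p"
      have 1: "(\<Sum>k\<le>3. c k p * v ^ k) = ?w ^ 3 - 3 * Y p * ?w + 2 * Z p"
        by (simp add: eval_nat_numeral c_def algebra_simps)
      have 2: "(\<Sum>k\<le>3. c k p * (real k * v ^ (k - 1))) = 3 * ?w ^ 2 - 3 * Y p"
        by (simp add: eval_nat_numeral c_def algebra_simps)
      have 3: "?w ^ 3 - 3 * Y p * ?w + 2 * Z p = 2 * (Z p - ?w ^ 3)" if "Y p = ?w ^ 2"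
        unfolding that by (simp add: eval_nat_numeral algebra_simps)
      have "3 * ?w ^ 2 - 3 * Y p = 0 \<longleftrightarrow> Y p = ?w ^ 2" by linarith
      then show ?thesis unfolding 1 2 D_def \<pi>_def fst_conv snd_conv
        using 3 by (metis mult_eq_0_iff right_minus_eq zero_neq_numeral)
    qed
    show "\<exists>\<eta>>0. \<forall>b w. norm b < \<eta> \<longrightarrow> D b w \<longrightarrow> \<bar>w\<bar> < \<epsilon>" if "0 < \<epsilon>" for \<epsilon>
    proof (intro exI[of _ "\<epsilon>^2"] conjI allI impI)
      fix b w assume "norm b < \<epsilon>^2" "D b w"
      moreover have "\<bar>fst (snd b)\<bar> \<le> norm b"
        by (rule abs_snd_component_le_norm(1))
      ultimately have "\<bar>w\<bar>^2 < \<epsilon>^2" by (simp add: D_def)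
      then show "\<bar>w\<bar> < \<epsilon>" by (rule power_less_imp_less_base) (use that in simp)
    qed (use that in simp)
  qed (use lin in \<open>auto simp: c'_def\<close>)
  moreover have "{b. \<exists>w. D b w} = standard_cuspidal_edge"
    by (auto simp: D_def image_def prod_eq_iff)
  ultimately show ?thesis by simp
qed

text \<open>The divisor is \<open>(v - m)^4 + b (v - m)^2 - Y (v - m) + Z\<close> with parameter \<open>p = (u, m, b, Y, Z)\<close>; a double zero at
  \<open>m + w\<close> means \<open>Y = 4 w^3 + 2 b w\<close> and \<open>Z = 3 w^4 + b w^2\<close>. The normal form contains \<open>b\<close> in place of \<open>u\<close>,
  so the unfolding must move the coefficient of \<open>v^2\<close> with \<open>u\<close>, which is the hypothesis \<open>versal\<close>,
  that is, \<open>\<phi>\<^sub>u\<^sub>v\<^sub>v \<noteq> 0\<close>.\<close>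

lemma swallowtail_legendre_surface:
  assumes K: "K holomorphic_on ball 0 R" "0 < R"
    and order: "\<And>j. j < 4 \<Longrightarrow> Im ((deriv ^^ j) K 0 * \<i> ^ j) = 0" "Im ((deriv ^^ 4) K 0 * \<i> ^ 4) \<noteq> 0"
    and versal: "Im ((deriv ^^ 3) K 0 * \<i> ^ 2) \<noteq> 0"
  shows "legendre_germs K standard_swallowtail"
proof -
  define D :: "space \<Rightarrow> real \<Rightarrow> bool"
    where "D x w \<longleftrightarrow> fst x = 3 * w^4 + snd (snd x) * w^2 \<and> fst (snd x) = 4 * w^3 + 2 * snd (snd x) * w" for x w
  define l :: "real \<times> real \<times> real \<times> real \<times> real \<Rightarrow> real" where "l = fst"
  define \<mu> :: "real \<times> real \<times> real \<times> real \<times> real \<Rightarrow> real" where "\<mu> p = fst (snd p)" for p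
  define B :: "real \<times> real \<times> real \<times> real \<times> real \<Rightarrow> real" where "B p = fst (snd (snd p))" for p
  define Y :: "real \<times> real \<times> real \<times> real \<times> real \<Rightarrow> real" where "Y p = fst (snd (snd (snd p)))" for p
  define Z :: "real \<times> real \<times> real \<times> real \<times> real \<Rightarrow> real" where "Z p = snd (snd (snd (snd p)))" for p
  define \<pi> where "\<pi> p = (Z p, Y p, B p)" for p
  define c where "c k p = (if k = 0 then \<mu> p ^ 4 + B p * \<mu> p ^ 2 + Y p * \<mu> p + Z p
      else if k = 1 then - 4 * \<mu> p ^ 3 - 2 * B p * \<mu> p - Y p else if k = 2 then 6 * \<mu> p ^ 2 + B p
      else if k = 3 then - 4 * \<mu> p else if k = 4 then 1 else 0)"
    for k :: nat and p
  define c' where "c' k p = (if k = 0 then Z p else if k = 1 then - Y p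
      else if k = 2 then B p else if k = 3 then - 4 * \<mu> p else 0)" for k :: nat and p
  define e :: "nat \<Rightarrow> real \<times> real \<times> real \<times> real \<times> real"
    where "e j = (if j = 0 then (0, 0, 0, 0, 1) else if j = 1 then (0, 0, 0, 1, 0)
      else if j = 2 then (0, 0, 1, 0, 0) else (0, 1, 0, 0, 0))" for j
  have lin: "bounded_linear l" "bounded_linear \<mu>" "bounded_linear Y" "bounded_linear Z" "bounded_linear B"
    unfolding l_def \<mu>_def[abs_def] Y_def[abs_def] Z_def[abs_def] B_def[abs_def]
    by (intro bounded_linear_fst bounded_linear_snd bounded_linear_compose[OF bounded_linear_fst]
        bounded_linear_compose[OF bounded_linear_snd])+
  note sm = smooth_on_linear[OF open_UNIV lin(1)] smooth_on_linear[OF open_UNIV lin(2)]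
    smooth_on_linear[OF open_UNIV lin(3)] smooth_on_linear[OF open_UNIV lin(4)] smooth_on_linear[OF open_UNIV lin(5)]
  note hd = bounded_linear_imp_has_derivative[OF lin(1)] bounded_linear_imp_has_derivative[OF lin(2)]
    bounded_linear_imp_has_derivative[OF lin(3)] bounded_linear_imp_has_derivative[OF lin(4)]
    bounded_linear_imp_has_derivative[OF lin(5)]
  have z: "l 0 = 0" "\<mu> 0 = 0" "Y 0 = 0" "Z 0 = 0" "B 0 = 0" by (auto simp: l_def \<mu>_def Y_def Z_def B_def)
  have eq0: "p = 0 \<longleftrightarrow> l p = 0 \<and> \<mu> p = 0 \<and> Y p = 0 \<and> Z p = 0 \<and> B p = 0" for p
    by (auto simp: l_def \<mu>_def Y_def Z_def B_def prod_eq_iff)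
  have "legendre_germs K {b. \<exists>w. D b w}"
  proof (rule discriminant_germ[OF K _ order, of c l \<mu> \<pi> c' "(1, 0, 0, 0, 0)" e])
    show "smooth_on UNIV (c k)" for k
    proof -
      consider "k = 0" | "k = 1" | "k = 2" | "k = 3" | "k = 4" | "k > 4" by linarith
      then show ?thesis
        by cases (simp_all add: c_def[abs_def] smooth_intros sm)
    qed
    show "bounded_linear \<pi>" unfolding \<pi>_def[abs_def] by (intro bounded_linear_Pair lin)
    show "c k 0 = (if k = 4 then 1 else 0)" if "k \<le> 4" for k by (auto simp: c_def z)
    show "(c k has_derivative c' k) (at 0)" if k: "k \<le> 4" for k
    proof -
      consider "k = 0" | "k = 1" | "k = 2" | "k = 3" | "k = 4" using k by linarith
      then show ?thesis
        by cases (auto simp: c_def[abs_def] c'_def[abs_def] z intro!: derivative_eq_intros hd)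
    qed
    show "a = 0 \<and> (\<forall>j<4. b j = 0)"
      if "a *\<^sub>R (1, 0, 0, 0, 0) + (\<Sum>j<4. b j *\<^sub>R e j) = 0" for a and b :: "nat \<Rightarrow> real"
      using that by (auto simp: e_def eval_nat_numeral zero_prod_def less_Suc_eq)
    show "p = 0" if "l p = 0" "\<And>k. k < 4 \<Longrightarrow> c' k p = 0" for p
      using that(1) that(2)[of 0] that(2)[of 1] that(2)[of 2] that(2)[of 3] by (simp add: c'_def eq0)
    show "c' k p = 0" if "\<pi> p = 0" "k < 4 - 1" for p k
      using that by (auto simp: c'_def \<pi>_def zero_prod_def)
    show "\<exists>j. 2 \<le> j \<and> j < 4 - 1 \<and> Im ((deriv ^^ Suc j) K 0 * \<i> ^ j) \<noteq> 0"
      if "\<pi> p = 0" "l p \<noteq> 0" for p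
      using versal by (intro exI[of _ 2]) (simp add: eval_nat_numeral)
    show "D (\<pi> p) (v - \<mu> p) \<longleftrightarrow> (\<Sum>k\<le>4. c k p * v ^ k) = 0 \<and> (\<Sum>k\<le>4. c k p * (real k * v ^ (k - 1))) = 0"
      for p v
    proof -
      let ?w = "v - \<mu> p"
      have 1: "(\<Sum>k\<le>4. c k p * v ^ k) = ?w ^ 4 + B p * ?w ^ 2 - Y p * ?w + Z p"
        by (simp add: eval_nat_numeral c_def algebra_simps)
      have 2: "(\<Sum>k\<le>4. c k p * (real k * v ^ (k - 1))) = 4 * ?w ^ 3 + 2 * B p * ?w - Y p"
        by (simp add: eval_nat_numeral c_def algebra_simps)
      have 3: "?w ^ 4 + B p * ?w ^ 2 - Y p * ?w + Z p = Z p - (3 * ?w ^ 4 + B p * ?w ^ 2)"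
        if "Y p = 4 * ?w ^ 3 + 2 * B p * ?w"
        unfolding that by (simp add: eval_nat_numeral algebra_simps)
      have "4 * ?w ^ 3 + 2 * B p * ?w - Y p = 0 \<longleftrightarrow> Y p = 4 * ?w ^ 3 + 2 * B p * ?w" by linarith
      then show ?thesis unfolding 1 2 D_def \<pi>_def fst_conv snd_conv
        using 3 by (metis right_minus_eq)
    qed
    show "\<exists>\<eta>>0. \<forall>b w. norm b < \<eta> \<longrightarrow> D b w \<longrightarrow> \<bar>w\<bar> < \<epsilon>" if "0 < \<epsilon>" for \<epsilon>
    proof (intro exI[of _ "min (2 * \<epsilon>^2) (\<epsilon>^4)"] conjI allI impI)
      fix x :: space and w assume x: "norm x < min (2 * \<epsilon>^2) (\<epsilon>^4)" "D x w"
      have "\<bar>fst x\<bar> \<le> norm x" "\<bar>snd (snd x)\<bar> \<le> norm x"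
        by (rule abs_fst_component_le_norm abs_snd_component_le_norm)+
      with x(1) have b: "\<bar>fst x\<bar> < \<epsilon>^4" "\<bar>snd (snd x)\<bar> < 2 * \<epsilon>^2" by auto
      show "\<bar>w\<bar> < \<epsilon>"
      proof (rule ccontr)
        assume "\<not> \<bar>w\<bar> < \<epsilon>"
        then have w: "\<epsilon>^2 \<le> w^2" using that by (metis abs_le_square_iff abs_of_pos not_less)
        have "\<epsilon>^2 * \<epsilon>^2 \<le> w^2 * (3 * w^2 + snd (snd x))"
          using w b that by (intro mult_mono) auto
        also have "\<dots> = fst x" using x(2) by (simp add: D_def algebra_simps eval_nat_numeral)
        finally show False using b(1) by (simp add: eval_nat_numeral algebra_simps)
      qed
    qed (use that in simp)
  qed (use lin in \<open>auto simp: c'_def\<close>)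
  moreover have "{b. \<exists>w. D b w} = standard_swallowtail"
    by (auto simp: D_def image_def prod_eq_iff)
  ultimately show ?thesis by simp
qed

section \<open>Normal form of the improper affine map\<close>

lemma diffeomorphic_germs_affine:
  fixes \<Lambda> \<Lambda>' :: "space \<Rightarrow> space"
  assumes lin: "bounded_linear \<Lambda>" "bounded_linear \<Lambda>'"
    and inv: "\<And>x. \<Lambda>' (\<Lambda> x) = x" "\<And>x. \<Lambda> (\<Lambda>' x) = x"
    and g: "diffeomorphic_germs ((\<lambda>x. \<Lambda> x + k) ` M) (\<Lambda> x0 + k) N r"
  shows "diffeomorphic_germs M x0 N r"
proof -
  obtain V W \<Phi> where d: "diffeomorphism V W \<Phi>" and 0: "\<Lambda> x0 + k \<in> V" "\<Phi> (\<Lambda> x0 + k) = r"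
    and im: "\<Phi> ` ((\<lambda>x. \<Lambda> x + k) ` M \<inter> V) = N \<inter> W"
    using g unfolding diffeomorphic_germs_def by blast
  have oV: "open V" "open W" and bij: "bij_betw \<Phi> V W"
    and sm: "smooth_on V \<Phi>" "smooth_on W (inv_into V \<Phi>)"
    using d by (auto simp: diffeomorphism_def)
  define A where "A x = \<Lambda> x + k" for x
  define A' where "A' y = \<Lambda>' (y - k)" for y
  have AA: "A' (A x) = x" "A (A' x) = x" for x by (auto simp: A_def A'_def inv)
  define V1 where "V1 = A -` V"
  have "continuous_on UNIV A" unfolding A_def[abs_def]
    by (intro linear_continuous_on[OF lin(1)] continuous_intros)
  then have oV1: "open V1" unfolding V1_def using oV(1) open_vimage by blast
  have AV: "A ` V1 = V" unfolding V1_def using AA by (metis surjI surj_image_vimage_eq)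
  have smA: "smooth_on V1 A" unfolding A_def[abs_def]
    by (intro smooth_on_linear[OF _ lin(1)] smooth_intros oV1)
  have smA': "smooth_on V A'" unfolding A'_def[abs_def]
    by (intro smooth_on_linear_comp[OF _ lin(2)] smooth_intros oV)
  have bijA: "bij_betw A V1 V" unfolding bij_betw_def using AV AA by (metis inj_on_inverseI)
  have bij1: "bij_betw (\<lambda>x. \<Phi> (A x)) V1 W"
    using bij_betw_trans[OF bijA bij] by (simp add: o_def)
  have "smooth_on W (inv_into V1 (\<lambda>x. \<Phi> (A x)))"
  proof (rule smooth_on_cong[OF oV(2)])
    show "smooth_on W (\<lambda>y. A' (inv_into V \<Phi> y))"
      by (rule smooth_on_compose[OF oV(2) smA' sm(2)])
         (use bij in \<open>auto simp: bij_betw_def inv_into_into\<close>)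
    fix y assume "y \<in> W"
    then have i: "inv_into V \<Phi> y \<in> V" "\<Phi> (inv_into V \<Phi> y) = y"
      using bij by (auto simp: bij_betw_def inv_into_into f_inv_into_f)
    then have "A' (inv_into V \<Phi> y) \<in> V1" by (simp add: V1_def AA)
    moreover have "\<Phi> (A (A' (inv_into V \<Phi> y))) = y" using i by (simp add: AA)
    ultimately show "A' (inv_into V \<Phi> y) = inv_into V1 (\<lambda>x. \<Phi> (A x)) y"
      using inv_into_f_f[of "\<lambda>x. \<Phi> (A x)" V1 "A' (inv_into V \<Phi> y)"] bij1
      by (simp add: bij_betw_def)
  qed
  moreover have "smooth_on V1 (\<lambda>x. \<Phi> (A x))"
    by (rule smooth_on_compose[OF oV1 sm(1) smA]) (simp add: AV)
  ultimately have "diffeomorphism V1 W (\<lambda>x. \<Phi> (A x))"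
    using oV1 oV(2) bij1 by (simp add: diffeomorphism_def)
  moreover have "x0 \<in> V1" "\<Phi> (A x0) = r"
    using 0 by (auto simp: V1_def A_def)
  moreover have "(\<lambda>x. \<Phi> (A x)) ` (M \<inter> V1) = N \<inter> W"
  proof -
    have "A ` (M \<inter> V1) = A ` M \<inter> V" by (auto simp: V1_def)
    moreover have "(\<lambda>x. \<Phi> (A x)) ` (M \<inter> V1) = \<Phi> ` (A ` (M \<inter> V1))" by (simp add: image_image)
    ultimately show ?thesis using im[folded A_def] by simp
  qed
  ultimately show ?thesis unfolding diffeomorphic_germs_def by blast
qed

lemma complex_partial_derivatives:
  assumes "(F has_field_derivative D) (at (Complex s t))"
  shows "((\<lambda>s. Re (F (Complex s t))) has_real_derivative Re D) (at s)"
    "((\<lambda>s. Im (F (Complex s t))) has_real_derivative Im D) (at s)"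
    "((\<lambda>t. Re (F (Complex s t))) has_real_derivative - Im D) (at t)"
    "((\<lambda>t. Im (F (Complex s t))) has_real_derivative Re D) (at t)"
proof -
  note F = assms[unfolded has_field_derivative_def]
  have "((\<lambda>s. Complex s t) has_derivative of_real) (at s)"
    unfolding Complex_eq by (auto intro!: derivative_eq_intros)
  from has_derivative_compose[OF this F]
  have s: "((\<lambda>s. F (Complex s t)) has_derivative (\<lambda>h. D * of_real h)) (at s)" .
  have "((\<lambda>t. Complex s t) has_derivative (\<lambda>h. \<i> * of_real h)) (at t)"
    unfolding Complex_eq by (auto intro!: derivative_eq_intros)
  from has_derivative_compose[OF this F]
  have t: "((\<lambda>t. F (Complex s t)) has_derivative (\<lambda>h. D * (\<i> * of_real h))) (at t)" .
  have m: "(*) (- Im D) = (\<lambda>x. - (Im D * x))" by (simp add: fun_eq_iff)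
  from bounded_linear.has_derivative[OF bounded_linear_Re s] bounded_linear.has_derivative[OF bounded_linear_Im s]
    bounded_linear.has_derivative[OF bounded_linear_Re t] bounded_linear.has_derivative[OF bounded_linear_Im t]
  show "((\<lambda>s. Re (F (Complex s t))) has_real_derivative Re D) (at s)"
    "((\<lambda>s. Im (F (Complex s t))) has_real_derivative Im D) (at s)"
    "((\<lambda>t. Re (F (Complex s t))) has_real_derivative - Im D) (at t)"
    "((\<lambda>t. Im (F (Complex s t))) has_real_derivative Re D) (at t)"
    by (simp_all add: has_field_derivative_def m)
qed

text \<open>The differential of \<open>g\<close> is known only through its two partial derivatives, so the usual criterion for
  constancy is applied along a horizontal and a vertical segment.\<close>

lemma zero_partial_derivatives_constant:
  fixes f :: "complex \<Rightarrow> real"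
  assumes s: "\<And>s t. Complex s t \<in> ball p r \<Longrightarrow> ((\<lambda>s. f (Complex s t)) has_real_derivative 0) (at s)"
    and t: "\<And>s t. Complex s t \<in> ball p r \<Longrightarrow> ((\<lambda>t. f (Complex s t)) has_real_derivative 0) (at t)"
    and z: "z \<in> ball p r"
  shows "f z = f p"
proof -
  have near: "Complex a b \<in> ball p r" if "\<bar>a - Re p\<bar> \<le> \<bar>Re z - Re p\<bar>" "\<bar>b - Im p\<bar> \<le> \<bar>Im z - Im p\<bar>" for a b
  proof -
    have "(a - Re p)^2 + (b - Im p)^2 \<le> (Re z - Re p)^2 + (Im z - Im p)^2"
      using that by (intro add_mono) (simp_all add: abs_le_square_iff)
    then have "cmod (Complex a b - p) \<le> cmod (z - p)"
      by (simp add: cmod_def)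
    then show ?thesis using z by (simp add: dist_norm norm_minus_commute)
  qed
  have seg: "\<bar>x - b\<bar> \<le> \<bar>a - b\<bar>" if "x \<in> closed_segment a b" for x a b :: real
    using that by (auto simp: closed_segment_eq_real_ivl split: if_splits)
  have "\<exists>c. \<forall>x\<in>closed_segment (Im z) (Im p). f (Complex (Re z) x) = c"
  proof (rule has_field_derivative_zero_constant)
    show "((\<lambda>x. f (Complex (Re z) x)) has_field_derivative 0) (at x within closed_segment (Im z) (Im p))"
      if "x \<in> closed_segment (Im z) (Im p)" for x
      by (rule has_field_derivative_at_within[OF t[OF near]]) (use seg[OF that] in auto)
  qed simp
  then have 1: "f (Complex (Re z) (Im z)) = f (Complex (Re z) (Im p))"
    by (metis ends_in_segment)
  have "\<exists>c. \<forall>x\<in>closed_segment (Re z) (Re p). f (Complex x (Im p)) = c"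
  proof (rule has_field_derivative_zero_constant)
    show "((\<lambda>x. f (Complex x (Im p))) has_field_derivative 0) (at x within closed_segment (Re z) (Re p))"
      if "x \<in> closed_segment (Re z) (Re p)" for x
      by (rule has_field_derivative_at_within[OF s[OF near]]) (use seg[OF that] in auto)
  qed simp
  then have 2: "f (Complex (Re z) (Im p)) = f (Complex (Re p) (Im p))"
    by (metis ends_in_segment)
  from 1 2 show ?thesis by simp
qed

text \<open>\<open>K\<close> is a primitive of \<open>G - Re (G p)\<close> in the coordinate \<open>\<omega> = F z - F p\<close>. The third components have the same
  differential because \<open>d Im K = Im (G - Re (G p)) du + Re (G - Re (G p)) dv\<close>, and \<open>v\<close> differs from \<open>Im F\<close> by
  \<open>Im (F p)\<close>, which accounts for the shear on the right-hand side.\<close>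

lemma legendre_normal_form:
  fixes F G :: "complex \<Rightarrow> complex" and \<gamma> :: "complex \<Rightarrow> real"
  assumes S: "open S" "p \<in> S" and F: "F holomorphic_on S" and G: "G holomorphic_on S"
    and F': "deriv F p \<noteq> 0"
    and \<gamma>s: "\<And>s t. Complex s t \<in> S \<Longrightarrow> ((\<lambda>s. \<gamma> (Complex s t)) has_real_derivative
        Im (G (Complex s t)) * Re (deriv F (Complex s t)) - Im (F (Complex s t)) * Re (deriv G (Complex s t))) (at s)"
    and \<gamma>t: "\<And>s t. Complex s t \<in> S \<Longrightarrow> ((\<lambda>t. \<gamma> (Complex s t)) has_real_derivative
        Im (F (Complex s t)) * Im (deriv G (Complex s t)) - Im (G (Complex s t)) * Im (deriv F (Complex s t))) (at t)"
  obtains K R S0 where "0 < R" "K holomorphic_on ball 0 R" "K 0 = 0" "open S0" "p \<in> S0" "S0 \<subseteq> S" "inj_on F S0"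
    "\<And>z. z \<in> S0 \<Longrightarrow> F z - F p \<in> ball 0 R"
    "\<And>z. z \<in> S0 \<Longrightarrow> deriv K (F z - F p) = G z - of_real (Re (G p))"
    "\<And>z. z \<in> S0 \<Longrightarrow> legendre_surface K (F z - F p) =
        (Re (F z) - Re (F p), Re (G z) - Re (G p), (\<gamma> z - \<gamma> p) + Im (F p) * (Re (G z) - Re (G p)))"
proof -
  obtain r1 where r1: "r1 > 0" "ball p r1 \<subseteq> S" "inj_on F (ball p r1)"
    using has_complex_derivative_locally_injective[OF F S(2,1) F'] by blast
  have F1: "F holomorphic_on ball p r1" by (rule holomorphic_on_subset[OF F r1(2)])
  obtain k where k: "k holomorphic_on F ` ball p r1" "\<And>z. z \<in> ball p r1 \<Longrightarrow> k (F z) = z"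
    using holomorphic_has_inverse[OF F1 open_ball r1(3)] by metis
  have "open (F ` ball p r1)" by (rule open_mapping_thm3[OF F1 open_ball r1(3)])
  moreover have "F p \<in> F ` ball p r1" using r1 by auto
  ultimately obtain R where R: "R > 0" "ball (F p) R \<subseteq> F ` ball p r1" using openE by blast
  define H where "H \<omega> = G (k (F p + \<omega>)) - of_real (Re (G p))" for \<omega>
  have sub: "(\<lambda>\<omega>. F p + \<omega>) ` ball 0 R \<subseteq> ball (F p) R" by (auto simp: dist_norm)
  have kS: "k y \<in> S" if "y \<in> ball (F p) R" for y
    using that R(2) k(2) r1(2) by (metis (no_types, lifting) imageE subsetD)
  have "(\<lambda>\<omega>. F p + \<omega>) holomorphic_on ball 0 R" by (intro holomorphic_intros)
  from holomorphic_on_compose_gen[OF this k(1) order_trans[OF sub R(2)]]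
  have kh: "(\<lambda>\<omega>. k (F p + \<omega>)) holomorphic_on ball 0 R" by (simp add: o_def)
  have "(\<lambda>\<omega>. k (F p + \<omega>)) ` ball 0 R \<subseteq> S" using sub kS by blast
  from holomorphic_on_compose_gen[OF kh G this]
  have "(\<lambda>\<omega>. G (k (F p + \<omega>))) holomorphic_on ball 0 R" by (simp add: o_def)
  then have "H holomorphic_on ball 0 R" unfolding H_def by (intro holomorphic_intros)
  then obtain K0 where K0: "\<And>\<omega>. \<omega> \<in> ball 0 R \<Longrightarrow> (K0 has_field_derivative H \<omega>) (at \<omega> within ball 0 R)"
    using holomorphic_convex_primitive'[OF convex_ball open_ball] by blast
  define K where "K \<omega> = K0 \<omega> - K0 0" for \<omega>
  have K': "(K has_field_derivative H \<omega>) (at \<omega>)" if "\<omega> \<in> ball 0 R" for \<omega>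
    using K0[OF that] at_within_open[OF that open_ball] unfolding K_def
    by (auto intro!: derivative_eq_intros)
  have dK: "deriv K \<omega> = H \<omega>" if "\<omega> \<in> ball 0 R" for \<omega> by (rule DERIV_imp_deriv[OF K'[OF that]])
  have Kh: "K holomorphic_on ball 0 R"
    using K' holomorphic_on_open[OF open_ball] by blast
  have "open (ball p r1 \<inter> F -` ball (F p) R)"
    by (rule continuous_open_preimage[OF holomorphic_on_imp_continuous_on[OF F1] open_ball open_ball])
  moreover have "p \<in> ball p r1 \<inter> F -` ball (F p) R" using r1 R by simp
  ultimately obtain r where r: "r > 0" "ball p r \<subseteq> ball p r1 \<inter> F -` ball (F p) R" using openE by blast
  have in_R: "F z - F p \<in> ball 0 R" if "z \<in> ball p r" for z
    using r(2) that by (force simp: dist_norm norm_minus_commute)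
  have HG: "H (F z - F p) = G z - of_real (Re (G p))" if "z \<in> ball p r" for z
    using r(2) that k(2)[of z] by (auto simp: H_def)
  \<comment> \<open>The difference of the third components of the two maps, up to a constant.\<close>
  define f where "f z = \<gamma> z + Im (F p) * Re (G z) -
      (Im (K (F z - F p)) - (Im (F z) - Im (F p)) * (Re (G z) - Re (G p)))" for z
  have ballS: "z \<in> S" if "z \<in> ball p r" for z using that r(2) r1(2) by blast
  have dF: "(F has_field_derivative deriv F z) (at z)" and dG: "(G has_field_derivative deriv G z) (at z)"
    if "z \<in> ball p r" for z
    using holomorphic_derivI[OF F S(1)] holomorphic_derivI[OF G S(1)] ballS[OF that] by auto
  have dKF: "((\<lambda>z. K (F z - F p)) has_field_derivative (G z - of_real (Re (G p))) * deriv F z) (at z)"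
    if "z \<in> ball p r" for z
  proof -
    have "((\<lambda>z. F z - F p) has_field_derivative deriv F z) (at z)"
      using dF[OF that] by (auto intro!: derivative_eq_intros)
    from DERIV_chain2[OF K'[OF in_R[OF that]] this] show ?thesis by (simp add: HG[OF that])
  qed
  have fconst: "f z = f p" if "z \<in> ball p r" for z
  proof (rule zero_partial_derivatives_constant[OF _ _ that])
    fix s t assume st: "Complex s t \<in> ball p r"
    note d = complex_partial_derivatives[OF dF[OF st]] complex_partial_derivatives[OF dG[OF st]]
      complex_partial_derivatives[OF dKF[OF st]]
    show "((\<lambda>s. f (Complex s t)) has_real_derivative 0) (at s)"
      unfolding f_def
      by (rule derivative_eq_intros d \<gamma>s[OF ballS[OF st]] refl)+ (simp add: algebra_simps)
    show "((\<lambda>t. f (Complex s t)) has_real_derivative 0) (at t)"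
      unfolding f_def
      by (rule derivative_eq_intros d \<gamma>t[OF ballS[OF st]] refl)+ (simp add: algebra_simps)
  qed
  show ?thesis
  proof (rule that[of R K "ball p r"])
    show "inj_on F (ball p r)" by (rule inj_on_subset[OF r1(3)]) (use r(2) in auto)
    show "ball p r \<subseteq> S" using ballS by blast
    show "legendre_surface K (F z - F p) =
        (Re (F z) - Re (F p), Re (G z) - Re (G p), (\<gamma> z - \<gamma> p) + Im (F p) * (Re (G z) - Re (G p)))"
      if "z \<in> ball p r" for z
      using fconst[OF that] unfolding legendre_surface_def dK[OF in_R[OF that]] HG[OF that]
      by (simp add: f_def K_def algebra_simps)
  qed (use R Kh r in_R HG dK in \<open>auto simp: K_def\<close>)
qed

section \<open>Derivatives along the conormal curve\<close>

lemma holomorphic_along_curve: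
  assumes "f holomorphic_on S" "open S" "w \<sigma> \<in> S" "(w has_vector_derivative w') (at \<sigma>)"
  shows "((\<lambda>\<sigma>. Re (f (w \<sigma>))) has_real_derivative Re (deriv f (w \<sigma>) * w')) (at \<sigma>)"
    "((\<lambda>\<sigma>. Im (f (w \<sigma>))) has_real_derivative Im (deriv f (w \<sigma>) * w')) (at \<sigma>)"
    "((\<lambda>\<sigma>. f (w \<sigma>)) has_vector_derivative deriv f (w \<sigma>) * w') (at \<sigma>)"
proof -
  have "((f \<circ> w) has_vector_derivative w' * deriv f (w \<sigma>)) (at \<sigma>)"
    by (rule field_vector_diff_chain_at[OF assms(4) holomorphic_derivI[OF assms(1-3)]])
  then show 1: "((\<lambda>\<sigma>. f (w \<sigma>)) has_vector_derivative deriv f (w \<sigma>) * w') (at \<sigma>)"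
    by (simp add: o_def mult.commute)
  show "((\<lambda>\<sigma>. Re (f (w \<sigma>))) has_real_derivative Re (deriv f (w \<sigma>) * w')) (at \<sigma>)"
    "((\<lambda>\<sigma>. Im (f (w \<sigma>))) has_real_derivative Im (deriv f (w \<sigma>) * w')) (at \<sigma>)"
    using bounded_linear.has_vector_derivative[OF bounded_linear_Re 1]
      bounded_linear.has_vector_derivative[OF bounded_linear_Im 1]
    by (simp_all add: has_real_derivative_iff_has_vector_derivative)
qed

text \<open>\<open>w\<close> is the curve \<open>[x - X, c] = 0\<close> in the coordinate \<open>\<omega>\<close>, \<open>v0 = Im (F p)\<close>, and \<open>h = M Im K''\<close> is \<open>\<delta>\<close> along it.
  Differentiating the equation of the curve once at \<open>w = 0\<close>, where \<open>K''\<close> is real, gives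
  \<open>Re w' (Im K' - v0 K'') = 0\<close>, so \<open>w'\<close> is vertical and \<open>h' = M Im w' Re K'''\<close>. If \<open>Re K''' = 0\<close>, a second
  differentiation gives \<open>Re w'' = 0\<close> in the same way, and \<open>h'' = - M (Im w')^2 Im K''''\<close>.\<close>

lemma caustic_jets_along_curve:
  fixes w w' :: "real \<Rightarrow> complex" and w2 :: complex and h M M' :: "real \<Rightarrow> real" and M2 v0 s :: real
  assumes K: "K holomorphic_on ball 0 R" and R: "0 < R"
    and w: "\<forall>\<^sub>F \<sigma> in nhds s. (w has_vector_derivative w' \<sigma>) (at \<sigma>)"
    and w': "(w' has_vector_derivative w2) (at s)" and ws: "w s = 0"
    and M: "\<forall>\<^sub>F \<sigma> in nhds s. (M has_real_derivative M' \<sigma>) (at \<sigma>)"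
    and M': "(M' has_real_derivative M2) (at s)"
    and K0: "Re (deriv K 0) = 0" "Im ((deriv ^^ 2) K 0) = 0"
    and conormal: "\<forall>\<^sub>F \<sigma> in nhds s. Re (w \<sigma>) * Im (deriv K (w \<sigma>)) = Re (deriv K (w \<sigma>)) * (Im (w \<sigma>) + v0)"
    and transversal: "Im (deriv K 0) - v0 * Re ((deriv ^^ 2) K 0) \<noteq> 0"
    and h: "\<forall>\<^sub>F \<sigma> in nhds s. h \<sigma> = M \<sigma> * Im ((deriv ^^ 2) K (w \<sigma>))"
  shows "deriv h s \<noteq> 0 \<Longrightarrow> Re ((deriv ^^ 3) K 0) \<noteq> 0"
    and "deriv h s = 0 \<Longrightarrow> deriv (deriv h) s \<noteq> 0 \<Longrightarrow> w' s \<noteq> 0 \<Longrightarrow> M s \<noteq> 0 \<Longrightarrow>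
      Re ((deriv ^^ 3) K 0) = 0 \<and> Im ((deriv ^^ 4) K 0) \<noteq> 0"
proof -
  let ?D = "\<lambda>n. (deriv ^^ n) K"
  have hol: "?D n holomorphic_on ball 0 R" for n by (rule holomorphic_higher_deriv[OF K open_ball])
  have dD: "deriv (?D n) = ?D (Suc n)" for n by simp
  have num: "Suc 0 = 1" "Suc 1 = 2" "Suc 2 = 3" "Suc 3 = (4::nat)" by simp_all
  have wd_s: "(w has_vector_derivative w' s) (at s)" using w by (rule eventually_nhds_x_imp_x)
  have "isCont w s" by (rule has_vector_derivative_continuous[OF wd_s])
  then have "\<forall>\<^sub>F \<sigma> in at s. w \<sigma> \<in> ball 0 R"
    unfolding isCont_def using topological_tendstoD[of w "w s" "at s" "ball 0 R"] R ws by simp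
  then have inb: "\<forall>\<^sub>F \<sigma> in nhds s. w \<sigma> \<in> ball 0 R"
    unfolding eventually_nhds_conv_at using ws R by simp
  note chain = holomorphic_along_curve[OF hol open_ball, of w, unfolded dD]
  have ws_in: "w s \<in> ball 0 R" using ws R by simp
  have nhds_nhds: "\<forall>\<^sub>F \<sigma> in nhds s. \<forall>\<^sub>F y in nhds \<sigma>. P y" if "\<forall>\<^sub>F \<sigma> in nhds s. P \<sigma>" for P
    using that by (simp add: eventually_eventually)
  have wRI: "((\<lambda>\<sigma>. Re (w \<sigma>)) has_real_derivative Re (w' \<sigma>)) (at \<sigma>)"
      "((\<lambda>\<sigma>. Im (w \<sigma>)) has_real_derivative Im (w' \<sigma>)) (at \<sigma>)"
    if "(w has_vector_derivative w' \<sigma>) (at \<sigma>)" for \<sigma>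
    using bounded_linear.has_vector_derivative[OF bounded_linear_Re that]
      bounded_linear.has_vector_derivative[OF bounded_linear_Im that]
    by (simp_all add: has_real_derivative_iff_has_vector_derivative)
  have w'RI: "((\<lambda>\<sigma>. Re (w' \<sigma>)) has_real_derivative Re w2) (at s)"
      "((\<lambda>\<sigma>. Im (w' \<sigma>)) has_real_derivative Im w2) (at s)"
    using bounded_linear.has_vector_derivative[OF bounded_linear_Re w']
      bounded_linear.has_vector_derivative[OF bounded_linear_Im w']
    by (simp_all add: has_real_derivative_iff_has_vector_derivative)
  define E where "E \<sigma> = Re (w \<sigma>) * Im (?D 1 (w \<sigma>)) - Re (?D 1 (w \<sigma>)) * (Im (w \<sigma>) + v0)" for \<sigma>
  define E' where "E' \<sigma> = Re (w' \<sigma>) * Im (?D 1 (w \<sigma>)) + Re (w \<sigma>) * Im (?D 2 (w \<sigma>) * w' \<sigma>)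
      - (Re (?D 2 (w \<sigma>) * w' \<sigma>) * (Im (w \<sigma>) + v0) + Re (?D 1 (w \<sigma>)) * Im (w' \<sigma>))" for \<sigma>
  have E0: "\<forall>\<^sub>F \<sigma> in nhds s. E \<sigma> = 0"
    using conormal by eventually_elim (simp add: E_def)
  have E'0: "\<forall>\<^sub>F \<sigma> in nhds s. E' \<sigma> = 0"
    using nhds_nhds[OF E0] w inb
  proof eventually_elim
    case (elim \<sigma>)
    have "(E has_real_derivative E' \<sigma>) (at \<sigma>)"
      unfolding E_def[abs_def] E'_def
      by (rule derivative_eq_intros wRI[OF elim(2)] chain(1,2)[OF elim(3,2), of 1, unfolded num] refl)+
         (simp add: algebra_simps)
    moreover have "((\<lambda>_. 0) has_real_derivative E' \<sigma>) (at \<sigma>) \<longleftrightarrow> (E has_real_derivative E' \<sigma>) (at \<sigma>)"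
      by (rule DERIV_cong_ev) (use elim(1) in \<open>auto elim: eventually_mono\<close>)
    ultimately show ?case using DERIV_unique[OF _ DERIV_const] by blast
  qed
  have U': "Re (w' s) = 0"
  proof -
    have "E' s = 0" using E'0 by (rule eventually_nhds_x_imp_x)
    then have "Re (w' s) * (Im (deriv K 0) - v0 * Re (?D 2 0)) = 0"
      using K0 by (simp add: E'_def ws algebra_simps)
    then show ?thesis using transversal by simp
  qed
  define k' where "k' \<sigma> = Im (?D 3 (w \<sigma>) * w' \<sigma>)" for \<sigma>
  have kd: "((\<lambda>\<sigma>. Im (?D 2 (w \<sigma>))) has_real_derivative k' \<sigma>) (at \<sigma>)"
    if "(w has_vector_derivative w' \<sigma>) (at \<sigma>)" "w \<sigma> \<in> ball 0 R" for \<sigma>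
    using chain(2)[OF that(2,1), of 2] by (simp add: k'_def num del: funpow.simps)
  have hd: "\<forall>\<^sub>F \<sigma> in nhds s. deriv h \<sigma> = M' \<sigma> * Im (?D 2 (w \<sigma>)) + M \<sigma> * k' \<sigma>"
    using nhds_nhds[OF h] w inb M
  proof eventually_elim
    case (elim \<sigma>)
    have "((\<lambda>\<sigma>. M \<sigma> * Im (?D 2 (w \<sigma>))) has_real_derivative M' \<sigma> * Im (?D 2 (w \<sigma>)) + k' \<sigma> * M \<sigma>) (at \<sigma>)"
      by (rule DERIV_mult[OF elim(4) kd[OF elim(2,3)]])
    moreover have "(h has_real_derivative d) (at \<sigma>) \<longleftrightarrow> ((\<lambda>\<sigma>. M \<sigma> * Im (?D 2 (w \<sigma>))) has_real_derivative d) (at \<sigma>)" for d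
      by (rule DERIV_cong_ev) (use elim(1) in auto)
    ultimately have "(h has_real_derivative M' \<sigma> * Im (?D 2 (w \<sigma>)) + k' \<sigma> * M \<sigma>) (at \<sigma>)" by blast
    then show ?case using DERIV_imp_deriv by (simp add: DERIV_imp_deriv mult.commute)
  qed
  have k's: "k' s = Re (?D 3 0) * Im (w' s)" using U' by (simp add: k'_def ws)
  have hs: "deriv h s = M s * (Re (?D 3 0) * Im (w' s))"
    using eventually_nhds_x_imp_x[OF hd] K0(2) k's by (simp add: ws)
  show "deriv h s \<noteq> 0 \<Longrightarrow> Re ((deriv ^^ 3) K 0) \<noteq> 0" using hs by auto
  assume h0: "deriv h s = 0" and h2: "deriv (deriv h) s \<noteq> 0" and w'0: "w' s \<noteq> 0" and M0: "M s \<noteq> 0"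
  have V': "Im (w' s) \<noteq> 0" using U' w'0 by (simp add: complex_eq_iff)
  have D3: "Re (?D 3 0) = 0" using hs h0 V' M0 by simp
  have prod: "((\<lambda>\<sigma>. Re (?D n (w \<sigma>) * w' \<sigma>)) has_real_derivative Re (?D (Suc n) 0 * (w' s)^2 + ?D n 0 * w2)) (at s)"
    "((\<lambda>\<sigma>. Im (?D n (w \<sigma>) * w' \<sigma>)) has_real_derivative Im (?D (Suc n) 0 * (w' s)^2 + ?D n 0 * w2)) (at s)" for n
  proof -
    have "((\<lambda>\<sigma>. ?D n (w \<sigma>) * w' \<sigma>) has_vector_derivative (?D n (w s) * w2 + (?D (Suc n) (w s) * w' s) * w' s)) (at s)"
      by (rule has_vector_derivative_mult[OF chain(3)[OF ws_in wd_s] w'])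
    then have 1: "((\<lambda>\<sigma>. ?D n (w \<sigma>) * w' \<sigma>) has_vector_derivative (?D (Suc n) 0 * (w' s)^2 + ?D n 0 * w2)) (at s)"
      by (simp add: ws power2_eq_square algebra_simps del: funpow.simps)
    show "((\<lambda>\<sigma>. Re (?D n (w \<sigma>) * w' \<sigma>)) has_real_derivative Re (?D (Suc n) 0 * (w' s)^2 + ?D n 0 * w2)) (at s)"
      "((\<lambda>\<sigma>. Im (?D n (w \<sigma>) * w' \<sigma>)) has_real_derivative Im (?D (Suc n) 0 * (w' s)^2 + ?D n 0 * w2)) (at s)"
      using bounded_linear.has_vector_derivative[OF bounded_linear_Re 1]
        bounded_linear.has_vector_derivative[OF bounded_linear_Im 1]
      by (simp_all only: has_real_derivative_iff_has_vector_derivative)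
  qed
  have w'sq: "(w' s)^2 = - of_real (Im (w' s) ^ 2)"
    using U' by (simp add: complex_eq_iff power2_eq_square)
  have U2: "Re w2 = 0"
  proof -
    let ?E2 = "Re w2 * Im (?D 1 0) - Re (?D 3 0 * (w' s)^2 + ?D 2 0 * w2) * v0"
    have "(E' has_real_derivative ?E2) (at s)"
      unfolding E'_def[abs_def]
      by (rule derivative_eq_intros wRI[OF wd_s] w'RI chain(1,2)[OF ws_in wd_s, of 1, unfolded num]
            prod[of 2, unfolded num] refl)+
         (simp add: ws U' K0 algebra_simps)
    moreover have "((\<lambda>_. 0) has_real_derivative ?E2) (at s) \<longleftrightarrow> (E' has_real_derivative ?E2) (at s)"
      by (rule DERIV_cong_ev) (use E'0 in \<open>auto elim: eventually_mono\<close>)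
    ultimately have "?E2 = 0" using DERIV_unique[OF _ DERIV_const] by blast
    then have "Re w2 * (Im (deriv K 0) - v0 * Re (?D 2 0)) = 0"
      using K0 D3 by (simp add: w'sq algebra_simps)
    then show ?thesis using transversal by simp
  qed
  let ?k2 = "Im (?D 4 0 * (w' s)^2 + ?D 3 0 * w2)"
  have k2: "(k' has_real_derivative ?k2) (at s)"
    unfolding k'_def[abs_def] using prod(2)[of 3, unfolded num] .
  have "((\<lambda>\<sigma>. M' \<sigma> * Im (?D 2 (w \<sigma>)) + M \<sigma> * k' \<sigma>) has_real_derivative
      (M2 * Im (?D 2 (w s)) + k' s * M' s) + (M' s * k' s + ?k2 * M s)) (at s)"
    by (intro DERIV_add DERIV_mult M' kd wd_s ws_in k2 eventually_nhds_x_imp_x[OF M])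
  then have "((\<lambda>\<sigma>. M' \<sigma> * Im (?D 2 (w \<sigma>)) + M \<sigma> * k' \<sigma>) has_real_derivative ?k2 * M s) (at s)"
    using K0 k's D3 by (simp add: ws del: funpow.simps)
  moreover have "(deriv h has_real_derivative d) (at s) \<longleftrightarrow>
      ((\<lambda>\<sigma>. M' \<sigma> * Im (?D 2 (w \<sigma>)) + M \<sigma> * k' \<sigma>) has_real_derivative d) (at s)" for d
    by (rule DERIV_cong_ev) (use hd in auto)
  ultimately have "deriv (deriv h) s = ?k2 * M s" using DERIV_imp_deriv by blast
  then have "?k2 \<noteq> 0" using h2 by auto
  moreover have "?k2 = - (Im (w' s)^2 * Im (?D 4 0))"
    using U2 D3 by (simp add: w'sq del: funpow.simps)
  ultimately show "Re ((deriv ^^ 3) K 0) = 0 \<and> Im ((deriv ^^ 4) K 0) \<noteq> 0" using D3 by auto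
qed

section \<open>Singularities in complex form\<close>

text \<open>The Jacobian determinant \<open>\<delta>\<close> of \<open>X = (Re F, Re G)\<close>, by the Cauchy-Riemann equations. Since
  \<open>G' = K'' F'\<close> it equals \<open>- |F'|\<^sup>2 Im K''\<close>.\<close>

definition caustic_density :: "(complex \<Rightarrow> complex) \<Rightarrow> (complex \<Rightarrow> complex) \<Rightarrow> complex \<Rightarrow> real" where
  "caustic_density F G z = - Im (cnj (deriv F z) * deriv G z)"

definition lifted_map :: "(complex \<Rightarrow> complex) \<Rightarrow> (complex \<Rightarrow> complex) \<Rightarrow> (complex \<Rightarrow> real) \<Rightarrow> complex \<Rightarrow> space" where
  "lifted_map F G \<gamma> z = (Re (F z), Re (G z), \<gamma> z)"

abbreviation small_germs :: "complex set \<Rightarrow> (complex \<Rightarrow> space) \<Rightarrow> complex \<Rightarrow> space set \<Rightarrow> bool" where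
  "small_germs S q p NF \<equiv> \<exists>N0. open N0 \<and> p \<in> N0 \<and> N0 \<subseteq> S \<and>
    (\<forall>N. open N \<and> p \<in> N \<and> N \<subseteq> N0 \<longrightarrow> diffeomorphic_germs (q ` N) (q p) NF 0)"

text \<open>\<open>F\<close> is open and injective near \<open>p\<close>, so small neighbourhoods of \<open>p\<close> correspond to small neighbourhoods of
  \<open>\<omega> = 0\<close>, and the images of the two maps differ by an affine isomorphism of the target.\<close>

lemma germ_of_lifted_map:
  fixes K F G :: "complex \<Rightarrow> complex" and \<gamma> :: "complex \<Rightarrow> real"
  assumes S0: "open S0" "p \<in> S0" "F holomorphic_on S0" "inj_on F S0"
    and L: "\<And>z. z \<in> S0 \<Longrightarrow> legendre_surface K (F z - F p) =
        (Re (F z) - Re (F p), Re (G z) - Re (G p), (\<gamma> z - \<gamma> p) + a * (Re (G z) - Re (G p)))"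
    and germ: "legendre_germs K NF"
  shows "small_germs S0 (lifted_map F G \<gamma>) p NF"
proof -
  obtain \<rho> where \<rho>: "\<rho> > 0" "\<And>N. open N \<Longrightarrow> 0 \<in> N \<Longrightarrow> N \<subseteq> ball 0 \<rho> \<Longrightarrow>
      diffeomorphic_germs (legendre_surface K ` N) 0 NF 0"
    using germ by blast
  define N0 where "N0 = S0 \<inter> F -` ball (F p) \<rho>"
  have oN0: "open N0" unfolding N0_def
    by (rule continuous_open_preimage[OF holomorphic_on_imp_continuous_on[OF S0(3)] S0(1) open_ball])
  define \<Lambda> :: "space \<Rightarrow> space" where "\<Lambda> x = (fst x, fst (snd x), snd (snd x) + a * fst (snd x))" for x
  define \<Lambda>' :: "space \<Rightarrow> space" where "\<Lambda>' x = (fst x, fst (snd x), snd (snd x) - a * fst (snd x))" for x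
  have lin: "bounded_linear \<Lambda>" "bounded_linear \<Lambda>'" unfolding \<Lambda>_def[abs_def] \<Lambda>'_def[abs_def]
    by (intro bounded_linear_Pair bounded_linear_add bounded_linear_sub bounded_linear_const_mult
        bounded_linear_compose[OF bounded_linear_fst] bounded_linear_compose[OF bounded_linear_snd]
        bounded_linear_fst bounded_linear_snd bounded_linear_ident)+
  let ?q = "lifted_map F G \<gamma>"
  show ?thesis
  proof (intro exI[of _ N0] conjI allI impI)
    show "p \<in> N0" using S0(2) \<rho>(1) by (simp add: N0_def)
    fix N assume N: "open N \<and> p \<in> N \<and> N \<subseteq> N0"
    have NS: "N \<subseteq> S0" using N by (auto simp: N0_def)
    have "open (F ` N)"
      by (rule open_mapping_thm3[OF holomorphic_on_subset[OF S0(3) NS] _ inj_on_subset[OF S0(4) NS]]) (use N in simp)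
    then have "open ((\<lambda>z. z - F p) ` F ` N)" by (rule open_translation_subtract)
    moreover have "(\<lambda>z. z - F p) ` F ` N \<subseteq> ball 0 \<rho>"
      using N by (force simp: N0_def dist_norm norm_minus_commute)
    moreover have "0 \<in> (\<lambda>z. z - F p) ` F ` N" using N by force
    ultimately have "diffeomorphic_germs (legendre_surface K ` (\<lambda>z. z - F p) ` F ` N) 0 NF 0"
      by (intro \<rho>(2))
    moreover have "legendre_surface K ` (\<lambda>z. z - F p) ` F ` N = (\<lambda>x. \<Lambda> x + - \<Lambda> (?q p)) ` ?q ` N"
      unfolding image_image
      by (rule image_cong) (use NS in \<open>auto simp: L \<Lambda>_def lifted_map_def algebra_simps\<close>)
    ultimately have "diffeomorphic_germs ((\<lambda>x. \<Lambda> x + - \<Lambda> (?q p)) ` ?q ` N) (\<Lambda> (?q p) + - \<Lambda> (?q p)) NF 0"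
      by simp
    then show "diffeomorphic_germs (?q ` N) (?q p) NF 0"
      by (rule diffeomorphic_germs_affine[OF lin, rotated 2]) (simp_all add: \<Lambda>_def \<Lambda>'_def)
  qed (use oN0 in \<open>auto simp: N0_def\<close>)
qed

text \<open>Replacing \<open>(F, G)\<close> by \<open>(G, -F)\<close> rotates the plane of \<open>X\<close> and leaves \<open>g\<close>, \<open>\<delta>\<close> and the bracket conditions
  unchanged. This covers the points where \<open>F' = 0\<close>.\<close>

lemma germ_of_rotated_lifted_map:
  assumes "diffeomorphic_germs (lifted_map G (\<lambda>z. - F z) \<gamma> ` N) (lifted_map G (\<lambda>z. - F z) \<gamma> p) NF 0"
  shows "diffeomorphic_germs (lifted_map F G \<gamma> ` N) (lifted_map F G \<gamma> p) NF 0"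
proof -
  define \<Lambda> :: "space \<Rightarrow> space" where "\<Lambda> x = (fst (snd x), - fst x, snd (snd x))" for x
  define \<Lambda>' :: "space \<Rightarrow> space" where "\<Lambda>' x = (- fst (snd x), fst x, snd (snd x))" for x
  have lin: "bounded_linear \<Lambda>" "bounded_linear \<Lambda>'" unfolding \<Lambda>_def[abs_def] \<Lambda>'_def[abs_def]
    by (intro bounded_linear_Pair bounded_linear_minus
        bounded_linear_compose[OF bounded_linear_fst] bounded_linear_compose[OF bounded_linear_snd]
        bounded_linear_fst bounded_linear_snd bounded_linear_ident)+
  have q: "\<Lambda> (lifted_map F G \<gamma> z) + 0 = lifted_map G (\<lambda>z. - F z) \<gamma> z" for z
    by (simp add: \<Lambda>_def lifted_map_def)
  show ?thesis
    by (rule diffeomorphic_germs_affine[OF lin, where k = 0])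
       (use assms in \<open>simp_all only: image_image q\<close>, simp_all add: \<Lambda>_def \<Lambda>'_def)
qed

lemma eventually_curve_in_open:
  assumes "(z has_vector_derivative d) (at s)" "open S" "z s \<in> S"
  shows "\<forall>\<^sub>F \<sigma> in nhds s. z \<sigma> \<in> S"
proof -
  have "\<forall>\<^sub>F \<sigma> in at s. z \<sigma> \<in> S"
    using has_vector_derivative_continuous[OF assms(1)] topological_tendstoD[of z "z s" "at s" S] assms(2,3)
    unfolding isCont_def by blast
  then show ?thesis unfolding eventually_nhds_conv_at using assms(3) by simp
qed

text \<open>\<open>z\<close> is the curve \<open>[x - X, c] = 0\<close> through \<open>p\<close> with \<open>x = X p\<close>, and \<open>h\<close> is \<open>\<delta>\<close> along it. The first
  jet condition is that of a cuspidal edge. For the swallowtail, \<open>\<phi>\<^sub>u\<^sub>v\<^sub>v = - Im K'''\<close> must not vanish: since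
  \<open>Re K''' = 0\<close>, otherwise \<open>K''' = 0\<close> and \<open>\<delta> = - |F'|\<^sup>2 Im K''\<close> would have derivative zero at \<open>p\<close>.\<close>

lemma singularities_of_lifted_map_regular:
  fixes F G :: "complex \<Rightarrow> complex" and \<gamma> :: "complex \<Rightarrow> real" and z z' :: "real \<Rightarrow> complex" and h :: "real \<Rightarrow> real"
  assumes S: "open S" "p \<in> S" and F: "F holomorphic_on S" and G: "G holomorphic_on S"
    and \<gamma>s: "\<And>s t. Complex s t \<in> S \<Longrightarrow> ((\<lambda>s. \<gamma> (Complex s t)) has_real_derivative
        Im (G (Complex s t)) * Re (deriv F (Complex s t)) - Im (F (Complex s t)) * Re (deriv G (Complex s t))) (at s)"
    and \<gamma>t: "\<And>s t. Complex s t \<in> S \<Longrightarrow> ((\<lambda>t. \<gamma> (Complex s t)) has_real_derivative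
        Im (F (Complex s t)) * Im (deriv G (Complex s t)) - Im (G (Complex s t)) * Im (deriv F (Complex s t))) (at t)"
    and z: "\<forall>\<^sub>F \<sigma> in nhds s. (z has_vector_derivative z' \<sigma>) (at \<sigma>)"
    and z': "(z' has_vector_derivative z2) (at s)" "z' s \<noteq> 0" and zs: "z s = p"
    and conormal: "\<forall>\<^sub>F \<sigma> in nhds s. (Re (F p) - Re (F (z \<sigma>))) * Im (G (z \<sigma>)) = (Re (G p) - Re (G (z \<sigma>))) * Im (F (z \<sigma>))"
    and transversal: "Im (deriv F p) * Im (G p) \<noteq> Im (deriv G p) * Im (F p)"
    and \<delta>p: "caustic_density F G p = 0"
    and h: "\<forall>\<^sub>F \<sigma> in nhds s. h \<sigma> = caustic_density F G (z \<sigma>)"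
    and F': "deriv F p \<noteq> 0"
  shows "deriv h s \<noteq> 0 \<Longrightarrow> small_germs S (lifted_map F G \<gamma>) p standard_cuspidal_edge"
    and "deriv h s = 0 \<Longrightarrow> deriv (deriv h) s \<noteq> 0 \<Longrightarrow> \<not> (caustic_density F G has_derivative (\<lambda>_. 0)) (at p) \<Longrightarrow>
      small_germs S (lifted_map F G \<gamma>) p standard_swallowtail"
proof -
  obtain K R S0 where R: "0 < R" and K: "K holomorphic_on ball 0 R" and K00: "K 0 = 0"
    and S0: "open S0" "p \<in> S0" "S0 \<subseteq> S" "inj_on F S0"
    and inR: "\<And>z. z \<in> S0 \<Longrightarrow> F z - F p \<in> ball 0 R"
    and dK: "\<And>z. z \<in> S0 \<Longrightarrow> deriv K (F z - F p) = G z - of_real (Re (G p))"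
    and L: "\<And>z. z \<in> S0 \<Longrightarrow> legendre_surface K (F z - F p) =
        (Re (F z) - Re (F p), Re (G z) - Re (G p), (\<gamma> z - \<gamma> p) + Im (F p) * (Re (G z) - Re (G p)))"
    by (rule legendre_normal_form[OF S F G F' \<gamma>s \<gamma>t]) (assumption | rule that)+
  let ?D = "\<lambda>n. (deriv ^^ n) K"
  have hol: "?D n holomorphic_on ball 0 R" for n by (rule holomorphic_higher_deriv[OF K open_ball])
  have D2: "?D 2 = deriv (deriv K)" by (simp add: numeral_2_eq_2)
  have FS: "F holomorphic_on S0" and GS: "G holomorphic_on S0"
    using holomorphic_on_subset[OF _ S0(3)] F G by blast+
  have hF': "deriv F holomorphic_on S0" by (rule holomorphic_deriv[OF FS S0(1)])
  have dF: "(F has_field_derivative deriv F y) (at y)" and dG: "(G has_field_derivative deriv G y) (at y)"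
    if "y \<in> S0" for y
    using holomorphic_derivI[OF FS S0(1) that] holomorphic_derivI[OF GS S0(1) that] .
  have dFp: "((\<lambda>y. F y - F p) has_field_derivative deriv F y) (at y)" if "y \<in> S0" for y
    using dF[OF that] by (auto intro!: derivative_eq_intros)
  have G': "deriv G y = ?D 2 (F y - F p) * deriv F y" if y: "y \<in> S0" for y
  proof -
    have "(deriv K has_field_derivative ?D 2 (F y - F p)) (at (F y - F p))"
      unfolding D2 by (rule holomorphic_derivI[OF holomorphic_deriv[OF K open_ball] open_ball inR[OF y]])
    from DERIV_chain2[OF this dFp[OF y]]
    have "((\<lambda>y. deriv K (F y - F p)) has_field_derivative ?D 2 (F y - F p) * deriv F y) (at y)" .
    then have "((\<lambda>y. G y - of_real (Re (G p))) has_field_derivative ?D 2 (F y - F p) * deriv F y) (at y)"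
      by (rule has_field_derivative_transform_within_open[OF _ S0(1) y]) (rule dK)
    moreover have "((\<lambda>y. G y - of_real (Re (G p))) has_field_derivative deriv G y) (at y)"
      using dG[OF y] by (auto intro!: derivative_eq_intros)
    ultimately show ?thesis using DERIV_unique by blast
  qed
  define m where "m y = - (Re (deriv F y)^2 + Im (deriv F y)^2)" for y
  have dens: "caustic_density F G y = m y * Im (?D 2 (F y - F p))" if "y \<in> S0" for y
    by (simp add: caustic_density_def G'[OF that] m_def power2_eq_square algebra_simps)
  have "m p = - (cmod (deriv F p) ^ 2)" by (simp add: m_def cmod_power2)
  then have mp: "m p \<noteq> 0" using F' by simp
  have K2: "Im (?D 2 0) = 0" using dens[OF S0(2)] \<delta>p mp by simp
  have K1: "deriv K 0 = G p - of_real (Re (G p))" using dK[OF S0(2)] by simp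
  have inS0: "\<forall>\<^sub>F \<sigma> in nhds s. z \<sigma> \<in> S0"
    by (rule eventually_curve_in_open[OF eventually_nhds_x_imp_x[OF z] S0(1)]) (simp add: zs S0(2))
  define w where "w \<sigma> = F (z \<sigma>) - F p" for \<sigma>
  define w' where "w' \<sigma> = deriv F (z \<sigma>) * z' \<sigma>" for \<sigma>
  define M where "M \<sigma> = m (z \<sigma>)" for \<sigma>
  let ?f = "\<lambda>\<sigma>. deriv (deriv F) (z \<sigma>) * z' \<sigma>"
  define M' where "M' \<sigma> = - (2 * Re (deriv F (z \<sigma>)) * Re (?f \<sigma>) + 2 * Im (deriv F (z \<sigma>)) * Im (?f \<sigma>))" for \<sigma>
  have wd: "\<forall>\<^sub>F \<sigma> in nhds s. (w has_vector_derivative w' \<sigma>) (at \<sigma>)"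
    using z inS0
  proof eventually_elim
    case (elim \<sigma>)
    show ?case unfolding w_def[abs_def] w'_def
      using has_vector_derivative_diff[OF holomorphic_along_curve(3)[OF FS S0(1) elim(2,1)] has_vector_derivative_const[of "F p"]]
      by simp
  qed
  note zds = eventually_nhds_x_imp_x[OF z]
  have zsS: "z s \<in> S0" using zs S0(2) by simp
  note f1 = holomorphic_along_curve[OF hF' S0(1)]
  have w'd: "(w' has_vector_derivative (deriv F (z s) * z2 + (deriv (deriv F) (z s) * z' s) * z' s)) (at s)"
    unfolding w'_def[abs_def] by (rule has_vector_derivative_mult[OF f1(3)[OF zsS zds] z'(1)])
  have Md: "\<forall>\<^sub>F \<sigma> in nhds s. (M has_real_derivative M' \<sigma>) (at \<sigma>)"
    using z inS0
  proof eventually_elim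
    case (elim \<sigma>)
    show ?case unfolding M_def[abs_def] m_def M'_def
      by (rule derivative_eq_intros f1(1,2)[OF elim(2,1)] refl)+ simp
  qed
  have "\<exists>M2. (M' has_real_derivative M2) (at s)"
  proof -
    have "(?f has_vector_derivative (deriv (deriv F) (z s) * z2 + (deriv (deriv (deriv F)) (z s) * z' s) * z' s)) (at s)"
      by (rule has_vector_derivative_mult[OF holomorphic_along_curve(3)[OF holomorphic_deriv[OF hF' S0(1)] S0(1) zsS zds] z'(1)])
    note f2 = bounded_linear.has_vector_derivative[OF bounded_linear_Re this, folded has_real_derivative_iff_has_vector_derivative]
      bounded_linear.has_vector_derivative[OF bounded_linear_Im this, folded has_real_derivative_iff_has_vector_derivative]
    show ?thesis unfolding M'_def[abs_def]
      by (rule exI) (rule derivative_eq_intros f1(1,2)[OF zsS zds] f2 refl)+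
  qed
  then obtain M2 where M'd: "(M' has_real_derivative M2) (at s)" ..
  have conormal': "\<forall>\<^sub>F \<sigma> in nhds s. Re (w \<sigma>) * Im (deriv K (w \<sigma>)) = Re (deriv K (w \<sigma>)) * (Im (w \<sigma>) + Im (F p))"
    using conormal inS0
  proof eventually_elim
    case (elim \<sigma>)
    then show ?case by (simp add: w_def dK algebra_simps)
  qed
  have tr: "Im (deriv K 0) - Im (F p) * Re (?D 2 0) \<noteq> 0"
  proof
    assume "Im (deriv K 0) - Im (F p) * Re (?D 2 0) = 0"
    then have "Im (G p) = Im (F p) * Re (?D 2 0)" by (simp add: K1)
    moreover have "Im (deriv G p) = Re (?D 2 0) * Im (deriv F p)"
      using G'[OF S0(2)] K2 by simp
    ultimately show False using transversal by simp
  qed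
  have h': "\<forall>\<^sub>F \<sigma> in nhds s. h \<sigma> = M \<sigma> * Im (?D 2 (w \<sigma>))"
    using h inS0 by eventually_elim (simp add: dens M_def w_def)
  have "w s = 0" by (simp add: w_def zs)
  have ReK1: "Re (deriv K 0) = 0" by (simp add: K1)
  note jets = caustic_jets_along_curve[OF K R wd w'd \<open>w s = 0\<close> Md M'd ReK1 K2 conormal' tr h']
  have low: "Im (?D j 0 * \<i> ^ j) = 0" if "j < 3" for j
  proof -
    have "j = 0 \<or> j = 1 \<or> j = 2" using that by auto
    then show ?thesis using K00 ReK1 K2 by auto
  qed
  have i3: "\<i> ^ 3 = - \<i>" and i4: "\<i> ^ 4 = 1" by (simp_all add: eval_nat_numeral)
  have weaken: "\<exists>N0. open N0 \<and> p \<in> N0 \<and> N0 \<subseteq> S \<and> (\<forall>N. open N \<and> p \<in> N \<and> N \<subseteq> N0 \<longrightarrow> Q N)"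
    if "\<exists>N0. open N0 \<and> p \<in> N0 \<and> N0 \<subseteq> S0 \<and> (\<forall>N. open N \<and> p \<in> N \<and> N \<subseteq> N0 \<longrightarrow> Q N)" for Q
    using that S0(3) by (meson order_trans)
  have germ: "small_germs S (lifted_map F G \<gamma>) p NF"
    if "legendre_germs K NF" for NF
    by (rule weaken, rule germ_of_lifted_map[OF S0(1,2) FS S0(4) _ that]) (rule L)
  show "small_germs S (lifted_map F G \<gamma>) p standard_cuspidal_edge"
    if "deriv h s \<noteq> 0"
  proof (rule germ)
    have "Im (?D 3 0 * \<i> ^ 3) \<noteq> 0" using jets(1)[OF that] by (simp add: i3)
    from cuspidal_edge_legendre_surface[OF K R low this]
    show "legendre_germs K standard_cuspidal_edge" by simp
  qed
  assume hyp: "deriv h s = 0" "deriv (deriv h) s \<noteq> 0" "\<not> (caustic_density F G has_derivative (\<lambda>_. 0)) (at p)"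
  have "w' s \<noteq> 0" using F' z'(2) by (simp add: w'_def zs)
  moreover have "M s \<noteq> 0" using mp by (simp add: M_def zs)
  ultimately have D34: "Re (?D 3 0) = 0" "Im (?D 4 0) \<noteq> 0" using jets(2)[OF hyp(1,2)] by auto
  have "Im (?D 3 0) \<noteq> 0"
  proof
    assume "Im (?D 3 0) = 0"
    with D34 have D3: "?D 3 0 = 0" by (simp add: complex_eq_iff)
    have "(?D 2 has_field_derivative deriv (?D 2) 0) (at (F p - F p))"
      using holomorphic_derivI[OF hol open_ball, of 0 2] R by simp
    moreover have "deriv (?D 2) 0 = 0" using D3 by (simp add: numeral_3_eq_3 D2)
    ultimately have "((\<lambda>y. ?D 2 (F y - F p)) has_field_derivative 0) (at p)"
      using DERIV_chain2[OF _ dFp[OF S0(2)], of "?D 2" 0] by simp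
    then have "((\<lambda>y. ?D 2 (F y - F p)) has_derivative (\<lambda>_. 0)) (at p)"
      by (simp add: has_field_derivative_def lambda_zero)
    from bounded_linear.has_derivative[OF bounded_linear_Im this]
    have d: "((\<lambda>y. Im (?D 2 (F y - F p))) has_derivative (\<lambda>_. 0)) (at p)" by simp
    have "isCont (deriv F) p"
      using hF' S0(1,2) continuous_on_eq_continuous_at holomorphic_on_imp_continuous_on by blast
    then have "isCont m p" unfolding m_def[abs_def]
      by (auto intro!: continuous_intros continuous_Re continuous_Im)
    from has_derivative_bilinear_at_zero[OF bounded_bilinear_mult this d]
    have "((\<lambda>y. m y * Im (?D 2 (F y - F p))) has_derivative (\<lambda>_. 0)) (at p)" using K2 by simp
    then have "(caustic_density F G has_derivative (\<lambda>_. 0)) (at p)"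
      by (rule has_derivative_transform_within_open[OF _ S0(1,2)]) (simp add: dens)
    then show False using hyp(3) by simp
  qed
  then have versal: "Im (?D 3 0 * \<i> ^ 2) \<noteq> 0" by simp
  have low4: "Im (?D j 0 * \<i> ^ j) = 0" if "j < 4" for j
  proof (cases "j = 3")
    case True
    show ?thesis unfolding True by (simp only: i3) (simp add: D34(1))
  next
    case False
    then show ?thesis using low that by simp
  qed
  have "Im (?D 4 0 * \<i> ^ 4) \<noteq> 0" using D34(2) by (simp only: i4) simp
  from swallowtail_legendre_surface[OF K R low4 this versal]
  have "legendre_germs K standard_swallowtail" by simp
  from germ[OF this]
  show "small_germs S (lifted_map F G \<gamma>) p standard_swallowtail" .
qed

text \<open>The transversality hypothesis is \<open>[X\<^sub>t, c] \<noteq> 0\<close>; it implies that \<open>F'\<close> and \<open>G'\<close> do not both vanish at \<open>p\<close>.\<close>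

lemma singularities_of_lifted_map:
  fixes F G :: "complex \<Rightarrow> complex" and \<gamma> :: "complex \<Rightarrow> real" and z z' :: "real \<Rightarrow> complex" and h :: "real \<Rightarrow> real"
  assumes S: "open S" "p \<in> S" and F: "F holomorphic_on S" and G: "G holomorphic_on S"
    and \<gamma>s: "\<And>s t. Complex s t \<in> S \<Longrightarrow> ((\<lambda>s. \<gamma> (Complex s t)) has_real_derivative
        Im (G (Complex s t)) * Re (deriv F (Complex s t)) - Im (F (Complex s t)) * Re (deriv G (Complex s t))) (at s)"
    and \<gamma>t: "\<And>s t. Complex s t \<in> S \<Longrightarrow> ((\<lambda>t. \<gamma> (Complex s t)) has_real_derivative
        Im (F (Complex s t)) * Im (deriv G (Complex s t)) - Im (G (Complex s t)) * Im (deriv F (Complex s t))) (at t)"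
    and z: "\<forall>\<^sub>F \<sigma> in nhds s. (z has_vector_derivative z' \<sigma>) (at \<sigma>)"
    and z': "(z' has_vector_derivative z2) (at s)" "z' s \<noteq> 0" and zs: "z s = p"
    and conormal: "\<forall>\<^sub>F \<sigma> in nhds s. (Re (F p) - Re (F (z \<sigma>))) * Im (G (z \<sigma>)) = (Re (G p) - Re (G (z \<sigma>))) * Im (F (z \<sigma>))"
    and transversal: "Im (deriv F p) * Im (G p) \<noteq> Im (deriv G p) * Im (F p)"
    and \<delta>p: "caustic_density F G p = 0"
    and h: "\<forall>\<^sub>F \<sigma> in nhds s. h \<sigma> = caustic_density F G (z \<sigma>)"
  shows "deriv h s \<noteq> 0 \<Longrightarrow> small_germs S (lifted_map F G \<gamma>) p standard_cuspidal_edge"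
    and "deriv h s = 0 \<Longrightarrow> deriv (deriv h) s \<noteq> 0 \<Longrightarrow> \<not> (caustic_density F G has_derivative (\<lambda>_. 0)) (at p) \<Longrightarrow>
      small_germs S (lifted_map F G \<gamma>) p standard_swallowtail"
proof -
  let ?germ = "\<lambda>F G NF. small_germs S (lifted_map F G \<gamma>) p NF"
  have "(deriv h s \<noteq> 0 \<longrightarrow> ?germ F G standard_cuspidal_edge) \<and> (deriv h s = 0 \<longrightarrow> deriv (deriv h) s \<noteq> 0 \<longrightarrow>
      \<not> (caustic_density F G has_derivative (\<lambda>_. 0)) (at p) \<longrightarrow> ?germ F G standard_swallowtail)"
  proof (cases "deriv F p = 0")
    case False
    note * = singularities_of_lifted_map_regular[OF S F G \<gamma>s \<gamma>t z z' zs conormal transversal \<delta>p h False]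
    show ?thesis by (intro conjI impI) ((rule *(1); assumption), (rule *(2); assumption))
  next
    case True
    let ?F = "\<lambda>z. - F z"
    have G'p: "deriv G p \<noteq> 0" using transversal True by auto
    have hF: "?F holomorphic_on S" by (intro holomorphic_intros F)
    have dF: "deriv ?F y = - deriv F y" if "y \<in> S" for y
      using holomorphic_derivI[OF F S(1) that] by (intro DERIV_imp_deriv) (auto intro!: derivative_eq_intros)
    have dens: "caustic_density G ?F y = caustic_density F G y" if "y \<in> S" for y
      by (simp add: caustic_density_def dF[OF that])
    have inS: "\<forall>\<^sub>F \<sigma> in nhds s. z \<sigma> \<in> S"
      by (rule eventually_curve_in_open[OF eventually_nhds_x_imp_x[OF z] S(1)]) (simp add: zs S(2))
    have h2: "\<forall>\<^sub>F \<sigma> in nhds s. h \<sigma> = caustic_density G ?F (z \<sigma>)"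
      using h inS by eventually_elim (simp add: dens)
    have con2: "\<forall>\<^sub>F \<sigma> in nhds s. (Re (G p) - Re (G (z \<sigma>))) * Im (?F (z \<sigma>)) = (Re (?F p) - Re (?F (z \<sigma>))) * Im (G (z \<sigma>))"
      using conormal by eventually_elim (simp add: algebra_simps)
    have tr2: "Im (deriv G p) * Im (?F p) \<noteq> Im (deriv ?F p) * Im (G p)"
      using transversal by (simp add: dF[OF S(2)])
    have d2: "caustic_density G ?F p = 0" using \<delta>p dens[OF S(2)] by simp
    have gs2: "((\<lambda>s. \<gamma> (Complex s t)) has_real_derivative
        Im (?F (Complex s t)) * Re (deriv G (Complex s t)) - Im (G (Complex s t)) * Re (deriv ?F (Complex s t))) (at s)"
      if "Complex s t \<in> S" for s t
      using \<gamma>s[OF that] by (simp add: dF[OF that] algebra_simps)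
    have gt2: "((\<lambda>t. \<gamma> (Complex s t)) has_real_derivative
        Im (G (Complex s t)) * Im (deriv ?F (Complex s t)) - Im (?F (Complex s t)) * Im (deriv G (Complex s t))) (at t)"
      if "Complex s t \<in> S" for s t
      using \<gamma>t[OF that] by (simp add: dF[OF that] algebra_simps)
    note * = singularities_of_lifted_map_regular[where F = G and G = ?F and \<gamma> = \<gamma> and z = z and z' = z' and h = h,
        OF S G hF gs2 gt2 z z' zs con2 tr2 d2 h2 G'p]
    have rot: "?germ F G NF" if germ: "?germ G ?F NF" for NF
    proof -
      from germ obtain N0 where X: "open N0 \<and> p \<in> N0 \<and> N0 \<subseteq> S \<and>
          (\<forall>N. open N \<and> p \<in> N \<and> N \<subseteq> N0 \<longrightarrow>
          diffeomorphic_germs (lifted_map G ?F \<gamma> ` N) (lifted_map G ?F \<gamma> p) NF 0)" ..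
      note N0 = X[THEN conjunct1] X[THEN conjunct2, THEN conjunct1] X[THEN conjunct2, THEN conjunct2, THEN conjunct1]
        and N = X[THEN conjunct2, THEN conjunct2, THEN conjunct2]
      have "\<forall>N. open N \<and> p \<in> N \<and> N \<subseteq> N0 \<longrightarrow>
          diffeomorphic_germs (lifted_map F G \<gamma> ` N) (lifted_map F G \<gamma> p) NF 0"
        by (intro allI impI) (rule germ_of_rotated_lifted_map, rule N[rule_format])
      with N0 show ?thesis by (intro exI[of _ N0] conjI)
    qed
    have "(caustic_density F G has_derivative (\<lambda>_. 0)) (at p)" if "(caustic_density G ?F has_derivative (\<lambda>_. 0)) (at p)"
      by (rule has_derivative_transform_within_open[OF that S]) (rule dens)
    then have nd: "\<not> (caustic_density G ?F has_derivative (\<lambda>_. 0)) (at p)"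
      if "\<not> (caustic_density F G has_derivative (\<lambda>_. 0)) (at p)"
      using that by blast
    show ?thesis by (intro conjI impI; rule rot)
        ((rule *(1); assumption), (rule *(2); (assumption | erule nd)))
  qed
  then show "deriv h s \<noteq> 0 \<Longrightarrow> ?germ F G standard_cuspidal_edge"
    and "deriv h s = 0 \<Longrightarrow> deriv (deriv h) s \<noteq> 0 \<Longrightarrow>
      \<not> (caustic_density F G has_derivative (\<lambda>_. 0)) (at p) \<Longrightarrow> ?germ F G standard_swallowtail"
    by blast+
qed

section \<open>Singularities of improper affine maps\<close>

lemma bracket_eq: "bracket u v = fst u * snd v - fst v * snd u"
  by (simp add: bracket_def det_2)

lemma smooth_on_first_partial:
  fixes f :: "real \<times> plane \<Rightarrow> real"
  assumes "smooth_on S f" "(\<sigma>, x) \<in> S"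
  shows "((\<lambda>\<sigma>. f (\<sigma>, x)) has_real_derivative frechet_derivative f (at (\<sigma>, x)) (1, 0)) (at \<sigma>)"
proof -
  let ?f' = "frechet_derivative f (at (\<sigma>, x))"
  have d: "(f has_derivative ?f') (at (\<sigma>, x))" by (rule smooth_on_has_derivative[OF assms])
  have "((\<lambda>\<sigma>. (\<sigma>, x)) has_derivative (\<lambda>h. (h, 0))) (at \<sigma>)"
    by (intro has_derivative_Pair has_derivative_ident has_derivative_const)
  from has_derivative_compose[OF this d]
  have "((\<lambda>\<sigma>. f (\<sigma>, x)) has_derivative (\<lambda>h. ?f' (h, 0))) (at \<sigma>)" .
  moreover have "(\<lambda>h. ?f' (h, 0)) = (*) (?f' (1, 0))"
  proof
    fix h
    have "?f' (h *\<^sub>R (1, 0)) = h *\<^sub>R ?f' (1, 0)" by (rule linear_scale[OF has_derivative_linear[OF d]])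
    then show "?f' (h, 0) = ?f' (1, 0) * h" by (simp add: mult.commute)
  qed
  ultimately show ?thesis by (simp add: has_field_derivative_def)
qed

theorem corollary5p3:
  fixes \<Omega> :: "(real \<times> real) set"
    and A B C D g :: "real \<times> real \<Rightarrow> real"
    and s0 t0 :: real
  assumes data: "improper_affine_data \<Omega> A B C D g"
    and nondegenerate:
      "\<And>p. p \<in> \<Omega> \<Longrightarrow> jac_det (planar_map A B) p = 0 \<Longrightarrow>
         (partial_s (jac_det (planar_map A B)) p, partial_t (jac_det (planar_map A B)) p) \<noteq> (0, 0)"
    and base: "(s0, t0) \<in> \<Omega>" "jac_det (planar_map A B) (s0, t0) = 0"
    and base_delta_t: "partial_t (jac_det (planar_map A B)) (s0, t0) \<noteq> 0"
    and base_X_t: "partial_t (planar_map A B) (s0, t0) \<noteq> 0"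
    and base_bracket:
      "bracket (partial_t (planar_map A B) (s0, t0)) (conormal C D (s0, t0)) \<noteq> 0"
  shows "\<exists>\<epsilon>>0. \<forall>I J U \<tau>.
      open I \<and> s0 \<in> I \<and> I \<subseteq> ball s0 \<epsilon> \<and>
      open J \<and> t0 \<in> J \<and> J \<subseteq> ball t0 \<epsilon> \<and>
      open U \<and> planar_map A B (s0, t0) \<in> U \<and> U \<subseteq> ball (planar_map A B (s0, t0)) \<epsilon> \<and>
      I \<times> J \<subseteq> \<Omega> \<and> implicit_solution (planar_map A B) (conormal C D) I J U \<tau> \<longrightarrow>
      (\<forall>s\<in>I. \<forall>t\<in>J. planar_map A B (s, t) \<in> U \<longrightarrow>
         (let \<delta> = jac_det (planar_map A B);
              x = planar_map A B (s, t);
              h = (\<lambda>s'. \<delta> (s', \<tau> (s', x)))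
          in (\<delta> (s, t) = 0 \<and> deriv h s \<noteq> 0 \<longrightarrow>
                small_images \<Omega> (affine_map A B g) (s, t)
                  (\<lambda>M. cuspidal_edge_at M (affine_map A B g (s, t)))) \<and>
             (\<delta> (s, t) = 0 \<and> deriv h s = 0 \<and> deriv (deriv h) s \<noteq> 0 \<longrightarrow>
                small_images \<Omega> (affine_map A B g) (s, t)
                  (\<lambda>M. swallowtail_at M (affine_map A B g (s, t))))))"
proof -
  define \<Omega>c where "\<Omega>c = {z. (Re z, Im z) \<in> \<Omega>}"
  define F where "F z = Complex (A (Re z, Im z)) (- D (Re z, Im z))" for z
  define G where "G z = Complex (B (Re z, Im z)) (C (Re z, Im z))" for z
  define \<gamma> where "\<gamma> z = g (Re z, Im z)" for z
  let ?X = "planar_map A B" and ?c = "conormal C D"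
  let ?J = "jac_det ?X"
  have o\<Omega>: "open \<Omega>" and F: "F holomorphic_on \<Omega>c" and G: "G holomorphic_on \<Omega>c"
    using data by (auto simp: improper_affine_data_def F_def[abs_def] G_def[abs_def] \<Omega>c_def)
  have o\<Omega>c: "open \<Omega>c"
  proof -
    have "continuous_on UNIV (\<lambda>z::complex. (Re z, Im z))" by (intro continuous_intros)
    then have "open ((\<lambda>z. (Re z, Im z)) -` \<Omega>)" using o\<Omega> open_vimage by blast
    then show ?thesis by (simp add: \<Omega>c_def vimage_def)
  qed
  have mem: "Complex s t \<in> \<Omega>c \<longleftrightarrow> (s, t) \<in> \<Omega>" for s t by (simp add: \<Omega>c_def)
  have AF: "A (s, t) = Re (F (Complex s t))" "D (s, t) = - Im (F (Complex s t))"
    "B (s, t) = Re (G (Complex s t))" "C (s, t) = Im (G (Complex s t))" for s t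
    by (simp_all add: F_def G_def)
  have dF: "(F has_field_derivative deriv F z) (at z)" and dG: "(G has_field_derivative deriv G z) (at z)"
    if "z \<in> \<Omega>c" for z
    using holomorphic_derivI[OF F o\<Omega>c that] holomorphic_derivI[OF G o\<Omega>c that] .
  have Xs: "partial_s ?X (s, t) = (Re (deriv F (Complex s t)), Re (deriv G (Complex s t)))"
    and Xt: "partial_t ?X (s, t) = (- Im (deriv F (Complex s t)), - Im (deriv G (Complex s t)))"
    if st: "(s, t) \<in> \<Omega>" for s t
  proof -
    have z: "Complex s t \<in> \<Omega>c" using st mem by simp
    note d = complex_partial_derivatives[OF dF[OF z]] complex_partial_derivatives[OF dG[OF z]]
    have "((\<lambda>s. ?X (s, t)) has_vector_derivative (Re (deriv F (Complex s t)), Re (deriv G (Complex s t)))) (at s)"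
      unfolding planar_map_def AF
      by (rule has_vector_derivative_Pair)
         (use d in \<open>simp_all add: has_real_derivative_iff_has_vector_derivative\<close>)
    then show "partial_s ?X (s, t) = (Re (deriv F (Complex s t)), Re (deriv G (Complex s t)))"
      by (simp add: partial_s_def vector_derivative_at)
    have "((\<lambda>t. ?X (s, t)) has_vector_derivative (- Im (deriv F (Complex s t)), - Im (deriv G (Complex s t)))) (at t)"
      unfolding planar_map_def AF
      by (rule has_vector_derivative_Pair)
         (use d in \<open>simp_all add: has_real_derivative_iff_has_vector_derivative\<close>)
    then show "partial_t ?X (s, t) = (- Im (deriv F (Complex s t)), - Im (deriv G (Complex s t)))"
      by (simp add: partial_t_def vector_derivative_at)
  qed
  have J: "?J (s, t) = caustic_density F G (Complex s t)" if "(s, t) \<in> \<Omega>" for s t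
    by (simp add: jac_det_def Xs[OF that] Xt[OF that] bracket_eq caustic_density_def algebra_simps)
  have c: "?c (s, t) = (Im (F (Complex s t)), Im (G (Complex s t)))" for s t
    by (simp add: conormal_def AF)
  have g\<gamma>: "g (s, t) = \<gamma> (Complex s t)" for s t by (simp add: \<gamma>_def)
  have gd: "((\<lambda>s'. g (s', t)) has_real_derivative bracket (partial_s ?X (s, t)) (?c (s, t))) (at s)"
      "((\<lambda>t'. g (s, t')) has_real_derivative bracket (partial_t ?X (s, t)) (?c (s, t))) (at t)"
    if "(s, t) \<in> \<Omega>" for s t
    using data that unfolding improper_affine_data_def by blast+
  have \<gamma>s: "((\<lambda>s. \<gamma> (Complex s t)) has_real_derivative
        Im (G (Complex s t)) * Re (deriv F (Complex s t)) - Im (F (Complex s t)) * Re (deriv G (Complex s t))) (at s)"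
    and \<gamma>t: "((\<lambda>t. \<gamma> (Complex s t)) has_real_derivative
        Im (F (Complex s t)) * Im (deriv G (Complex s t)) - Im (G (Complex s t)) * Im (deriv F (Complex s t))) (at t)"
    if st: "Complex s t \<in> \<Omega>c" for s t
    using gd[OF st[unfolded mem]]
    by (simp_all add: g\<gamma> Xs[OF st[unfolded mem]] Xt[OF st[unfolded mem]] c bracket_eq algebra_simps)
  \<comment> \<open>Up to sign this is \<open>[X\<^sub>t, c]\<close>; the radius is chosen so that it does not vanish near the base point.\<close>
  define \<beta> where "\<beta> z = Im (deriv F z) * Im (G z) - Im (deriv G z) * Im (F z)" for z
  have "continuous_on \<Omega>c \<beta>" unfolding \<beta>_def[abs_def]
    by (intro continuous_intros holomorphic_on_imp_continuous_on F G holomorphic_deriv o\<Omega>c)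
  then have "open (\<Omega>c \<inter> \<beta> -` (- {0}))"
    by (rule continuous_open_preimage[OF _ o\<Omega>c]) (simp add: open_Compl)
  moreover have "Complex s0 t0 \<in> \<Omega>c \<inter> \<beta> -` (- {0})"
    using base(1) base_bracket by (auto simp: mem Xt[OF base(1)] c bracket_eq \<beta>_def)
  ultimately obtain r where r: "r > 0" "ball (Complex s0 t0) r \<subseteq> \<Omega>c \<inter> \<beta> -` (- {0})"
    using openE by blast
  show ?thesis
  proof (intro exI[of _ "r / 2"] conjI allI impI ballI)
    show "r / 2 > 0" using r by simp
    fix I J U \<tau> s t
    assume hyp: "open I \<and> s0 \<in> I \<and> I \<subseteq> ball s0 (r / 2) \<and>
      open J \<and> t0 \<in> J \<and> J \<subseteq> ball t0 (r / 2) \<and>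
      open U \<and> ?X (s0, t0) \<in> U \<and> U \<subseteq> ball (?X (s0, t0)) (r / 2) \<and>
      I \<times> J \<subseteq> \<Omega> \<and> implicit_solution ?X ?c I J U \<tau>"
      and s: "s \<in> I" and t: "t \<in> J" and xU: "?X (s, t) \<in> U"
    define x where "x = ?X (s, t)"
    define h where "h s' = ?J (s', \<tau> (s', x))" for s'
    have oIU: "open I" "open U" and IJ: "I \<times> J \<subseteq> \<Omega>" and sm: "smooth_on (I \<times> U) \<tau>" and \<tau>J: "\<tau> ` (I \<times> U) \<subseteq> J"
      and sol: "\<And>s t x. s \<in> I \<Longrightarrow> t \<in> J \<Longrightarrow> x \<in> U \<Longrightarrow> bracket (x - ?X (s, t)) (?c (s, t)) = 0 \<longleftrightarrow> t = \<tau> (s, x)"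
      using hyp by (auto simp: implicit_solution_def)
    have x: "x \<in> U" using xU by (simp add: x_def)
    have st: "(s, t) \<in> \<Omega>" using s t IJ by blast
    have \<tau>s: "\<tau> (s, x) = t" using sol[OF s t x] by (simp add: x_def bracket_eq)
    define p where "p = Complex s t"
    have p: "p \<in> \<Omega>c" using st by (simp add: p_def mem)
    have "p \<in> ball (Complex s0 t0) r"
    proof -
      have "\<bar>s0 - s\<bar> < r / 2" "\<bar>t0 - t\<bar> < r / 2" using hyp s t by (auto simp: dist_real_def subset_iff)
      moreover have "cmod (Complex s0 t0 - p) \<le> \<bar>s0 - s\<bar> + \<bar>t0 - t\<bar>"
        using cmod_le[of "Complex s0 t0 - p"] by (simp add: p_def)
      ultimately show ?thesis by (simp add: dist_norm)
    qed
    then have "\<beta> p \<noteq> 0" using r(2) by blast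
    then have transversal: "Im (deriv F p) * Im (G p) \<noteq> Im (deriv G p) * Im (F p)" by (simp add: \<beta>_def)
    define z where "z \<sigma> = Complex \<sigma> (\<tau> (\<sigma>, x))" for \<sigma>
    define \<tau>1 where "\<tau>1 \<sigma> = frechet_derivative \<tau> (at (\<sigma>, x)) (1, 0)" for \<sigma>
    have slice: "((\<lambda>\<sigma>. f (\<sigma>, x)) has_real_derivative frechet_derivative f (at (\<sigma>, x)) (1, 0)) (at \<sigma>)"
      if "smooth_on (I \<times> U) f" "\<sigma> \<in> I" for f :: "real \<times> plane \<Rightarrow> real" and \<sigma>
      by (rule smooth_on_first_partial[OF that(1)]) (use that x in simp)
    have \<tau>d: "((\<lambda>\<sigma>. \<tau> (\<sigma>, x)) has_real_derivative \<tau>1 \<sigma>) (at \<sigma>)" if "\<sigma> \<in> I" for \<sigma>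
      unfolding \<tau>1_def by (rule slice[OF sm that])
    obtain \<tau>2 where \<tau>2: "(\<tau>1 has_real_derivative \<tau>2) (at s)"
      using slice[OF smooth_on_directional[OF sm] s, of "(1, 0)"] unfolding \<tau>1_def[abs_def] by blast
    have Cd: "((\<lambda>\<sigma>. Complex (a \<sigma>) (b \<sigma>)) has_vector_derivative Complex a' b') (at \<sigma>)"
      if "(a has_real_derivative a') (at \<sigma>)" "(b has_real_derivative b') (at \<sigma>)" for a b a' b' \<sigma>
      using that by (simp add: has_vector_derivative_complex_iff has_real_derivative_iff_has_vector_derivative)
    have nI: "\<forall>\<^sub>F \<sigma> in nhds s. \<sigma> \<in> I" using oIU(1) s eventually_nhds by blast
    have zd: "\<forall>\<^sub>F \<sigma> in nhds s. (z has_vector_derivative Complex 1 (\<tau>1 \<sigma>)) (at \<sigma>)"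
      using nI by eventually_elim (auto simp: z_def[abs_def] intro!: Cd \<tau>d derivative_eq_intros)
    have z'd: "((\<lambda>\<sigma>. Complex 1 (\<tau>1 \<sigma>)) has_vector_derivative Complex 0 \<tau>2) (at s)"
      by (rule Cd[OF DERIV_const \<tau>2])
    have z0: "Complex 1 (\<tau>1 s) \<noteq> 0" by (simp add: complex_eq_iff)
    have zs: "z s = p" by (simp add: z_def \<tau>s p_def)
    have conormal: "\<forall>\<^sub>F \<sigma> in nhds s. (Re (F p) - Re (F (z \<sigma>))) * Im (G (z \<sigma>)) = (Re (G p) - Re (G (z \<sigma>))) * Im (F (z \<sigma>))"
      using nI
    proof eventually_elim
      case (elim \<sigma>)
      have "\<tau> (\<sigma>, x) \<in> J" using elim x \<tau>J by auto
      then have "bracket (x - ?X (\<sigma>, \<tau> (\<sigma>, x))) (?c (\<sigma>, \<tau> (\<sigma>, x))) = 0"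
        using sol[OF elim _ x] by simp
      then show ?case
        by (simp add: bracket_eq c x_def planar_map_def AF z_def p_def algebra_simps)
    qed
    have hev: "\<forall>\<^sub>F \<sigma> in nhds s. h \<sigma> = caustic_density F G (z \<sigma>)"
      using nI
    proof eventually_elim
      case (elim \<sigma>)
      have "\<tau> (\<sigma>, x) \<in> J" using elim x \<tau>J by auto
      then have "(\<sigma>, \<tau> (\<sigma>, x)) \<in> \<Omega>" using elim IJ by blast
      then show ?case by (simp add: h_def J z_def)
    qed
    have nd: "\<not> (caustic_density F G has_derivative (\<lambda>_. 0)) (at p)" if \<delta>0: "?J (s, t) = 0"
    proof
      assume d: "(caustic_density F G has_derivative (\<lambda>_. 0)) (at p)"
      have Jc: "?J y = caustic_density F G (Complex (fst y) (snd y))" if "y \<in> \<Omega>" for y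
        using J[of "fst y" "snd y"] that by simp
      have "((\<lambda>y::plane. Complex (fst y) (snd y)) has_derivative (\<lambda>y. Complex (fst y) (snd y))) (at (s, t))"
        unfolding Complex_eq by (auto intro!: derivative_eq_intros)
      from has_derivative_compose[OF this, of "caustic_density F G" "\<lambda>_. 0"] d
      have "((\<lambda>y. caustic_density F G (Complex (fst y) (snd y))) has_derivative (\<lambda>_. 0)) (at (s, t))"
        by (simp add: p_def)
      then have dJ: "(?J has_derivative (\<lambda>_. 0)) (at (s, t))"
        by (rule has_derivative_transform_within_open[OF _ o\<Omega> st]) (simp add: Jc)
      have "((\<lambda>s. (s, t)) has_derivative (\<lambda>v. (v, 0))) (at s)" "((\<lambda>t. (s, t)) has_derivative (\<lambda>v. (0, v))) (at t)"
        by (intro has_derivative_Pair has_derivative_ident has_derivative_const)+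
      from has_derivative_compose[OF this(1) dJ] has_derivative_compose[OF this(2) dJ]
      have "((\<lambda>s. ?J (s, t)) has_vector_derivative 0) (at s)" "((\<lambda>t. ?J (s, t)) has_vector_derivative 0) (at t)"
        by (simp_all add: has_vector_derivative_def)
      then have "partial_s ?J (s, t) = 0" "partial_t ?J (s, t) = 0"
        by (simp_all add: partial_s_def partial_t_def vector_derivative_at)
      then show False using nondegenerate[OF st \<delta>0] by simp
    qed
    have q: "affine_map A B g y = lifted_map F G \<gamma> (Complex (fst y) (snd y))" for y
      by (simp add: affine_map_def lifted_map_def AF[of "fst y" "snd y", simplified] g\<gamma>[of "fst y" "snd y", simplified])
    have small: "small_images \<Omega> (affine_map A B g) (s, t)
        (\<lambda>M. diffeomorphic_germs M (affine_map A B g (s, t)) NF (0, 0, 0))"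
      if "small_germs \<Omega>c (lifted_map F G \<gamma>) p NF" for NF
    proof -
      from that obtain N0 where N0: "open N0 \<and> p \<in> N0 \<and> N0 \<subseteq> \<Omega>c \<and> (\<forall>N. open N \<and> p \<in> N \<and> N \<subseteq> N0 \<longrightarrow>
          diffeomorphic_germs (lifted_map F G \<gamma> ` N) (lifted_map F G \<gamma> p) NF 0)" ..
      note N = N0[THEN conjunct2, THEN conjunct2, THEN conjunct2, rule_format]
      let ?cx = "\<lambda>y::plane. Complex (fst y) (snd y)" and ?rl = "\<lambda>z. (Re z, Im z)"
      have "continuous_on UNIV ?cx" unfolding Complex_eq by (intro continuous_intros)
      then have "open (?cx -` N0)" using open_vimage N0 by blast
      moreover have "?cx -` N0 \<subseteq> \<Omega>" using N0 by (auto simp: \<Omega>c_def)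
      moreover have "diffeomorphic_germs (affine_map A B g ` N') (affine_map A B g (s, t)) NF (0, 0, 0)"
        if N': "open N'" "(s, t) \<in> N'" "N' \<subseteq> ?cx -` N0" for N'
      proof -
        have "continuous_on UNIV ?rl" by (intro continuous_intros)
        then have "open (?rl -` N')" using open_vimage N'(1) by blast
        moreover have "p \<in> ?rl -` N'" using N'(2) by (simp add: p_def)
        moreover have "?rl -` N' \<subseteq> N0" using N'(3) by auto
        ultimately have "diffeomorphic_germs (lifted_map F G \<gamma> ` (?rl -` N')) (lifted_map F G \<gamma> p) NF 0"
          by (intro N conjI)
        moreover have "lifted_map F G \<gamma> ` (?rl -` N') = affine_map A B g ` N'"
        proof -
          have "?rl -` N' = ?cx ` N'" by (force simp: image_iff)
          then show ?thesis by (simp add: image_image q)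
        qed
        ultimately show ?thesis by (simp add: q p_def zero_prod_def)
      qed
      moreover have "(s, t) \<in> ?cx -` N0" using N0 by (simp add: p_def)
      ultimately show ?thesis unfolding small_images_def by (intro exI[of _ "?cx -` N0"]) simp
    qed
    have \<delta>p: "caustic_density F G p = 0" if "?J (s, t) = 0" using that J[OF st] by (simp add: p_def)
    have 1: "small_images \<Omega> (affine_map A B g) (s, t) (\<lambda>M. cuspidal_edge_at M (affine_map A B g (s, t)))"
      if "?J (s, t) = 0" "deriv h s \<noteq> 0"
      unfolding cuspidal_edge_at_def
      by (rule small, rule singularities_of_lifted_map(1)[OF o\<Omega>c p F G _ _ zd z'd z0 zs conormal transversal
            \<delta>p[OF that(1)] hev that(2)]) (rule \<gamma>s \<gamma>t; assumption)+
    have 2: "small_images \<Omega> (affine_map A B g) (s, t) (\<lambda>M. swallowtail_at M (affine_map A B g (s, t)))"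
      if "?J (s, t) = 0" "deriv h s = 0" "deriv (deriv h) s \<noteq> 0"
      unfolding swallowtail_at_def
      by (rule small, rule singularities_of_lifted_map(2)[OF o\<Omega>c p F G _ _ zd z'd z0 zs conormal transversal
            \<delta>p[OF that(1)] hev that(2,3) nd[OF that(1)]]) (rule \<gamma>s \<gamma>t; assumption)+
    have hh: "h = (\<lambda>s'. ?J (s', \<tau> (s', ?X (s, t))))" by (simp add: h_def[abs_def] x_def)
    show "let \<delta> = ?J; x = ?X (s, t); h = (\<lambda>s'. \<delta> (s', \<tau> (s', x)))
          in (\<delta> (s, t) = 0 \<and> deriv h s \<noteq> 0 \<longrightarrow>
                small_images \<Omega> (affine_map A B g) (s, t)
                  (\<lambda>M. cuspidal_edge_at M (affine_map A B g (s, t)))) \<and>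
             (\<delta> (s, t) = 0 \<and> deriv h s = 0 \<and> deriv (deriv h) s \<noteq> 0 \<longrightarrow>
                small_images \<Omega> (affine_map A B g) (s, t)
                  (\<lambda>M. swallowtail_at M (affine_map A B g (s, t))))"
      unfolding Let_def hh[symmetric] using 1 2 by blast
  qed
qed

end
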